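(* Let $f$ be a checkerboard IC-net. Then the following properties hold: (i) All net-squares are circumscribed. (ii) Net-squares $\square_{i,j}^c$ and $\square_{i-l,j-l}^{c+2l}$, where $l$ is odd, are perspective. (iii) The points $f_{i,j}$, where $i+j$ is an odd constant, lie on a conic. The points $f_{i,j}$, where $i-j$ is an even constant, lie on a conic as well. (iv) (Ivory-type theorem) For any $(i,j)\in\mathbb{Z}^2$ with even $i+j$ and any even integer $c$ one has $$d_C(\square_{i-c,j},\square_{i+c,j}) = d_C(\square_{i,j-c},\square_{i,j+c}).$$ (v) Let $\omega_{i,j}$ be the inscribed circle of the unit net-square $\square_{i,j}$. Consider the cone in $\mathbb{R}^3$ intersecting the plane along $\omega_{i,j}$ at constant oriented angle (all the apexes $a_{i,j}$ of these cones lie in one half-space). Then all the apexes $\{a_{i,j} \mid i+j=4n,\ n\in\mathbb{Z}\}$ lie on a one-sheeted hyperboloid. The apexes $\{a_{i,j} \mid i+j=4n+2,\ n\in\mathbb{Z}\}$ lie on a one-sheeted hyperboloid as well. (vi) The centers $o_{i,j}$ of the incircles of a checkerboard IC-net build a circle-conical net, i.e. a net that is simultaneously circular and conical.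
   Context: Let $\mathbb{P}=\{(i,j)\in\mathbb{Z}^2 \mid m_1<i<m_2,\ n_1<j<n_2\}$ be a rectangle in $\mathbb{Z}^2$; for $f:\mathbb{P}\to\mathbb{R}^2$ write $f_{i,j}=f(i,j)$. All properties are understood for indices for which the objects involved are defined. A quadrilateral is circumscribed if it possesses an inscribed circle (touching its four sides). A checkerboard IC-net is a map $f:\mathbb{P}\to\mathbb{R}^2$ such that: (1) for any integer $i$ the points $\{f_{i,j}\}_j$ lie on a straight line preserving the order, i.e. $f_{i,j}$ lies between $f_{i,j-1}$ and $f_{i,j+1}$, and likewise for the points $\{f_{i,j}\}_i$ for any $j$; these lines are called the lines of the checkerboard IC-net; (2) for any integers $i,j$ of the same parity the quadrilateral with vertices $f_{i,j},f_{i+1,j},f_{i+1,j+1},f_{i,j+1}$ is circumscribed. The quadrilaterals $\square_{i,j}$ with vertices $f_{i,j},f_{i+1,j},f_{i+1,j+1},f_{i,j+1}$ with $i+j$ even are called unit net-squares; the quadrilaterals $\square_{i,j}^c$ with vertices $f_{i,j},f_{i+c,j},f_{i+c,j+c},f_{i,j+c}$ with $i+j$ even and $c$ odd are called net-squares. The incircle of the unit net-square $\square_{i,j}$ is $\omega_{i,j}$ and its center is $o_{i,j}$ ($i+j$ even). Two net-squares are perspective if the lines joining their corresponding vertices pass through one common point. The distance $d_C(\square_{a,b},\square_{c,d})$ between two unit net-squares is the distance between the tangent points on a common exterior tangent line to the circles $\omega_{a,b}$ and $\omega_{c,d}$ inscribed in $\square_{a,b}$ and $\square_{c,d}$ respectively.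 In case $a=c$ or $b=d$ these tangent lines are lines of the checkerboard IC-net. In (v) the plane $\mathbb{R}^2$ is embedded in $\mathbb{R}^3$ and the cones are cones of revolution. The net of centers has vertices $o_{i,j}$, $i+j$ even, and quadrilaterals $(o_{i,j}\,o_{i+1,j+1}\,o_{i,j+2}\,o_{i-1,j+1})$. It is circular if each such quadrilateral is inscribed in a circle; conical nets in the plane are characterized by the condition that the sums of two opposite angles at a vertex are equal (and equal to $\pi$).
   Formalization: In (v) the apex families are i, j both even and i, j both odd, instead of i+j=4n and i+j=4n+2, and "one-sheeted hyperboloid" includes degenerate ones (quadrics that are limits of one-sheeted hyperboloids); as printed (v) fails, e.g. for the square grid. *)

theory Defs
  imports "HOL-Analysis.Analysis"
begin

section \<open>Circumscribed quadrilaterals\<close>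

type_synonym quad = "(real^2) \<times> (real^2) \<times> (real^2) \<times> (real^2)"

text \<open>The circle touches the side itself, not merely the line carrying it.\<close>

definition touches_side :: "real^2 \<Rightarrow> real \<Rightarrow> real^2 \<Rightarrow> real^2 \<Rightarrow> bool" where
  "touches_side p r A B \<longleftrightarrow>
     A \<noteq> B \<and> (\<exists>T \<in> closed_segment A B. affine hull {A, B} \<inter> sphere p r = {T})"

text \<open>No three of the four vertices are collinear. A nondegenerate quadrilateral whose four sides
  touch a circle is automatically convex and contains the circle: for a crossed or a nonconvex
  quadrilateral some tangent point lies only on the extension of a side.\<close>

fun nondegenerate :: "quad \<Rightarrow> bool" where
  "nondegenerate (A, B, C, D) \<longleftrightarrow>
     \<not> collinear {A, B, C} \<and> \<not> collinear {B, C, D} \<and> \<not> collinear {C, D, A} \<and> \<not> collinear {D, A, B}"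

fun inscribed_circle :: "quad \<Rightarrow> real^2 \<Rightarrow> real \<Rightarrow> bool" where
  "inscribed_circle (A, B, C, D) p r \<longleftrightarrow>
     nondegenerate (A, B, C, D) \<and> 0 < r \<and>
     touches_side p r A B \<and> touches_side p r B C \<and> touches_side p r C D \<and> touches_side p r D A"

definition circumscribed :: "quad \<Rightarrow> bool" where
  "circumscribed Q \<longleftrightarrow> (\<exists>p r. inscribed_circle Q p r)"

text \<open>The inscribed circle of a quadrilateral is unique, if it exists.\<close>

definition incenter :: "quad \<Rightarrow> real^2" where
  "incenter Q = (THE p. \<exists>r. inscribed_circle Q p r)"

fun perspective :: "quad \<Rightarrow> quad \<Rightarrow> bool" where
  "perspective (A, B, C, D) (A', B', C', D') \<longleftrightarrow>
     (\<exists>X. X \<in> affine hull {A, A'} \<and> X \<in> affine hull {B, B'} \<and>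
          X \<in> affine hull {C, C'} \<and> X \<in> affine hull {D, D'})"

section \<open>Checkerboard IC-nets\<close>

definition rectangle :: "int \<Rightarrow> int \<Rightarrow> int \<Rightarrow> int \<Rightarrow> (int \<times> int) set" where
  "rectangle m1 m2 n1 n2 = {m1<..<m2} \<times> {n1<..<n2}"

definition net_square :: "(int \<Rightarrow> int \<Rightarrow> real^2) \<Rightarrow> int \<Rightarrow> int \<Rightarrow> int \<Rightarrow> quad" where
  "net_square f i j c = (f i j, f (i + c) j, f (i + c) (j + c), f i (j + c))"

text \<open>\<open>f\<close> is a total function, but only its values on the rectangle \<open>P\<close> are meaningful. The following
  predicate says that \<open>i, j, c\<close> index a net-square, all of whose vertices are defined.\<close>

definition is_net_square :: "(int \<times> int) set \<Rightarrow> int \<Rightarrow> int \<Rightarrow> int \<Rightarrow> bool" where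
  "is_net_square P i j c \<longleftrightarrow> even (i + j) \<and> odd c \<and> {i, i + c} \<times> {j, j + c} \<subseteq> P"

abbreviation is_unit_square :: "(int \<times> int) set \<Rightarrow> int \<Rightarrow> int \<Rightarrow> bool" where
  "is_unit_square P i j \<equiv> is_net_square P i j 1"

abbreviation unit_square :: "(int \<Rightarrow> int \<Rightarrow> real^2) \<Rightarrow> int \<Rightarrow> int \<Rightarrow> quad" where
  "unit_square f i j \<equiv> net_square f i j 1"

definition checkerboard_IC_net :: "(int \<times> int) set \<Rightarrow> (int \<Rightarrow> int \<Rightarrow> real^2) \<Rightarrow> bool" where
  "checkerboard_IC_net P f \<longleftrightarrow>
     (\<forall>i. collinear {f i j | j. (i, j) \<in> P}) \<and>
     (\<forall>j. collinear {f i j | i. (i, j) \<in> P}) \<and>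
     (\<forall>i j. (i, j - 1) \<in> P \<and> (i, j) \<in> P \<and> (i, j + 1) \<in> P \<longrightarrow>
        f i j \<in> open_segment (f i (j - 1)) (f i (j + 1))) \<and>
     (\<forall>i j. (i - 1, j) \<in> P \<and> (i, j) \<in> P \<and> (i + 1, j) \<in> P \<longrightarrow>
        f i j \<in> open_segment (f (i - 1) j) (f (i + 1) j)) \<and>
     (\<forall>i j. is_unit_square P i j \<longrightarrow> circumscribed (unit_square f i j))"

section \<open>Distance between circumscribed quadrilaterals\<close>

text \<open>\<open>T\<close> and \<open>T'\<close> are the tangent points on a common tangent line \<open>{x. n \<bullet> x = h}\<close> which is exterior,
  i.e. has both circles on the same side. All common exterior tangents give the same distance.\<close>

definition exterior_tangent_points ::
  "real^2 \<Rightarrow> real \<Rightarrow> real^2 \<Rightarrow> real \<Rightarrow> real^2 \<Rightarrow> real^2 \<Rightarrow> bool" where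
  "exterior_tangent_points p r p' r' T T' \<longleftrightarrow>
     (\<exists>n h. n \<noteq> 0 \<and> {x. n \<bullet> x = h} \<inter> sphere p r = {T} \<and> {x. n \<bullet> x = h} \<inter> sphere p' r' = {T'} \<and>
            0 < (n \<bullet> p - h) * (n \<bullet> p' - h))"

definition d_C :: "quad \<Rightarrow> quad \<Rightarrow> real" where
  "d_C Q Q' = (THE d. \<exists>p r p' r' T T'. inscribed_circle Q p r \<and> inscribed_circle Q' p' r' \<and>
     exterior_tangent_points p r p' r' T T' \<and> d = dist T T')"

section \<open>Conics and one-sheeted hyperboloids\<close>

definition quadric :: "real^'n^'n \<Rightarrow> real^'n \<Rightarrow> real \<Rightarrow> (real^'n) set" where
  "quadric M b c = {x. x \<bullet> (M *v x) + b \<bullet> x + c = 0}"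

text \<open>Degenerate conics, such as pairs of lines, are included: if all lines of a checkerboard IC-net
  belong to two parallel classes, its diagonals may be straight.\<close>

definition conic :: "(real^2) set \<Rightarrow> bool" where
  "conic S \<longleftrightarrow> (\<exists>M b c. transpose M = M \<and> M \<noteq> 0 \<and> S = quadric M b c)"

text \<open>The affine images of the standard hyperboloid; by the principal axis theorem these are the
  one-sheeted hyperboloids with arbitrary axes.\<close>

definition one_sheeted_hyperboloid :: "(real^3) set \<Rightarrow> bool" where
  "one_sheeted_hyperboloid S \<longleftrightarrow>
     (\<exists>(g :: real^3 \<Rightarrow> real^3) v. linear g \<and> bij g \<and>
        S = (\<lambda>x. v + g x) ` {x. (x$1)\<^sup>2 + (x$2)\<^sup>2 - (x$3)\<^sup>2 = 1})"

text \<open>A one-sheeted hyperboloid, possibly degenerate: a quadric with an equation that is the limit of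
  equations of one-sheeted hyperboloids. Degenerate ones cannot be excluded. For the square grid all
  apexes considered below lie in a plane parallel to the plane of the net, and a lattice in such a
  plane is not contained in a conic, hence not in a proper hyperboloid.\<close>

definition limit_one_sheeted_hyperboloid :: "(real^3) set \<Rightarrow> bool" where
  "limit_one_sheeted_hyperboloid S \<longleftrightarrow>
     (\<exists>M b c Ms bs cs. transpose M = M \<and> M \<noteq> 0 \<and> S = quadric M b c \<and>
        Ms \<longlonglongrightarrow> M \<and> bs \<longlonglongrightarrow> b \<and> cs \<longlonglongrightarrow> c \<and>
        (\<forall>k::nat. one_sheeted_hyperboloid (quadric (Ms k) (bs k) (cs k))))"

section \<open>Cones over the incircles\<close>

definition embed :: "real^2 \<Rightarrow> real^3" where
  "embed x = vector [x$1, x$2, 0]"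

text \<open>The (double) cone of revolution with apex \<open>a\<close>, axis perpendicular to the plane \<open>x$3 = 0\<close> and
  generators at angle \<open>\<theta>\<close> to that plane. A cone of revolution meets the plane in a circle only if its
  axis is perpendicular to the plane.\<close>

definition revolution_cone :: "real^3 \<Rightarrow> real \<Rightarrow> (real^3) set" where
  "revolution_cone a \<theta> = {x. \<bar>x$3 - a$3\<bar> = sin \<theta> * norm (x - a)}"

text \<open>The orientation of the angle is encoded by the half-space that contains the apex.\<close>

definition cone_apex :: "real \<Rightarrow> quad \<Rightarrow> real^3 \<Rightarrow> bool" where
  "cone_apex \<theta> Q a \<longleftrightarrow>
     (\<exists>p r. inscribed_circle Q p r \<and> 0 < a$3 \<and>
        revolution_cone a \<theta> \<inter> {x. x$3 = 0} = embed ` sphere p r)"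

section \<open>Circular and conical nets\<close>

definition concyclic :: "(real^2) set \<Rightarrow> bool" where
  "concyclic S \<longleftrightarrow> (\<exists>p r. 0 < r \<and> S \<subseteq> sphere p r)"

definition angle_at :: "real^2 \<Rightarrow> real^2 \<Rightarrow> real^2 \<Rightarrow> real" where
  "angle_at A V B = arccos ((A - V) \<bullet> (B - V) / (norm (A - V) * norm (B - V)))"

definition net_of_centers :: "(int \<Rightarrow> int \<Rightarrow> real^2) \<Rightarrow> int \<Rightarrow> int \<Rightarrow> real^2" where
  "net_of_centers f i j = incenter (unit_square f i j)"

text \<open>In the next two definitions the net \<open>z\<close> lives on the index set \<open>I\<close>, a set of pairs with even sum;
  \<open>(i, j)\<close> is adjacent to \<open>(i \<plusminus> 1, j \<plusminus> 1)\<close>.\<close>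

definition circular_net :: "(int \<times> int) set \<Rightarrow> (int \<Rightarrow> int \<Rightarrow> real^2) \<Rightarrow> bool" where
  "circular_net I z \<longleftrightarrow>
     (\<forall>i j. {(i, j), (i + 1, j + 1), (i, j + 2), (i - 1, j + 1)} \<subseteq> I \<longrightarrow>
        concyclic {z i j, z (i + 1) (j + 1), z i (j + 2), z (i - 1) (j + 1)})"

definition conical_net :: "(int \<times> int) set \<Rightarrow> (int \<Rightarrow> int \<Rightarrow> real^2) \<Rightarrow> bool" where
  "conical_net I z \<longleftrightarrow>
     (\<forall>i j. {(i, j), (i + 1, j + 1), (i - 1, j + 1), (i - 1, j - 1), (i + 1, j - 1)} \<subseteq> I \<longrightarrow>
        angle_at (z (i + 1) (j + 1)) (z i j) (z (i - 1) (j + 1)) +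
        angle_at (z (i - 1) (j - 1)) (z i j) (z (i + 1) (j - 1)) = pi \<and>
        angle_at (z (i - 1) (j + 1)) (z i j) (z (i - 1) (j - 1)) +
        angle_at (z (i + 1) (j - 1)) (z i j) (z (i + 1) (j + 1)) = pi)"

definition circle_conical_net :: "(int \<times> int) set \<Rightarrow> (int \<Rightarrow> int \<Rightarrow> real^2) \<Rightarrow> bool" where
  "circle_conical_net I z \<longleftrightarrow> circular_net I z \<and> conical_net I z"

end

theory Submission
  imports Defs
begin

text \<open>The lines of a net are described by unit normals \<open>u\<^sub>i\<close>, \<open>v\<^sub>j\<close> that point towards increasing indices. Along a
  line that touches two circles, the distance of the tangent points is the same as along the other
  tangent of the pair; hence the sum \<open>AB - BC + CD - DA\<close> of a net-square of size \<open>c\<close> equals the one of the concentric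
  net-square of size \<open>c - 2\<close>, and Pitot's theorem together with its converse gives (i) by induction. Adding up
  such relations for five net-squares gives (iv).

  Give the lines alternating orientations and lift a circle with center \<open>p\<close> and signed radius \<open>\<rho>\<close> to the point \<open>(p, \<rho>)\<close> of
  three-space. The circles that touch an oriented line form a plane. So (ii) becomes Monge's theorem on centers of
  similitude. In (v), the intersections of the planes of consecutive columns and of consecutive rows are two families of
  lines that meet each other, that is, two rulings of a quadric. In (iii), the planes of the two lines through a
  vertex intersect in a line, and by (i) these lines, for even and for odd vertices of a diagonal, are again two rulings of a
  quadric, whose section with the plane \<open>\<rho> = 0\<close> contains the diagonal. For (vi), consecutive centers lie on the
  bisectors of the lines of the net.

  All this needs one orientation for the whole net, which exists if there are at least three rows and three columns; with only
  two rows, two consecutive rows may cross between unit net-squares.\<close>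

section \<open>Circumscribed quadrilaterals in terms of signed distances\<close>

text \<open>Touching a segment gives a distance only up to sign. The first task is therefore to show
  that an inscribed circle forces the quadrilateral to turn the same way at all corners, with the
  center on the same side of all four lines; afterwards each tangency is a linear equation
  \<open>n \<bullet> p - h = r\<close>, and tangency to the segments can be recovered from such
  equations and the turning directions. The second obstacle is degeneracy. The construction of a
  quadric from two families of lines relies on distinct intersection points, and Monge's theorem on
  different signed radii; since columns may cross far away, such facts are derived from the order of
  the columns between two rows. Where a quadric or conic still degenerates, a pair of planes or the
  square of an affine function takes its place. Nets with at most two rows or columns are treated
  directly: they have only unit net-squares, diagonals of at most two points, and incircles that
  touch two fixed lines.\<close>

text \<open>The rotations by a right angle; the sign \<open>s\<close>, which is \<open>1\<close> or \<open>-1\<close>, keeps track of the orientation.\<close>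

definition rot :: "real \<Rightarrow> real^2 \<Rightarrow> real^2" where
  "rot s x = vector [- s * x$2, s * x$1]"

lemma rot_nth [simp]: "rot s x $ 1 = - s * x$2" "rot s x $ 2 = s * x$1"
  by (simp_all add: rot_def)

lemma inner2: "(x::real^2) \<bullet> y = x$1 * y$1 + x$2 * y$2"
  by (simp add: inner_vec_def sum_2)

lemma eq2_iff: "(x::real^2) = y \<longleftrightarrow> x$1 = y$1 \<and> x$2 = y$2"
  by (simp add: vec_eq_iff forall_2)

lemma norm_eq_1_iff2: "norm (x::real^2) = 1 \<longleftrightarrow> x$1 * x$1 + x$2 * x$2 = 1"
  by (simp add: norm_eq_sqrt_inner inner2)

text \<open>If the only common point \<open>T\<close> of line and circle were not the foot of the
  perpendicular from \<open>p\<close>, its mirror image \<open>T'\<close> in that foot would be a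
  second common point.\<close>

lemma touches_sideE:
  assumes "touches_side p r A B"
  obtains t where "0 \<le> t" "t \<le> 1" "(p - (A + t *\<^sub>R (B - A))) \<bullet> (B - A) = 0"
    "(p - (A + t *\<^sub>R (B - A))) \<bullet> (p - (A + t *\<^sub>R (B - A))) = r^2" "A \<noteq> B"
proof -
  from assms obtain T where T: "T \<in> closed_segment A B" and I: "affine hull {A, B} \<inter> sphere p r = {T}"
    and AB: "A \<noteq> B" by (auto simp: touches_side_def)
  from T obtain t where t: "0 \<le> t" "t \<le> 1" and "T = (1 - t) *\<^sub>R A + t *\<^sub>R B"
    by (auto simp: closed_segment_def)
  then have Tt: "T = A + t *\<^sub>R (B - A)" by (simp add: algebra_simps)
  define d where "d = B - A"
  define e where "e = ((p - T) \<bullet> d) / (d \<bullet> d)"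
  have dd: "d \<bullet> d > 0" using AB by (simp add: d_def)
  have "T \<in> sphere p r" using I by blast
  then have nT: "norm (p - T) = r" by (simp add: dist_norm)
  then have nT2: "(p - T) \<bullet> (p - T) = r^2" by (simp add: dot_square_norm)
  have r0: "r \<ge> 0" using nT by auto
  define T' where "T' = T + (2 * e) *\<^sub>R d"
  have "T' = A + (t + 2 * e) *\<^sub>R (B - A)" by (simp add: T'_def Tt d_def algebra_simps)
  then have "T' = (1 - (t + 2 * e)) *\<^sub>R A + (t + 2 * e) *\<^sub>R B" by (simp add: algebra_simps)
  then have aff: "T' \<in> affine hull {A, B}" unfolding affine_hull_2 by force
  have "(p - T') \<bullet> (p - T') = (p - T) \<bullet> (p - T) - 4 * e * ((p - T) \<bullet> d) + 4 * e^2 * (d \<bullet> d)"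
    by (simp add: T'_def inner_diff inner_add power2_eq_square algebra_simps inner_commute)
  also have "\<dots> = r^2" using dd by (simp add: e_def nT2 power2_eq_square)
  finally have "(norm (p - T'))^2 = r^2" by (simp add: dot_square_norm)
  then have "norm (p - T') = r" using r0 by (simp add: power2_eq_iff_nonneg)
  then have "T' \<in> sphere p r" by (simp add: dist_norm)
  with aff I have "T' = T" by blast
  then have "e = 0" using dd by (auto simp: T'_def)
  then have "(p - T) \<bullet> d = 0" using dd by (simp add: e_def)
  then show ?thesis using that t nT2 AB unfolding Tt d_def by blast
qed

text \<open>By Pythagoras the squared distance from \<open>p\<close> exceeds \<open>r^2\<close> by
  \<open>(w - t)^2 |B - A|^2\<close>, so the foot is the only point of the line at distance
  \<open>r\<close>.\<close>

lemma touches_sideI: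
  assumes "A \<noteq> B" "0 \<le> t" "t \<le> 1" "0 < r" and perp: "(p - (A + t *\<^sub>R (B - A))) \<bullet> (B - A) = 0"
    and rr: "(p - (A + t *\<^sub>R (B - A))) \<bullet> (p - (A + t *\<^sub>R (B - A))) = r^2"
  shows "touches_side p r A B"
proof -
  define T where "T = A + t *\<^sub>R (B - A)"
  have sq: "(p - (A + w *\<^sub>R (B - A))) \<bullet> (p - (A + w *\<^sub>R (B - A)))
      = r^2 + (w - t)^2 * ((B - A) \<bullet> (B - A))" for w
  proof -
    have *: "p - (A + w *\<^sub>R (B - A)) = (p - T) - (w - t) *\<^sub>R (B - A)"
      by (simp add: T_def algebra_simps)
    show ?thesis unfolding * using perp rr unfolding T_def[symmetric]
      by (simp add: inner2 power2_eq_square) algebra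
  qed
  have Tc: "T = (1 - t) *\<^sub>R A + t *\<^sub>R B" by (simp add: T_def algebra_simps)
  then have seg: "T \<in> closed_segment A B" using assms by (auto simp: closed_segment_def)
  have "affine hull {A, B} \<inter> sphere p r = {T}"
  proof (intro equalityI subsetI)
    fix x assume "x \<in> affine hull {A, B} \<inter> sphere p r"
    then obtain a b where ab: "x = a *\<^sub>R A + b *\<^sub>R B" "a + b = 1" and n: "norm (p - x) = r"
      by (auto simp: affine_hull_2 dist_norm)
    have x: "x = A + b *\<^sub>R (B - A)" using ab by (simp add: algebra_simps flip: scaleR_add_left)
    have "(p - x) \<bullet> (p - x) = r^2" using n by (simp add: dot_square_norm)
    then have "b = t" using sq[of b] \<open>A \<noteq> B\<close> unfolding x by simp
    then show "x \<in> {T}" by (simp add: x T_def)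
  next
    fix x assume "x \<in> {T}"
    then have x: "x = T" by simp
    have "(norm (p - T))^2 = r^2" using rr unfolding T_def by (simp add: dot_square_norm)
    then have "norm (p - T) = r" using \<open>0 < r\<close> by (simp add: power2_eq_iff_nonneg)
    moreover have "T \<in> affine hull {A, B}"
      using Tc unfolding affine_hull_2 by force
    ultimately show "x \<in> affine hull {A, B} \<inter> sphere p r" by (simp add: x dist_norm)
  qed
  then show ?thesis using seg assms by (auto simp: touches_side_def)
qed

text \<open>\<open>D\<close> and \<open>E\<close> are the directions of the incoming and outgoing
  side at a vertex, and \<open>w\<close> leads from the vertex to the center. Because the tangent
  points lie on the segments, the tangent lengths satisfy \<open>a = - b\<close>; opposite signed
  distances would then make the cross product of \<open>D\<close> and \<open>E\<close> vanish by the
  identity \<open>X\<close>.\<close>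

lemma tangent_corner:
  fixes D E w :: "real^2"
  assumes "norm D = 1" "norm E = 1" "D \<bullet> w \<le> 0" "E \<bullet> w \<ge> 0" "(rot 1 D \<bullet> w)^2 = r^2"
    "(rot 1 E \<bullet> w)^2 = r^2" "r > 0" "rot 1 D \<bullet> E \<noteq> 0"
  shows "rot 1 E \<bullet> w = rot 1 D \<bullet> w \<and> (rot 1 D \<bullet> E) * (rot 1 D \<bullet> w) > 0"
proof -
  define \<sigma> where "\<sigma> = rot 1 D \<bullet> w"
  define \<sigma>' where "\<sigma>' = rot 1 E \<bullet> w"
  define a where "a = D \<bullet> w"
  define b where "b = E \<bullet> w"
  note defs = \<sigma>_def \<sigma>'_def a_def b_def inner2 rot_nth
  have D: "D$1 * D$1 + D$2 * D$2 = 1" and E: "E$1 * E$1 + E$2 * E$2 = 1"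
    using assms by (simp_all add: norm_eq_1_iff2)
  have W: "a^2 + \<sigma>^2 = w \<bullet> w" "b^2 + \<sigma>'^2 = w \<bullet> w"
    unfolding defs using D E by algebra+
  have "a^2 = b^2" using W assms(5,6) unfolding \<sigma>_def \<sigma>'_def by linarith
  then have ab: "a = - b" using assms(3,4) unfolding a_def b_def by (auto simp: power2_eq_iff)
  have ss: "\<sigma>' = \<sigma> \<or> \<sigma>' = - \<sigma>" using assms(5,6) unfolding \<sigma>_def \<sigma>'_def by (metis power2_eq_iff)
  have X: "(rot 1 D \<bullet> E) * (w \<bullet> w) = b * \<sigma> - a * \<sigma>'"
    unfolding defs by algebra
  have s0: "\<sigma>^2 > 0" using assms(5,7) unfolding \<sigma>_def by simp
  then have wpos: "w \<bullet> w > 0" using W by (smt (verit) zero_le_power2)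
  have "\<sigma>' = \<sigma>" using ss X ab wpos assms(8) by auto
  moreover have "(rot 1 D \<bullet> E) * \<sigma> * (w \<bullet> w) = 2 * b * \<sigma>^2"
    using X ab \<open>\<sigma>' = \<sigma>\<close> by (simp add: power2_eq_square algebra_simps)
  moreover have "b \<noteq> 0" using X ab \<open>\<sigma>' = \<sigma>\<close> assms(8) wpos by auto
  ultimately have "(rot 1 D \<bullet> E) * \<sigma> * (w \<bullet> w) > 0" using assms(4) s0 unfolding b_def by simp
  then show ?thesis using wpos \<open>\<sigma>' = \<sigma>\<close> unfolding \<sigma>_def \<sigma>'_def by (simp add: zero_less_mult_iff)
qed

lemma collinear3_iff2:
  fixes A B C :: "real^2"
  shows "collinear {A, B, C} \<longleftrightarrow> rot 1 (B - A) \<bullet> (C - B) = 0"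
proof -
  define x where "x = A - B"
  define y where "y = C - B"
  have "collinear {A, B, C} \<longleftrightarrow> collinear {0, x, y}"
    using collinear_3[of A B C] by (simp add: x_def y_def NO_MATCH_def)
  also have "\<dots> \<longleftrightarrow> \<bar>x \<bullet> y\<bar> = norm x * norm y" by (simp add: norm_cauchy_schwarz_equal)
  also have "\<dots> \<longleftrightarrow> (x \<bullet> y)^2 = (x \<bullet> x) * (y \<bullet> y)"
  proof -
    have "(x \<bullet> x) * (y \<bullet> y) = (norm x * norm y)^2" by (simp add: dot_square_norm power_mult_distrib)
    moreover have "norm x * norm y \<ge> 0" by simp
    ultimately show ?thesis by (auto simp: power2_eq_iff)
  qed
  also have "\<dots> \<longleftrightarrow> (rot 1 x \<bullet> y)^2 = 0"
  proof -
    have "(x \<bullet> x) * (y \<bullet> y) - (x \<bullet> y)^2 = (rot 1 x \<bullet> y)^2" by (simp add: inner2) algebra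
    then show ?thesis by linarith
  qed
  also have "\<dots> \<longleftrightarrow> rot 1 (B - A) \<bullet> (C - B) = 0"
    by (auto simp: inner2 x_def y_def algebra_simps)
  finally show ?thesis .
qed

lemma touches_side_unit:
  fixes a :: "real^2"
  assumes "touches_side p r A B" "B - A = l *\<^sub>R a" "l > 0" "norm a = 1"
  shows "a \<bullet> (p - B) \<le> 0" "a \<bullet> (p - A) \<ge> 0" "(rot 1 a \<bullet> (p - B))^2 = r^2"
    "rot 1 a \<bullet> (p - A) = rot 1 a \<bullet> (p - B)"
proof -
  from assms(1) obtain t where t: "0 \<le> t" "t \<le> 1" "(p - (A + t *\<^sub>R (B - A))) \<bullet> (B - A) = 0"
    "(p - (A + t *\<^sub>R (B - A))) \<bullet> (p - (A + t *\<^sub>R (B - A))) = r^2"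
    by (rule touches_sideE)
  have aa: "a \<bullet> a = 1" using assms(4) by (simp add: dot_square_norm)
  have B: "B = A + l *\<^sub>R a" using assms(2) by (simp add: algebra_simps)
  have "l * (a \<bullet> (p - A) - t * l) = 0"
    using t(3) aa unfolding assms(2)
    by (simp add: inner_commute inner_diff_right inner_diff_left inner_add_left inner_add_right algebra_simps)
  then have "a \<bullet> (p - A) = t * l" using assms(3) by simp
  then show 1: "a \<bullet> (p - A) \<ge> 0" using t assms(3) by simp
  have "a \<bullet> (p - B) = - (1 - t) * l"
    using \<open>a \<bullet> (p - A) = t * l\<close> aa unfolding B by (simp add: inner_diff_right inner_add_right algebra_simps)
  then show 2: "a \<bullet> (p - B) \<le> 0" using t assms(3) by (simp add: mult_nonpos_nonneg)
  show 4: "rot 1 a \<bullet> (p - A) = rot 1 a \<bullet> (p - B)" unfolding B by (simp add: inner2) algebra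
  define x where "x = p - A"
  have x1: "a \<bullet> x = t * l" using \<open>a \<bullet> (p - A) = t * l\<close> by (simp add: x_def)
  have x2: "(x - (t * l) *\<^sub>R a) \<bullet> (x - (t * l) *\<^sub>R a) = r^2" using t(4) unfolding assms(2) x_def
    by (simp add: algebra_simps)
  have "(rot 1 a \<bullet> x)^2 = r^2"
    using x1 x2 aa by (simp add: inner2) algebra
  then show 3: "(rot 1 a \<bullet> (p - B))^2 = r^2" using 4 by (simp add: x_def)
qed

text \<open>Convexity is a conclusion here: going round the corners with
  \<open>tangent_corner\<close>, the signed distance \<open>q\<close> is passed on unchanged and
  every turn has the sign of \<open>q\<close>. The sign \<open>s\<close> turns \<open>q\<close> into
  the radius.\<close>

lemma inscribed_circle_signed:
  fixes a b c d :: "real^2"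
  assumes ic: "inscribed_circle (A, B, C, D) p r"
    and sides: "B - A = ta *\<^sub>R a" "C - B = tb *\<^sub>R b" "D - C = tc *\<^sub>R c" "A - D = td *\<^sub>R d"
    and pos: "ta > 0" "tb > 0" "tc > 0" "td > 0"
    and unit: "norm a = 1" "norm b = 1" "norm c = 1" "norm d = 1"
  shows "\<exists>s. (s = 1 \<or> s = -1) \<and> rot s a \<bullet> b > 0 \<and> rot s b \<bullet> c > 0 \<and> rot s c \<bullet> d > 0 \<and> rot s d \<bullet> a > 0 \<and>
    rot s a \<bullet> (p - A) = r \<and> rot s b \<bullet> (p - B) = r \<and> rot s c \<bullet> (p - C) = r \<and> rot s d \<bullet> (p - D) = r"
proof -
  have r: "r > 0" and tA: "touches_side p r A B" "touches_side p r B C" "touches_side p r C D" "touches_side p r D A"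
    and nd: "\<not> collinear {A, B, C}" "\<not> collinear {B, C, D}" "\<not> collinear {C, D, A}" "\<not> collinear {D, A, B}"
    using ic by auto
  have sc: "rot 1 (x *\<^sub>R v) \<bullet> (y *\<^sub>R w) = x * y * (rot 1 v \<bullet> w)" for x y v w
    by (simp add: inner2 algebra_simps)
  have nz: "rot 1 a \<bullet> b \<noteq> 0" "rot 1 b \<bullet> c \<noteq> 0" "rot 1 c \<bullet> d \<noteq> 0" "rot 1 d \<bullet> a \<noteq> 0"
    using nd pos unfolding collinear3_iff2 sides sc by auto
  note T1 = touches_side_unit[OF tA(1) sides(1) pos(1) unit(1)]
  note T2 = touches_side_unit[OF tA(2) sides(2) pos(2) unit(2)]
  note T3 = touches_side_unit[OF tA(3) sides(3) pos(3) unit(3)]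
  note T4 = touches_side_unit[OF tA(4) sides(4) pos(4) unit(4)]
  note C1 = tangent_corner[OF unit(1,2) T1(1) T2(2) T1(3) T2(3)[folded T2(4)] r nz(1)]
  note C2 = tangent_corner[OF unit(2,3) T2(1) T3(2) T2(3) T3(3)[folded T3(4)] r nz(2)]
  note C3 = tangent_corner[OF unit(3,4) T3(1) T4(2) T3(3) T4(3)[folded T4(4)] r nz(3)]
  note C4 = tangent_corner[OF unit(4,1) T4(1) T1(2) T4(3) T1(3)[folded T1(4)] r nz(4)]
  have rs: "rot s v \<bullet> w = s * (rot 1 v \<bullet> w)" for s v w by (simp add: inner2 algebra_simps)
  define q where "q = rot 1 a \<bullet> (p - A)"
  have qs: "rot 1 a \<bullet> (p - A) = q" "rot 1 b \<bullet> (p - B) = q" "rot 1 c \<bullet> (p - C) = q" "rot 1 d \<bullet> (p - D) = q"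
    "rot 1 a \<bullet> (p - B) = q" "rot 1 b \<bullet> (p - C) = q" "rot 1 c \<bullet> (p - D) = q"  "rot 1 d \<bullet> (p - A) = q"
    using T1(4) T2(4) T3(4) T4(4) C1 C2 C3 unfolding q_def by auto
  have q2: "q^2 = r^2" using T1(3) qs by simp
  have P: "(rot 1 a \<bullet> b) * q > 0" "(rot 1 b \<bullet> c) * q > 0" "(rot 1 c \<bullet> d) * q > 0" "(rot 1 d \<bullet> a) * q > 0"
    using C1 C2 C3 C4 qs by auto
  from q2 consider "q = r" | "q = - r" by (auto simp: power2_eq_iff)
  then show ?thesis
  proof cases
    case 1
    then show ?thesis using qs P r by (intro exI[of _ 1]) (simp add: zero_less_mult_iff)
  next
    case 2
    then show ?thesis using qs P r
      by (intro exI[of _ "-1"]) (simp add: zero_less_mult_iff rs[of "-1"] mult_less_0_iff)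
  qed
qed

text \<open>Both tangent lengths at the vertex equal \<open>r (1 - d \<bullet> a)\<close> divided by
  the oriented cross product of the directions, so the turning direction decides on which side of
  the vertex the tangent points lie.\<close>

lemma tangent_length_pos:
  fixes d a x :: "real^2"
  assumes "norm d = 1" "norm a = 1" "rot s d \<bullet> a > 0" "rot s d \<bullet> x = r" "rot s a \<bullet> x = r" "r > 0" "s = 1 \<or> s = -1"
  shows "a \<bullet> x > 0" "d \<bullet> x < 0"
proof -
  have D: "d$1 * d$1 + d$2 * d$2 = 1" and A: "a$1 * a$1 + a$2 * a$2 = 1" and s: "s * s = 1"
    using assms by (auto simp: norm_eq_1_iff2)
  have "(a \<bullet> x) * (rot s d \<bullet> a) = (rot s d \<bullet> x) * (a \<bullet> a) - (rot s a \<bullet> x) * (d \<bullet> a)"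
    by (simp add: inner2) algebra
  then have 1: "(a \<bullet> x) * (rot s d \<bullet> a) = r * (1 - d \<bullet> a)"
    using assms(4,5) A by (simp add: inner2[of a a] right_diff_distrib)
  have "(d \<bullet> x) * (rot s d \<bullet> a) = (rot s d \<bullet> x) * (d \<bullet> a) - (rot s a \<bullet> x) * (d \<bullet> d)"
    by (simp add: inner2) algebra
  then have 2: "(d \<bullet> x) * (rot s d \<bullet> a) = - r * (1 - d \<bullet> a)"
    using assms(4,5) D by (simp add: inner2[of d d] right_diff_distrib)
  have 3: "(rot s d \<bullet> a)^2 + (d \<bullet> a)^2 = 1"
    using D A s unfolding inner2 rot_nth by algebra
  then have "(d \<bullet> a)^2 < 1" using assms(3) by (smt (verit) zero_less_power)
  then have "d \<bullet> a < 1" by (simp add: abs_square_less_1)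
  then have "(a \<bullet> x) * (rot s d \<bullet> a) > 0" "(d \<bullet> x) * (rot s d \<bullet> a) < 0"
    using 1 2 assms(6) by simp_all
  then show "a \<bullet> x > 0" "d \<bullet> x < 0" using assms(3) by (simp_all add: zero_less_mult_iff mult_less_0_iff)
qed

lemma touches_sideI_unit:
  fixes a :: "real^2"
  assumes "B - A = l *\<^sub>R a" "l > 0" "norm a = 1" "a \<bullet> (p - A) \<ge> 0" "a \<bullet> (p - B) \<le> 0"
    "(rot s a \<bullet> (p - A))^2 = r^2" "r > 0" "s = 1 \<or> s = -1"
  shows "touches_side p r A B"
proof -
  define t where "t = a \<bullet> (p - A) / l"
  have s: "s * s = 1" using assms by auto
  have aa: "a$1 * a$1 + a$2 * a$2 = 1" using assms(3) by (simp add: norm_eq_1_iff2)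
  have B: "B = A + l *\<^sub>R a" using assms(1) by (simp add: algebra_simps)
  have "a \<bullet> (p - B) = a \<bullet> (p - A) - l" unfolding B using aa by (simp add: inner2) algebra
  then have t: "0 \<le> t" "t \<le> 1" using assms by (auto simp: t_def divide_simps)
  define x where "x = p - A"
  have tl: "t * l = a \<bullet> x" using assms by (simp add: t_def x_def)
  have e: "p - (A + t *\<^sub>R (B - A)) = x - (a \<bullet> x) *\<^sub>R a"
    unfolding assms(1) by (simp add: tl x_def)
  show ?thesis
  proof (rule touches_sideI[OF _ t assms(7)])
    show "A \<noteq> B" using B assms by auto
    show "(p - (A + t *\<^sub>R (B - A))) \<bullet> (B - A) = 0"
      unfolding e unfolding assms(1) using aa by (simp add: inner2) algebra
    show "(p - (A + t *\<^sub>R (B - A))) \<bullet> (p - (A + t *\<^sub>R (B - A))) = r\<^sup>2"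
      unfolding e using assms(6) aa s unfolding x_def[symmetric] by (simp add: inner2) algebra
  qed
qed

text \<open>Tangency to the lines becomes tangency to the segments, because
  \<open>tangent_length_pos\<close> at both ends of a side places the tangent point between
  them.\<close>

lemma inscribed_circleI_signed:
  fixes a b c d :: "real^2"
  assumes sides: "B - A = ta *\<^sub>R a" "C - B = tb *\<^sub>R b" "D - C = tc *\<^sub>R c" "A - D = td *\<^sub>R d"
    and pos: "ta > 0" "tb > 0" "tc > 0" "td > 0"
    and unit: "norm a = 1" "norm b = 1" "norm c = 1" "norm d = 1"
    and s: "s = 1 \<or> s = -1" and r: "r > 0"
    and cr: "rot s a \<bullet> b > 0" "rot s b \<bullet> c > 0" "rot s c \<bullet> d > 0" "rot s d \<bullet> a > 0"
    and di: "rot s a \<bullet> (p - A) = r" "rot s b \<bullet> (p - B) = r" "rot s c \<bullet> (p - C) = r" "rot s d \<bullet> (p - D) = r"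
  shows "inscribed_circle (A, B, C, D) p r"
proof -
  have sc: "rot 1 (x *\<^sub>R v) \<bullet> (y *\<^sub>R w) = x * y * (rot 1 v \<bullet> w)" for x y v w
    by (simp add: inner2 algebra_simps)
  have rs: "rot s v \<bullet> w = s * (rot 1 v \<bullet> w)" for s v w by (simp add: inner2 algebra_simps)
  have nd: "\<not> collinear {A, B, C}" "\<not> collinear {B, C, D}" "\<not> collinear {C, D, A}" "\<not> collinear {D, A, B}"
    using cr pos unfolding collinear3_iff2 sides sc rs[of s] by auto
  have mv: "rot s v \<bullet> (p - V) = rot s v \<bullet> (p - W)" if "V - W = l *\<^sub>R v" for v V W l
  proof -
    have V: "V = W + l *\<^sub>R v" using that by (simp add: algebra_simps)
    show ?thesis unfolding V by (simp add: inner2) algebra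
  qed
  have di2: "rot s a \<bullet> (p - B) = r" "rot s b \<bullet> (p - C) = r" "rot s c \<bullet> (p - D) = r" "rot s d \<bullet> (p - A) = r"
    using di mv[OF sides(1)] mv[OF sides(2)] mv[OF sides(3)] mv[OF sides(4)] by simp_all
  note B = tangent_length_pos[OF unit(1,2) cr(1) di2(1) di(2) r s]
  note C = tangent_length_pos[OF unit(2,3) cr(2) di2(2) di(3) r s]
  note D = tangent_length_pos[OF unit(3,4) cr(3) di2(3) di(4) r s]
  note A = tangent_length_pos[OF unit(4,1) cr(4) di2(4) di(1) r s]
  have "touches_side p r A B"
    using A(1) B(2) di(1) by (intro touches_sideI_unit[OF sides(1) pos(1) unit(1) _ _ _ r s]) auto
  moreover have "touches_side p r B C"
    using B(1) C(2) di(2) by (intro touches_sideI_unit[OF sides(2) pos(2) unit(2) _ _ _ r s]) auto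
  moreover have "touches_side p r C D"
    using C(1) D(2) di(3) by (intro touches_sideI_unit[OF sides(3) pos(3) unit(3) _ _ _ r s]) auto
  moreover have "touches_side p r D A"
    using D(1) A(2) di(4) by (intro touches_sideI_unit[OF sides(4) pos(4) unit(4) _ _ _ r s]) auto
  ultimately show ?thesis using nd r by simp
qed

section \<open>Pitot's theorem\<close>

lemma rot_add: "rot s (x + y) = rot s x + rot s y"
  and rot_diff: "rot s (x - y) = rot s x - rot s y"
  and rot_minus: "rot s (- x) = - rot s x"
  and rot_scaleR: "rot s (c *\<^sub>R x) = c *\<^sub>R rot s x"
  by (simp_all add: eq2_iff algebra_simps)

lemma rot_inner_self [simp]: "rot s x \<bullet> x = 0" "x \<bullet> rot s x = 0"
  by (simp_all add: inner2)

lemma rot_skew: "x \<bullet> rot s y = - (rot s x \<bullet> y)"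
  by (simp add: inner2 algebra_simps)

lemma rot_swap: "rot s y \<bullet> x = - (rot s x \<bullet> y)"
  by (simp add: inner2 algebra_simps)

lemma rot_rot: "s = 1 \<or> s = -1 \<Longrightarrow> rot s (rot s x) = - x"
  by (auto simp add: eq2_iff)

lemma norm_rot: "s = 1 \<or> s = -1 \<Longrightarrow> norm (rot s x) = norm x"
  by (auto simp add: norm_eq_sqrt_inner inner2 algebra_simps)

lemma inner_unit_less_1:
  fixes n n' :: "real^2"
  assumes "norm n = 1" "norm n' = 1" "n \<noteq> n'"
  shows "n \<bullet> n' < 1"
proof -
  have "(n - n') \<bullet> (n - n') = 2 - 2 * (n \<bullet> n')"
    using assms unfolding inner_diff_left inner_diff_right by (simp add: inner_commute dot_square_norm)
  moreover have "(n - n') \<bullet> (n - n') > 0" using assms by simp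
  ultimately show ?thesis by simp
qed

text \<open>\<open>n + n'\<close> is orthogonal to \<open>n' - n\<close>, so its rotation by a right
  angle is a multiple of \<open>n' - n\<close>; up to the sign \<open>s\<close> the factor is the
  cotangent of half the angle from \<open>n\<close> to \<open>n'\<close>.\<close>

lemma kappa_identity:
  fixes n n' x :: "real^2"
  assumes "norm n = 1" "norm n' = 1"
  shows "(1 - n \<bullet> n') * (rot s (n + n') \<bullet> x) = (rot s n \<bullet> n') * ((n' - n) \<bullet> x)"
proof -
  have N: "n$1 * n$1 + n$2 * n$2 = 1" and N': "n'$1 * n'$1 + n'$2 * n'$2 = 1"
    using assms by (auto simp: norm_eq_1_iff2)
  have "(1 - n \<bullet> n') * (rot s (n + n') \<bullet> x) - (rot s n \<bullet> n') * ((n' - n) \<bullet> x)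
    = s * ((1 - (n$1 * n$1 + n$2 * n$2)) * (n'$1 * x$2 - n'$2 * x$1)
       + (1 - (n'$1 * n'$1 + n'$2 * n'$2)) * (n$1 * x$2 - n$2 * x$1))"
    by (simp add: inner2) algebra
  also have "\<dots> = 0" unfolding N N' by simp
  finally show ?thesis by simp
qed

text \<open>For the difference \<open>x\<close> of the centers of two circles touching both lines,
  this compares the displacements of the tangent points along the two lines. It is the equality of
  common tangent lengths behind all sums below.\<close>

lemma bisector_perp:
  fixes n n' x :: "real^2"
  assumes "norm n = 1" "norm n' = 1" "n \<noteq> n'" "n \<bullet> x = n' \<bullet> x"
  shows "rot s n \<bullet> x + rot s n' \<bullet> x = 0"
proof -
  have "(1 - n \<bullet> n') * (rot s (n + n') \<bullet> x) = 0"
    using kappa_identity[OF assms(1,2), of s x] assms(4) by (simp add: inner_diff_left)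
  then show ?thesis using inner_unit_less_1[OF assms(1-3)] by (simp add: rot_add inner_add_left)
qed

lemma solve_2x2:
  fixes m m' :: "real^2"
  assumes "rot 1 m \<bullet> m' \<noteq> 0"
  obtains p where "m \<bullet> p = g" "m' \<bullet> p = g'"
proof
  define D where "D = rot 1 m \<bullet> m'"
  define p where "p = (1 / D) *\<^sub>R (g' *\<^sub>R rot 1 m - g *\<^sub>R rot 1 m')"
  have D: "D \<noteq> 0" using assms by (simp add: D_def)
  have m: "m \<bullet> rot 1 m' = - D" "m' \<bullet> rot 1 m = D" unfolding D_def by (simp_all add: inner2)
  show "m \<bullet> p = g" "m' \<bullet> p = g'" using D by (simp_all add: p_def inner_diff_right m)
qed

text \<open>Up to orientation this is twice the area of the triangle \<open>n1 n2 n3\<close> in the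
  unit circle. It makes \<open>n1 - n2\<close> and \<open>n2 - n3\<close> independent, so that the
  bisectors at two successive corners meet.\<close>

lemma cross_triple_pos:
  fixes n1 n2 n3 :: "real^2"
  assumes "norm n1 = 1" "norm n2 = 1" "norm n3 = 1" "rot s n1 \<bullet> n2 > 0" "rot s n2 \<bullet> n3 > 0"
  shows "rot s (n1 - n2) \<bullet> (n2 - n3) > 0"
proof -
  have "n1 \<noteq> n2" "n2 \<noteq> n3" using assms by auto
  then have l: "n1 \<bullet> n2 < 1" "n2 \<bullet> n3 < 1" using assms by (auto intro!: inner_unit_less_1)
  have N: "n2$1 * n2$1 + n2$2 * n2$2 = 1" using assms by (auto simp: norm_eq_1_iff2)
  have "rot s (n1 - n2) \<bullet> (n2 - n3) - ((rot s n1 \<bullet> n2) * (1 - n2 \<bullet> n3) + (rot s n2 \<bullet> n3) * (1 - n1 \<bullet> n2))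
     = (1 - (n2$1 * n2$1 + n2$2 * n2$2)) * s * (n1$2 * n3$1 - n1$1 * n3$2)"
    by (simp add: inner2) algebra
  then have "rot s (n1 - n2) \<bullet> (n2 - n3) = (rot s n1 \<bullet> n2) * (1 - n2 \<bullet> n3) + (rot s n2 \<bullet> n3) * (1 - n1 \<bullet> n2)"
    unfolding N by simp
  also have "\<dots> > 0" using l assms by (intro add_pos_pos mult_pos_pos) auto
  finally show ?thesis .
qed

text \<open>Pitot's theorem in terms of oriented lines \<open>{x. n\<^sub>k \<bullet> x = h\<^sub>k}\<close>: the usual statement, about side lengths,
  is the case where \<open>q12\<close> etc. are the vertices. Only that these points lie on the angle bisectors matters.\<close>

lemma pitot_sum:
  fixes n1 n2 n3 n4 :: "real^2"
  assumes unit: "norm n1 = 1" "norm n2 = 1" "norm n3 = 1" "norm n4 = 1"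
    and ne: "n1 \<noteq> n2" "n2 \<noteq> n3" "n3 \<noteq> n4" "n4 \<noteq> n1"
    and K: "n1 \<bullet> K - h1 = \<rho>" "n2 \<bullet> K - h2 = \<rho>" "n3 \<bullet> K - h3 = \<rho>" "n4 \<bullet> K - h4 = \<rho>"
    and q: "n1 \<bullet> q12 - h1 = n2 \<bullet> q12 - h2" "n2 \<bullet> q23 - h2 = n3 \<bullet> q23 - h3"
      "n3 \<bullet> q34 - h3 = n4 \<bullet> q34 - h4" "n4 \<bullet> q41 - h4 = n1 \<bullet> q41 - h1"
  shows "rot s n1 \<bullet> (q12 - q41) + rot s n2 \<bullet> (q12 - q23) + rot s n3 \<bullet> (q34 - q23) + rot s n4 \<bullet> (q34 - q41) = 0"
proof -
  have "rot s n1 \<bullet> (q12 - K) + rot s n2 \<bullet> (q12 - K) = 0"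
    using q(1) K by (intro bisector_perp unit ne) (simp add: inner_diff_right)
  moreover have "rot s n2 \<bullet> (q23 - K) + rot s n3 \<bullet> (q23 - K) = 0"
    using q(2) K by (intro bisector_perp unit ne) (simp add: inner_diff_right)
  moreover have "rot s n3 \<bullet> (q34 - K) + rot s n4 \<bullet> (q34 - K) = 0"
    using q(3) K by (intro bisector_perp unit ne) (simp add: inner_diff_right)
  moreover have "rot s n4 \<bullet> (q41 - K) + rot s n1 \<bullet> (q41 - K) = 0"
    using q(4) K by (intro bisector_perp unit ne) (simp add: inner_diff_right)
  ultimately show ?thesis by (simp add: inner_diff_right)
qed

text \<open>\<open>K\<close> is equidistant from the first three lines, and \<open>\<delta>\<close>
  measures the defect at the fourth. Evaluated along the bisectors, the sum becomes
  \<open>\<delta>\<close> times the sum of two half-angle cotangents, which are positive by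
  convexity.\<close>

lemma pitot_converse:
  fixes n1 n2 n3 n4 :: "real^2"
  assumes unit: "norm n1 = 1" "norm n2 = 1" "norm n3 = 1" "norm n4 = 1"
    and cr: "rot s n1 \<bullet> n2 > 0" "rot s n2 \<bullet> n3 > 0" "rot s n3 \<bullet> n4 > 0" "rot s n4 \<bullet> n1 > 0"
    and q: "n1 \<bullet> q12 - h1 = n2 \<bullet> q12 - h2" "n2 \<bullet> q23 - h2 = n3 \<bullet> q23 - h3"
      "n3 \<bullet> q34 - h3 = n4 \<bullet> q34 - h4" "n4 \<bullet> q41 - h4 = n1 \<bullet> q41 - h1"
    and sum: "rot s n1 \<bullet> (q12 - q41) + rot s n2 \<bullet> (q12 - q23) + rot s n3 \<bullet> (q34 - q23) + rot s n4 \<bullet> (q34 - q41) = 0"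
  obtains K \<rho> where "n1 \<bullet> K - h1 = \<rho>" "n2 \<bullet> K - h2 = \<rho>" "n3 \<bullet> K - h3 = \<rho>" "n4 \<bullet> K - h4 = \<rho>"
proof -
  have ne: "n1 \<noteq> n2" "n2 \<noteq> n3" "n3 \<noteq> n4" "n4 \<noteq> n1" using cr by auto
  have "rot s (n1 - n2) \<bullet> (n2 - n3) > 0" by (intro cross_triple_pos unit cr)
  moreover have "rot s (n1 - n2) \<bullet> (n2 - n3) = s * (rot 1 (n1 - n2) \<bullet> (n2 - n3))"
    by (simp add: inner2 algebra_simps)
  ultimately have "rot 1 (n1 - n2) \<bullet> (n2 - n3) \<noteq> 0" by auto
  then obtain K where K: "(n1 - n2) \<bullet> K = h1 - h2" "(n2 - n3) \<bullet> K = h2 - h3" by (rule solve_2x2)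
  define \<rho> where "\<rho> = n1 \<bullet> K - h1"
  define \<delta> where "\<delta> = n4 \<bullet> K - h4 - \<rho>"
  have K': "n1 \<bullet> K = h1 + \<rho>" "n2 \<bullet> K = h2 + \<rho>" "n3 \<bullet> K = h3 + \<rho>" "n4 \<bullet> K = h4 + \<rho> + \<delta>"
    using K unfolding \<rho>_def \<delta>_def by (simp_all add: inner_diff_left)
  have 1: "rot s n1 \<bullet> (q12 - K) + rot s n2 \<bullet> (q12 - K) = 0"
    using q(1) K' by (intro bisector_perp unit ne) (simp add: inner_diff_right)
  have 2: "rot s n2 \<bullet> (q23 - K) + rot s n3 \<bullet> (q23 - K) = 0"
    using q(2) K' by (intro bisector_perp unit ne) (simp add: inner_diff_right)
  define x where "x = rot s (n3 + n4) \<bullet> (K - q34)"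
  define y where "y = rot s (n4 + n1) \<bullet> (K - q41)"
  have "(n4 - n3) \<bullet> (K - q34) = \<delta>" using q(3) K' by (simp add: inner_diff_left inner_diff_right)
  then have "(1 - n3 \<bullet> n4) * x = (rot s n3 \<bullet> n4) * \<delta>"
    unfolding x_def kappa_identity[OF unit(3,4)] by simp
  then have x: "x = (rot s n3 \<bullet> n4) / (1 - n3 \<bullet> n4) * \<delta>"
    using inner_unit_less_1[OF unit(3,4) ne(3)] by (simp add: field_simps)
  have "(n1 - n4) \<bullet> (K - q41) = - \<delta>" using q(4) K' by (simp add: inner_diff_left inner_diff_right)
  then have "(1 - n4 \<bullet> n1) * y = (rot s n4 \<bullet> n1) * (- \<delta>)"
    unfolding y_def kappa_identity[OF unit(4,1)] by simp
  then have y: "y = (rot s n4 \<bullet> n1) / (1 - n4 \<bullet> n1) * (- \<delta>)"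
    using inner_unit_less_1[OF unit(4,1) ne(4)] by (simp add: field_simps)
  have "x = y" using sum 1 2 unfolding x_def y_def by (simp add: inner_diff_right rot_add inner_add_left)
  then have "((rot s n3 \<bullet> n4) / (1 - n3 \<bullet> n4) + (rot s n4 \<bullet> n1) / (1 - n4 \<bullet> n1)) * \<delta> = 0"
    unfolding x y by (simp add: algebra_simps)
  moreover have "(rot s n3 \<bullet> n4) / (1 - n3 \<bullet> n4) + (rot s n4 \<bullet> n1) / (1 - n4 \<bullet> n1) > 0"
    using cr inner_unit_less_1[OF unit(3,4) ne(3)] inner_unit_less_1[OF unit(4,1) ne(4)]
    by (intro add_pos_pos divide_pos_pos) auto
  ultimately have "\<delta> = 0" by simp
  then show thesis using that[of K \<rho>] K' by simp
qed

text \<open>The tangent lengths at \<open>V\<close> and \<open>W\<close> add up to the side length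
  \<open>t\<close>, and each is a positive multiple of \<open>\<rho>\<close>.\<close>

lemma tangent_circle_radius_pos:
  fixes n1 n2 n4 :: "real^2"
  assumes unit: "norm n1 = 1" "norm n2 = 1" "norm n4 = 1"
    and cr: "rot s n1 \<bullet> n2 > 0" "rot s n4 \<bullet> n1 > 0"
    and V: "n4 \<bullet> V = h4" "n1 \<bullet> V = h1" "n1 \<bullet> W = h1" "n2 \<bullet> W = h2"
    and W: "W = V - t *\<^sub>R rot s n1" "t > 0" and s: "s = 1 \<or> s = -1"
    and K: "n1 \<bullet> K - h1 = \<rho>" "n2 \<bullet> K - h2 = \<rho>" "n4 \<bullet> K - h4 = \<rho>"
  shows "\<rho> > 0"
proof -
  have ne: "n1 \<noteq> n2" "n4 \<noteq> n1" using cr by auto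
  have N: "n1$1 * n1$1 + n1$2 * n1$2 = 1" using unit by (auto simp: norm_eq_1_iff2)
  have nn: "n1 \<bullet> n1 = 1" using unit by (simp add: dot_square_norm)
  have sp: "(rot s n1 \<bullet> x) * (rot s m \<bullet> n1) = s^2 * ((n1 \<bullet> x) * (m \<bullet> n1) - n1 \<bullet> n1 * (m \<bullet> x))" for x m
    by (simp add: inner2) algebra
  have s2: "s^2 = 1" using s by auto
  define x where "x = - (rot s n1 \<bullet> (K - V))"
  define y where "y = rot s n1 \<bullet> (K - W)"
  have "n1 \<bullet> (K - V) = \<rho>" "n4 \<bullet> (K - V) = \<rho>" "n1 \<bullet> (K - W) = \<rho>" "n2 \<bullet> (K - W) = \<rho>"
    using K V by (simp_all add: inner_diff_right)
  note e = this
  have "(rot s n1 \<bullet> (K - V)) * (rot s n4 \<bullet> n1) = - \<rho> * (1 - n4 \<bullet> n1)"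
    unfolding sp s2 nn e by (simp add: algebra_simps)
  moreover have "(rot s n1 \<bullet> (K - W)) * (rot s n2 \<bullet> n1) = - \<rho> * (1 - n2 \<bullet> n1)"
    unfolding sp s2 nn e by (simp add: algebra_simps)
  ultimately have 1: "x = \<rho> * (1 - n4 \<bullet> n1) / (rot s n4 \<bullet> n1)" and 2: "y = \<rho> * (1 - n2 \<bullet> n1) / (rot s n1 \<bullet> n2)"
    using cr unfolding x_def y_def rot_swap[of s n2 n1] by (simp_all add: field_simps)
  have "x + y = rot s n1 \<bullet> (V - W)" unfolding x_def y_def by (simp add: inner_diff_right)
  also have "\<dots> = t" using N s2 unfolding W(1) by (simp add: inner2) algebra
  finally have "t = \<rho> * ((1 - n4 \<bullet> n1) / (rot s n4 \<bullet> n1) + (1 - n2 \<bullet> n1) / (rot s n1 \<bullet> n2))"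
    unfolding 1 2 by (simp add: algebra_simps)
  moreover have "(1 - n4 \<bullet> n1) / (rot s n4 \<bullet> n1) + (1 - n2 \<bullet> n1) / (rot s n1 \<bullet> n2) > 0"
    using cr inner_unit_less_1[OF unit(3,1) ne(2)] inner_unit_less_1[OF unit(2,1)] ne(1)
    by (intro add_pos_pos divide_pos_pos) auto
  ultimately show ?thesis using W(2) by (auto simp: zero_less_mult_iff)
qed

lemma affine_zero_on_plane:
  fixes n :: "real^2"
  assumes "n \<bullet> A = \<eta>" "n \<bullet> B = \<eta>" "n \<bullet> C = \<eta>" "rot 1 (B - A) \<bullet> (C - A) \<noteq> 0"
  shows "n \<bullet> x = \<eta>"
proof -
  have z: "n \<bullet> (B - A) = 0" "n \<bullet> (C - A) = 0" using assms by (simp_all add: inner_diff_right)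
  have "n$1 * (rot 1 (B - A) \<bullet> (C - A)) = 0" "n$2 * (rot 1 (B - A) \<bullet> (C - A)) = 0"
    using z unfolding inner2 rot_nth by algebra+
  then have "n = 0" using assms(4) by (simp add: eq2_iff)
  then show ?thesis using assms(1) by simp
qed

section \<open>Net-squares are circumscribed\<close>

lemma rot_uminus: "rot (- s) x = - rot s x"
  by (simp add: eq2_iff)

lemma mem_rectangle: "(i, j) \<in> rectangle m1 m2 n1 n2 \<longleftrightarrow> m1 < i \<and> i < m2 \<and> n1 < j \<and> j < n2"
  by (auto simp: rectangle_def)

lemma is_unit_square_rectangle:
  "is_unit_square (rectangle m1 m2 n1 n2) i j \<longleftrightarrow> even (i + j) \<and> m1 < i \<and> i + 1 < m2 \<and> n1 < j \<and> j + 1 < n2"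
  by (auto simp: is_net_square_def mem_rectangle)

text \<open>A corner of the rectangle need not be a vertex of any unit net-square; at such a corner the two lines may
  cross with the wrong orientation.\<close>

definition good :: "(int \<times> int) set \<Rightarrow> int \<Rightarrow> int \<Rightarrow> bool" where
  "good P i j \<longleftrightarrow> (\<exists>a b. is_unit_square P a b \<and> (i = a \<or> i = a + 1) \<and> (j = b \<or> j = b + 1))"

lemma goodI:
  assumes "is_unit_square P i j"
  shows "good P i j" "good P (i + 1) j" "good P i (j + 1)" "good P (i + 1) (j + 1)"
  using assms unfolding good_def by blast+

text \<open>Data that remove all choices of sign: \<open>s\<close> relates the normals to the
  directions of the lines, with different signs for rows and columns. The bounds of the rectangle
  are exclusive, so \<open>m1 + 4 \<le> m2\<close> means at least three columns. Crossing signs are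
  required at good vertices only.\<close>

locale ic_net =
  fixes m1 m2 n1 n2 :: int and f :: "int \<Rightarrow> int \<Rightarrow> real^2" and s :: real
    and u v :: "int \<Rightarrow> real^2" and h k :: "int \<Rightarrow> real"
  assumes s: "s = 1 \<or> s = -1"
    and size: "m1 + 4 \<le> m2" "n1 + 4 \<le> n2"
    and unit_u: "norm (u i) = 1" and unit_v: "norm (v j) = 1"
    and on_col: "(i, j) \<in> rectangle m1 m2 n1 n2 \<Longrightarrow> u i \<bullet> f i j = h i"
    and on_row: "(i, j) \<in> rectangle m1 m2 n1 n2 \<Longrightarrow> v j \<bullet> f i j = k j"
    and row_dir: "(i, j) \<in> rectangle m1 m2 n1 n2 \<Longrightarrow> (i', j) \<in> rectangle m1 m2 n1 n2 \<Longrightarrow> i < i' \<Longrightarrow>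
      \<exists>t>0. f i' j = f i j - t *\<^sub>R rot s (v j)"
    and col_dir: "(i, j) \<in> rectangle m1 m2 n1 n2 \<Longrightarrow> (i, j') \<in> rectangle m1 m2 n1 n2 \<Longrightarrow> j < j' \<Longrightarrow>
      \<exists>t>0. f i j' = f i j + t *\<^sub>R rot s (u i)"
    and good_cross: "good (rectangle m1 m2 n1 n2) i j \<Longrightarrow> rot s (u i) \<bullet> v j > 0"
    and unit_circle: "is_unit_square (rectangle m1 m2 n1 n2) i j \<Longrightarrow>
      \<exists>p r. 0 < r \<and> u i \<bullet> p - h i = r \<and> h (i + 1) - u (i + 1) \<bullet> p = r \<and>
        v j \<bullet> p - k j = r \<and> k (j + 1) - v (j + 1) \<bullet> p = r"
begin

lemma s_nz: "s \<noteq> 0" using s by auto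

abbreviation "P \<equiv> rectangle m1 m2 n1 n2"

text \<open>The signs at \<open>i'\<close> and \<open>j'\<close> are reversed since the normals
  point to larger indices, that is, outwards on these two sides.\<close>

definition tang :: "int \<Rightarrow> int \<Rightarrow> int \<Rightarrow> int \<Rightarrow> real^2 \<Rightarrow> real \<Rightarrow> bool" where
  "tang i i' j j' p r \<longleftrightarrow> u i \<bullet> p - h i = r \<and> h i' - u i' \<bullet> p = r \<and> v j \<bullet> p - k j = r \<and> k j' - v j' \<bullet> p = r"

definition sq :: "int \<Rightarrow> int \<Rightarrow> int \<Rightarrow> int \<Rightarrow> bool" where
  "sq i i' j j' \<longleftrightarrow> i < i' \<and> i' - i = j' - j \<and> odd (i' - i) \<and> even (i + j) \<and> m1 < i \<and> i' < m2 \<and> n1 < j \<and> j' < n2"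

text \<open>Exchanging rows and columns reverses the orientation, hence \<open>- s\<close>.
  Statements about columns are transferred to rows in this way.\<close>

lemma transpose: "ic_net n1 n2 m1 m2 (\<lambda>i j. f j i) (- s) v u k h"
proof
  have us: "is_unit_square (rectangle n1 n2 m1 m2) i j \<longleftrightarrow> is_unit_square P j i" for i j
    by (auto simp: is_unit_square_rectangle add.commute)
  then have gd: "good (rectangle n1 n2 m1 m2) i j \<longleftrightarrow> good P j i" for i j
    by (auto simp: good_def)
  show "- s = 1 \<or> - s = -1" using s by auto
  show "n1 + 4 \<le> n2" "m1 + 4 \<le> m2" "norm (v i) = 1" "norm (u i) = 1" for i
    using size unit_u unit_v by auto
  show "v i \<bullet> f j i = k i" if "(i, j) \<in> rectangle n1 n2 m1 m2" for i j
    using that on_row by (simp add: mem_rectangle)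
  show "u j \<bullet> f j i = h j" if "(i, j) \<in> rectangle n1 n2 m1 m2" for i j
    using that on_col by (simp add: mem_rectangle)
  show "\<exists>t>0. f j i' = f j i - t *\<^sub>R rot (- s) (u j)"
    if "(i, j) \<in> rectangle n1 n2 m1 m2" "(i', j) \<in> rectangle n1 n2 m1 m2" "i < i'" for i j i'
    using that col_dir[of j i i'] by (simp add: mem_rectangle rot_uminus)
  show "\<exists>t>0. f j' i = f j i + t *\<^sub>R rot (- s) (v i)"
    if "(i, j) \<in> rectangle n1 n2 m1 m2" "(i, j') \<in> rectangle n1 n2 m1 m2" "j < j'" for i j j'
    using that row_dir[of j i j'] by (simp add: mem_rectangle rot_uminus)
  show "0 < rot (- s) (v i) \<bullet> u j" if "good (rectangle n1 n2 m1 m2) i j" for i j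
    using that good_cross[of j i] rot_swap[of s "u j" "v i"] by (simp add: gd rot_uminus)
  show "\<exists>p r. 0 < r \<and> v i \<bullet> p - k i = r \<and> k (i + 1) - v (i + 1) \<bullet> p = r \<and>
        u j \<bullet> p - h j = r \<and> h (j + 1) - u (j + 1) \<bullet> p = r"
    if "is_unit_square (rectangle n1 n2 m1 m2) i j" for i j
    using that unit_circle[of j i] unfolding us by blast
qed

lemma sq_transpose: "ic_net.sq n1 n2 m1 m2 j j' i i' \<longleftrightarrow> sq i i' j j'"
  unfolding sq_def ic_net.sq_def[OF transpose] by presburger

lemma tang_transpose: "ic_net.tang v u k h j j' i i' p r \<longleftrightarrow> tang i i' j j' p r"
  unfolding tang_def ic_net.tang_def[OF transpose] by auto

lemma good_transpose: "good (rectangle n1 n2 m1 m2) j i \<longleftrightarrow> good P i j"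
  unfolding good_def by (auto simp: is_unit_square_rectangle add.commute)

lemma sq_unit: "is_unit_square P i j \<longleftrightarrow> sq i (i + 1) j (j + 1)"
  by (auto simp: is_unit_square_rectangle sq_def)

text \<open>The odd side length gives all four corner cells the parity of unit net-squares; their
  incircles link the lines of a net-square to the next inner lines.\<close>

lemma sq_corner_squares:
  assumes "sq i i' j j'"
  shows "is_unit_square P i j" "is_unit_square P (i' - 1) j" "is_unit_square P (i' - 1) (j' - 1)" "is_unit_square P i (j' - 1)"
proof -
  have *: "i < i'" "j' = j + (i' - i)" "odd (i' - i)" "even (i + j)" "m1 < i" "i' < m2" "n1 < j" "j' < n2"
    using assms unfolding sq_def by linarith+
  have "even (i' - 1 + j)" "even (i' - 1 + (j' - 1))" "even (i + (j' - 1))"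
    using * by auto
  then show "is_unit_square P i j" "is_unit_square P (i' - 1) j" "is_unit_square P (i' - 1) (j' - 1)" "is_unit_square P i (j' - 1)"
    using * by (auto simp: is_unit_square_rectangle)
qed

lemma sq_good:
  assumes "sq i i' j j'"
  shows "good P i j" "good P i' j" "good P i' j'" "good P i j'"
  using goodI(1)[OF sq_corner_squares(1)[OF assms]] goodI(2)[OF sq_corner_squares(2)[OF assms]]
    goodI(4)[OF sq_corner_squares(3)[OF assms]] goodI(3)[OF sq_corner_squares(4)[OF assms]] by simp_all

lemmas sq_cross = sq_good[THEN good_cross]

text \<open>On a row that is not extreme there is a cell above and a cell below each vertex, and
  exactly one of the two has the parity of a unit net-square. This works on the first and last
  column too.\<close>

lemma good_row_interior:
  assumes "m1 < i" "i < m2" "n1 + 1 < j" "j + 1 < n2"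
  shows "good P i j"
proof -
  consider "i + 1 < m2" "even (i + j)" | "m1 + 1 < i" "even (i + j)" | "i + 1 < m2" "odd (i + j)" | "m1 + 1 < i" "odd (i + j)"
    using size assms by force
  then show ?thesis
  proof cases
    case 1 then show ?thesis using assms goodI(1)[of P i j] by (simp add: is_unit_square_rectangle)
  next
    case 2 then show ?thesis using assms goodI(4)[of P "i - 1" "j - 1"] by (simp add: is_unit_square_rectangle)
  next
    case 3 then show ?thesis using assms goodI(3)[of P i "j - 1"] by (simp add: is_unit_square_rectangle)
  next
    case 4 then show ?thesis using assms goodI(2)[of P "i - 1" j] by (simp add: is_unit_square_rectangle)
  qed
qed

lemma good_col_interior:
  assumes "m1 + 1 < i" "i + 1 < m2" "n1 < j" "j < n2"
  shows "good P i j"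
  using ic_net.good_row_interior[OF transpose, of j i] assms by (simp add: good_transpose)

lemma goodD: "good P i j \<Longrightarrow> (i, j) \<in> P"
  by (auto simp: good_def is_unit_square_rectangle mem_rectangle)

lemma u_ne_minus: assumes "good P i j" "good P i' j" shows "u i \<noteq> - u i'"
  using good_cross[OF assms(1)] good_cross[OF assms(2)] by (auto simp: rot_minus)

lemma v_ne_minus: assumes "good P i j" "good P i j'" shows "v j \<noteq> - v j'"
  using good_cross[OF assms(1)] good_cross[OF assms(2)] by (auto simp: rot_minus)

text \<open>Pitot's sum with the inward normals \<open>v j\<close>, \<open>- u i'\<close>,
  \<open>- v j'\<close>, \<open>u i\<close>. In the applications the four points are centers of
  circles in corner unit net-squares.\<close>

lemma sq_pitot:
  assumes sq: "sq i i' j j'" and K: "tang i i' j j' K \<rho>"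
    and q12: "v j \<bullet> q12 - k j = h i' - u i' \<bullet> q12" and q23: "h i' - u i' \<bullet> q23 = k j' - v j' \<bullet> q23"
    and q34: "k j' - v j' \<bullet> q34 = u i \<bullet> q34 - h i" and q41: "u i \<bullet> q41 - h i = v j \<bullet> q41 - k j"
  shows "rot s (v j) \<bullet> (q12 - q41) - rot s (u i') \<bullet> (q12 - q23) - rot s (v j') \<bullet> (q34 - q23) + rot s (u i) \<bullet> (q34 - q41) = 0"
proof -
  have "u i \<noteq> - v j'" using sq_cross[OF sq] by (auto simp: rot_minus)
  then have ne: "v j \<noteq> - u i'" "- u i' \<noteq> - v j'" "- v j' \<noteq> u i" "u i \<noteq> v j"
    using sq_cross[OF sq] by (auto simp: rot_minus)
  show ?thesis
    using pitot_sum[of "v j" "- u i'" "- v j'" "u i" K "k j" \<rho> "- h i'" "- k j'" "h i" q12 q23 q34 q41 s] ne K q12 q23 q34 q41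
    by (simp add: unit_u unit_v tang_def rot_minus)
qed

lemma sq_converse_pitot:
  assumes sq: "sq i i' j j'"
    and q12: "v j \<bullet> q12 - k j = h i' - u i' \<bullet> q12" and q23: "h i' - u i' \<bullet> q23 = k j' - v j' \<bullet> q23"
    and q34: "k j' - v j' \<bullet> q34 = u i \<bullet> q34 - h i" and q41: "u i \<bullet> q41 - h i = v j \<bullet> q41 - k j"
    and sum: "rot s (v j) \<bullet> (q12 - q41) - rot s (u i') \<bullet> (q12 - q23) - rot s (v j') \<bullet> (q34 - q23) + rot s (u i) \<bullet> (q34 - q41) = 0"
  shows "\<exists>p r. 0 < r \<and> tang i i' j j' p r"
proof -
  note c = sq_cross[OF sq]
  have cr: "rot s (v j) \<bullet> (- u i') > 0" "rot s (- u i') \<bullet> (- v j') > 0" "rot s (- v j') \<bullet> u i > 0" "rot s (u i) \<bullet> v j > 0"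
    using c rot_swap[of s "v j" "u i'"] rot_swap[of s "v j'" "u i"] by (simp_all add: rot_minus)
  obtain K \<rho> where K: "v j \<bullet> K - k j = \<rho>" "(- u i') \<bullet> K - (- h i') = \<rho>" "(- v j') \<bullet> K - (- k j') = \<rho>" "u i \<bullet> K - h i = \<rho>"
    using pitot_converse[of "v j" "- u i'" "- v j'" "u i" s q12 "k j" "- h i'" q23 "- k j'" q34 "h i" q41] cr q12 q23 q34 q41 sum
    by (auto simp: unit_u unit_v rot_minus)
  have mem: "(i, j) \<in> P" "(i', j) \<in> P" and "i < i'" using sq by (auto simp: sq_def mem_rectangle)
  then obtain t where t: "t > 0" "f i' j = f i j - t *\<^sub>R rot s (v j)" using row_dir by blast
  have nu: "norm (- u i') = 1" and on: "(- u i') \<bullet> f i' j = - h i'" using unit_u on_col mem by simp_all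
  have "\<rho> > 0"
    by (rule tangent_circle_radius_pos[OF unit_v nu unit_u cr(1,4) on_col[OF mem(1)] on_row[OF mem(1)]
          on_row[OF mem(2)] on t(2,1) s K(1,2,4)])
  then show ?thesis using K by (intro exI[of _ K] exI[of _ \<rho>]) (simp add: tang_def)
qed

theorem circle_exists: "sq i i' j j' \<Longrightarrow> \<exists>p r. 0 < r \<and> tang i i' j j' p r"
proof (induction "nat (i' - i)" arbitrary: i i' j j' rule: less_induct)
  case less
  note sq = less.prems
  have st: "i < i'" "j' = j + (i' - i)" "odd (i' - i)" "even (i + j)" "m1 < i" "i' < m2" "n1 < j" "j' < n2"
    using sq unfolding sq_def by linarith+
  show ?case
  proof (cases "i' = i + 1")
    case True
    then have "is_unit_square P i j" "j' = j + 1" using sq st by (auto simp: sq_unit)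
    then show ?thesis using unit_circle[of i j] True unfolding tang_def by blast
  next
    case False
    then have big: "i' \<ge> i + 3" using st by presburger
    then have inner: "sq (i + 1) (i' - 1) (j + 1) (j' - 1)" using st by (auto simp: sq_def)
    then obtain K \<rho> where K: "tang (i + 1) (i' - 1) (j + 1) (j' - 1) K \<rho>"
      using less.hyps[of "i' - 1" "i + 1"] big by force
    note us = sq_corner_squares[OF sq]
    obtain p4 r4 where p4: "u i \<bullet> p4 - h i = r4" "h (i + 1) - u (i + 1) \<bullet> p4 = r4" "v j \<bullet> p4 - k j = r4" "k (j + 1) - v (j + 1) \<bullet> p4 = r4"
      using unit_circle[OF us(1)] by auto
    obtain p1 r1 where p1: "u (i' - 1) \<bullet> p1 - h (i' - 1) = r1" "h i' - u i' \<bullet> p1 = r1" "v j \<bullet> p1 - k j = r1" "k (j + 1) - v (j + 1) \<bullet> p1 = r1"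
      using unit_circle[OF us(2)] by auto
    obtain p2 r2 where p2: "u (i' - 1) \<bullet> p2 - h (i' - 1) = r2" "h i' - u i' \<bullet> p2 = r2" "v (j' - 1) \<bullet> p2 - k (j' - 1) = r2" "k j' - v j' \<bullet> p2 = r2"
      using unit_circle[OF us(3)] by auto
    obtain p3 r3 where p3: "u i \<bullet> p3 - h i = r3" "h (i + 1) - u (i + 1) \<bullet> p3 = r3" "v (j' - 1) \<bullet> p3 - k (j' - 1) = r3" "k j' - v j' \<bullet> p3 = r3"
      using unit_circle[OF us(4)] by auto
    \<comment> \<open>The centers of the corner circles lie outside the inner net-square but still
      on the bisectors at its corners: their inward distances from both inner lines are minus the
      radius.\<close>
    have IN: "rot s (v (j + 1)) \<bullet> (p1 - p4) - rot s (u (i' - 1)) \<bullet> (p1 - p2) - rot s (v (j' - 1)) \<bullet> (p3 - p2) + rot s (u (i + 1)) \<bullet> (p3 - p4) = 0"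
      using p1 p2 p3 p4 by (intro sq_pitot[OF inner K]) linarith+
    \<comment> \<open>An outer line and the inner line next to it touch the same two corner circles,
      so the displacement of the tangent points may be read off on either.\<close>
    have R1: "rot s (v j) \<bullet> (p1 - p4) = rot s (v (j + 1)) \<bullet> (p1 - p4)"
      using bisector_perp[of "v j" "- v (j + 1)" "p1 - p4" s] p1 p4 v_ne_minus[OF goodI(1,3)[OF us(1)]]
      by (simp add: unit_v rot_minus inner_diff_right)
    have R3: "rot s (v j') \<bullet> (p3 - p2) = rot s (v (j' - 1)) \<bullet> (p3 - p2)"
      using bisector_perp[of "v j'" "- v (j' - 1)" "p3 - p2" s] p3 p2 v_ne_minus[OF goodI(3,1)[OF us(4)]]
      by (simp add: unit_v rot_minus inner_diff_right)
    have R2: "rot s (u i') \<bullet> (p1 - p2) = rot s (u (i' - 1)) \<bullet> (p1 - p2)"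
      using bisector_perp[of "u i'" "- u (i' - 1)" "p1 - p2" s] p1 p2 u_ne_minus[OF goodI(2,1)[OF us(2)]]
      by (simp add: unit_u rot_minus inner_diff_right)
    have R4: "rot s (u i) \<bullet> (p3 - p4) = rot s (u (i + 1)) \<bullet> (p3 - p4)"
      using bisector_perp[of "u i" "- u (i + 1)" "p3 - p4" s] p3 p4 u_ne_minus[OF goodI(1,2)[OF us(1)]]
      by (simp add: unit_u rot_minus inner_diff_right)
    show ?thesis
      by (rule sq_converse_pitot[OF sq, of p1 p2 p3 p4]) (use p1 p2 p3 p4 IN R1 R2 R3 R4 in linarith)+
  qed
qed

text \<open>Between two rows the columns keep their order, although their lines may cross outside.\<close>

lemma strip_order:
  assumes ab: "a < b" and cd: "c < d"
    and g: "good P a c" "good P b c" "good P a d" "good P b d"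
    and x: "v c \<bullet> x \<ge> k c" "v d \<bullet> x \<le> k d" "u a \<bullet> x \<le> h a"
  shows "u b \<bullet> x < h b"
proof (rule ccontr)
  assume "\<not> u b \<bullet> x < h b"
  then have xb: "u b \<bullet> x \<ge> h b" by simp
  note mem = g[THEN goodD]
  note c = g[THEN good_cross]
  obtain t1 where t1: "t1 > 0" "f b c = f a c - t1 *\<^sub>R rot s (v c)" using row_dir[OF mem(1,2) ab] by blast
  obtain t2 where t2: "t2 > 0" "f b d = f b c + t2 *\<^sub>R rot s (u b)" using col_dir[OF mem(2,4) cd] by blast
  obtain t3 where t3: "t3 > 0" "f b d = f a d - t3 *\<^sub>R rot s (v d)" using row_dir[OF mem(3,4) ab] by blast
  obtain t4 where t4: "t4 > 0" "f a d = f a c + t4 *\<^sub>R rot s (u a)" using col_dir[OF mem(1,3) cd] by blast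
  define gl where "gl = (\<lambda>x. u a \<bullet> x - h a)"
  define gr where "gr = (\<lambda>x. h b - u b \<bullet> x)"
  define gb where "gb = (\<lambda>x. v c \<bullet> x - k c)"
  define gt where "gt = (\<lambda>x. k d - v d \<bullet> x)"
  note gs = gl_def gr_def gb_def gt_def
  note on = on_col[OF mem(1)] on_col[OF mem(2)] on_col[OF mem(3)] on_col[OF mem(4)]
    on_row[OF mem(1)] on_row[OF mem(2)] on_row[OF mem(3)] on_row[OF mem(4)]
  have z: "gl (f a c) = 0" "gl (f a d) = 0" "gr (f b c) = 0" "gr (f b d) = 0"
    "gb (f a c) = 0" "gb (f b c) = 0" "gt (f a d) = 0" "gt (f b d) = 0"
    by (simp_all add: gs on)
  have "gl (f b c) = t1 * (rot s (u a) \<bullet> v c)" unfolding t1(2) gl_def by (simp add: inner_diff_right on rot_skew)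
  then have \<alpha>: "gl (f b c) > 0" using t1 c by simp
  have "h b = u b \<bullet> f b c" by (simp add: on)
  then have "gr (f a c) = t1 * (rot s (u b) \<bullet> v c)" unfolding t1(2) gr_def by (simp add: inner_diff_right rot_skew)
  then have \<beta>1: "gr (f a c) > 0" using t1 c by simp
  have "h b = u b \<bullet> f b d" by (simp add: on)
  then have "gr (f a d) = t3 * (rot s (u b) \<bullet> v d)" unfolding t3(2) gr_def by (simp add: inner_diff_right rot_skew)
  then have \<beta>2: "gr (f a d) > 0" using t3 c by simp
  have "gb (f a d) = t4 * (rot s (u a) \<bullet> v c)" unfolding t4(2) gb_def by (simp add: inner_add_right on inner_commute)
  then have \<gamma>: "gb (f a d) > 0" using t4 c by simp
  have "k d = v d \<bullet> f a d" by (simp add: on)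
  then have "gt (f a c) = t4 * (rot s (u a) \<bullet> v d)" unfolding t4(2) gt_def by (simp add: inner_add_right inner_commute)
  then have \<delta>1: "gt (f a c) > 0" using t4 c by simp
  have "k d = v d \<bullet> f b d" by (simp add: on)
  then have "gt (f b c) = t2 * (rot s (u b) \<bullet> v d)" unfolding t2(2) gt_def by (simp add: inner_add_right inner_commute)
  then have \<delta>2: "gt (f b c) > 0" using t2 c by simp
  \<comment> \<open>The ratios are chosen so that \<open>gt + B gb = A gl + C gr\<close> holds at
    \<open>f a c\<close>, \<open>f b c\<close> and \<open>f a d\<close>; these are not collinear, so
    it holds everywhere. At \<open>x\<close> the left side is nonnegative and the right side
    nonpositive.\<close>
  define A where "A = gt (f b c) / gl (f b c)"
  define C where "C = gt (f a c) / gr (f a c)"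
  define B where "B = C * gr (f a d) / gb (f a d)"
  have ABC: "A > 0" "B > 0" "C > 0" using \<alpha> \<beta>1 \<beta>2 \<gamma> \<delta>1 \<delta>2 by (simp_all add: A_def B_def C_def)
  define n where "n = - v d - A *\<^sub>R u a + B *\<^sub>R v c + C *\<^sub>R u b"
  define \<eta> where "\<eta> = - k d - A * h a + B * k c + C * h b"
  have E: "n \<bullet> y - \<eta> = gt y - A * gl y + B * gb y - C * gr y" for y
    by (simp add: n_def \<eta>_def gs inner_add_left inner_diff_left algebra_simps)
  have "rot 1 (f b c - f a c) \<bullet> (f a d - f a c) = t1 * t4 * s * (s * (rot 1 (u a) \<bullet> v c))"
    unfolding t1(2) t4(2) by (simp add: inner2) algebra
  also have "s * (rot 1 (u a) \<bullet> v c) = rot s (u a) \<bullet> v c" by (simp add: inner2 algebra_simps)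
  finally have nz: "rot 1 (f b c - f a c) \<bullet> (f a d - f a c) \<noteq> 0"
    using t1(1) t4(1) c(1) s by (simp add: s_nz)
  have e1: "n \<bullet> f a c = \<eta>" using E[of "f a c"] z \<beta>1 by (simp add: C_def)
  have e2: "n \<bullet> f b c = \<eta>" using E[of "f b c"] z \<alpha> by (simp add: A_def)
  have e3: "n \<bullet> f a d = \<eta>" using E[of "f a d"] z \<gamma> by (simp add: B_def)
  have "n \<bullet> x = \<eta>" by (rule affine_zero_on_plane[OF e1 e2 e3 nz])
  then have "gt x + B * gb x + A * (- gl x) + C * (- gr x) = 0" using E[of x] by simp
  moreover have "gt x \<ge> 0" "B * gb x \<ge> 0" "A * (- gl x) \<ge> 0" "C * (- gr x) \<ge> 0"
    using x xb ABC unfolding gs by (simp_all add: mult_nonneg_nonneg mult_le_0_iff mult_nonpos_nonpos)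
  ultimately have "gt x = 0" "B * gb x = 0" "A * (- gl x) = 0" by linarith+
  \<comment> \<open>Hence \<open>x\<close> would be the vertex \<open>f a c\<close>, where
    \<open>gt\<close> is positive.\<close>
  then have 0: "gt x = 0" "gb x = 0" "gl x = 0" using ABC by auto
  define y where "y = x - f a c"
  have y: "u a \<bullet> y = 0" "v c \<bullet> y = 0" using 0 z unfolding gs y_def by (simp_all add: inner_diff_right)
  have "y$1 * (rot s (u a) \<bullet> v c) = 0" "y$2 * (rot s (u a) \<bullet> v c) = 0"
    using y unfolding inner2 rot_nth by algebra+
  then have "y = 0" using c(1) by (simp add: eq2_iff)
  then show False using 0 \<delta>1 by (simp add: y_def)
qed

end

section \<open>The Ivory-type theorem\<close>

lemma inner_add_self: "(x + y) \<bullet> (x + y) = x \<bullet> x + 2 * (x \<bullet> y) + y \<bullet> y"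
  and inner_diff_self: "(x - y) \<bullet> (x - y) = x \<bullet> x - 2 * (x \<bullet> y) + y \<bullet> y" for x y :: "'a::real_inner"
  by (simp_all add: inner_add_left inner_add_right inner_diff_left inner_diff_right inner_commute)

section \<open>Uniqueness of the incircle and length of exterior tangents\<close>

lemma inscribed_circle_signedE:
  assumes "inscribed_circle (A, B, C, D) p r"
  obtains ta tb tc td a b c d s where "B - A = ta *\<^sub>R a" "C - B = tb *\<^sub>R b" "D - C = tc *\<^sub>R c" "A - D = td *\<^sub>R d"
    "ta > 0" "tb > 0" "tc > 0" "td > 0" "norm a = 1" "norm b = 1" "norm c = 1" "norm d = 1" "s = 1 \<or> s = -1"
    "rot s a \<bullet> b > 0" "rot s b \<bullet> c > 0" "rot s c \<bullet> d > 0" "rot s d \<bullet> a > 0"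
    "rot s a \<bullet> (p - A) = r" "rot s b \<bullet> (p - B) = r" "rot s c \<bullet> (p - C) = r" "rot s d \<bullet> (p - D) = r"
proof -
  have ne: "A \<noteq> B" "B \<noteq> C" "C \<noteq> D" "D \<noteq> A"
    using assms by (auto simp: touches_side_def)
  have x: "y - x = norm (y - x) *\<^sub>R sgn (y - x)" "norm (y - x) > 0" "norm (sgn (y - x)) = 1" if "x \<noteq> y" for x y :: "real^2"
    using that by (simp_all add: sgn_div_norm)
  from inscribed_circle_signed[OF assms x(1)[OF ne(1)] x(1)[OF ne(2)] x(1)[OF ne(3)] x(1)[OF ne(4)]
      x(2)[OF ne(1)] x(2)[OF ne(2)] x(2)[OF ne(3)] x(2)[OF ne(4)] x(3)[OF ne(1)] x(3)[OF ne(2)] x(3)[OF ne(3)] x(3)[OF ne(4)]]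
  obtain s where "s = 1 \<or> s = -1"
    "rot s (sgn (B - A)) \<bullet> sgn (C - B) > 0" "rot s (sgn (C - B)) \<bullet> sgn (D - C) > 0"
    "rot s (sgn (D - C)) \<bullet> sgn (A - D) > 0" "rot s (sgn (A - D)) \<bullet> sgn (B - A) > 0"
    "rot s (sgn (B - A)) \<bullet> (p - A) = r" "rot s (sgn (C - B)) \<bullet> (p - B) = r"
    "rot s (sgn (D - C)) \<bullet> (p - C) = r" "rot s (sgn (A - D)) \<bullet> (p - D) = r"
    by blast
  then show thesis
    by (rule that[OF x(1)[OF ne(1)] x(1)[OF ne(2)] x(1)[OF ne(3)] x(1)[OF ne(4)]
      x(2)[OF ne(1)] x(2)[OF ne(2)] x(2)[OF ne(3)] x(2)[OF ne(4)] x(3)[OF ne(1)] x(3)[OF ne(2)] x(3)[OF ne(3)] x(3)[OF ne(4)]])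
qed

text \<open>Both circles are seen with the same orientation, so all four signed distances of the
  centers differ by \<open>r - r'\<close>. Weighting them with the side lengths, and using that the
  sides form a closed polygon, shows that the perimeter times \<open>r - r'\<close> is zero.\<close>

lemma inscribed_circle_unique:
  assumes ic: "inscribed_circle Q p r" and ic': "inscribed_circle Q p' r'"
  shows "p = p'" "r = r'"
proof -
  obtain A B C D where Q: "Q = (A, B, C, D)" by (cases Q) auto
  from ic[unfolded Q] obtain ta tb tc td a b c d s where 1: "B - A = ta *\<^sub>R a" "C - B = tb *\<^sub>R b" "D - C = tc *\<^sub>R c" "A - D = td *\<^sub>R d"
    "ta > 0" "tb > 0" "tc > 0" "td > 0" "norm a = 1" "norm b = 1" "norm c = 1" "norm d = 1" "s = 1 \<or> s = -1"
    "rot s a \<bullet> b > 0" "rot s b \<bullet> c > 0" "rot s c \<bullet> d > 0" "rot s d \<bullet> a > 0"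
    "rot s a \<bullet> (p - A) = r" "rot s b \<bullet> (p - B) = r" "rot s c \<bullet> (p - C) = r" "rot s d \<bullet> (p - D) = r"
    by (rule inscribed_circle_signedE)
  from inscribed_circle_signed[OF ic'[unfolded Q] 1(1-12)]
  obtain s' where 2: "s' = 1 \<or> s' = -1" "rot s' a \<bullet> b > 0"
    "rot s' a \<bullet> (p' - A) = r'" "rot s' b \<bullet> (p' - B) = r'" "rot s' c \<bullet> (p' - C) = r'" "rot s' d \<bullet> (p' - D) = r'"
    by blast
  have "s' = s" using 1(13,14) 2(1,2) by (auto simp: inner2)
  have e: "rot s a \<bullet> (p - p') = r - r'" "rot s b \<bullet> (p - p') = r - r'" "rot s c \<bullet> (p - p') = r - r'" "rot s d \<bullet> (p - p') = r - r'"
    using 1(18-21) 2(3-6) unfolding \<open>s' = s\<close> by (simp_all add: inner_diff_right)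
  have "ta *\<^sub>R a + tb *\<^sub>R b + tc *\<^sub>R c + td *\<^sub>R d = 0" unfolding 1(1-4)[symmetric] by simp
  then have "rot s (ta *\<^sub>R a + tb *\<^sub>R b + tc *\<^sub>R c + td *\<^sub>R d) \<bullet> (p - p') = 0" by (simp add: rot_def inner2)
  then have "ta * (r - r') + tb * (r - r') + tc * (r - r') + td * (r - r') = 0"
    by (simp only: rot_add rot_scaleR inner_add_left inner_scaleR_left e)
  then have "(ta + tb + tc + td) * (r - r') = 0" by (simp only: distrib_right)
  then show r: "r = r'" using 1(5-8) by auto
  define x where "x = p - p'"
  have "rot s a \<bullet> x = 0" "rot s b \<bullet> x = 0" using e r by (simp_all add: x_def)
  then have "x$1 * (s * (rot s a \<bullet> b)) = 0" "x$2 * (s * (rot s a \<bullet> b)) = 0" unfolding inner2 rot_nth by algebra+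
  then have "x = 0" using 1(13,14) by (auto simp add: eq2_iff)
  then show "p = p'" by (simp add: x_def)
qed

text \<open>The cross product \<open>N\<close> of the diagonals is, up to sign, twice the area,
  hence nonzero by convexity.\<close>

lemma inscribed_circle_diagonals:
  assumes "inscribed_circle (A, B, C, D) p r"
  obtains X where "X \<in> affine hull {A, C}" "X \<in> affine hull {B, D}"
proof -
  from assms obtain ta tb tc td a b c d s where 1: "B - A = ta *\<^sub>R a" "C - B = tb *\<^sub>R b" "D - C = tc *\<^sub>R c" "A - D = td *\<^sub>R d"
    "ta > 0" "tb > 0" "tc > 0" "td > 0" "norm a = 1" "norm b = 1" "norm c = 1" "norm d = 1" "s = 1 \<or> s = -1"
    "rot s a \<bullet> b > 0" "rot s b \<bullet> c > 0" "rot s c \<bullet> d > 0" "rot s d \<bullet> a > 0"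
    by (rule inscribed_circle_signedE)
  define N where "N = rot 1 (C - A) \<bullet> (D - B)"
  have "s * N = rot s (B - A) \<bullet> (C - B) + rot s (D - C) \<bullet> (A - D)"
    unfolding N_def by (simp add: inner2) algebra
  also have "\<dots> > 0" using 1 unfolding 1(1-4) by (simp add: rot_scaleR add_pos_pos)
  finally have N: "N \<noteq> 0" by auto
  define t where "t = (rot 1 (B - A) \<bullet> (D - B)) / N"
  define w where "w = (rot 1 (B - A) \<bullet> (C - A)) / N"
  have "N *\<^sub>R (B - A) = (rot 1 (B - A) \<bullet> (D - B)) *\<^sub>R (C - A) - (rot 1 (B - A) \<bullet> (C - A)) *\<^sub>R (D - B)"
    unfolding N_def by (simp add: eq2_iff inner2) algebra
  also have "\<dots> = N *\<^sub>R (t *\<^sub>R (C - A) - w *\<^sub>R (D - B))" using N by (simp add: t_def w_def scaleR_diff_right)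
  finally have BA: "B - A = t *\<^sub>R (C - A) - w *\<^sub>R (D - B)" using N by (metis scaleR_left_imp_eq)
  have "B + w *\<^sub>R (D - B) = A + (B - A) + w *\<^sub>R (D - B)" by simp
  also have "\<dots> = A + t *\<^sub>R (C - A)" unfolding BA by (simp only: add.assoc diff_add_cancel)
  finally have e: "A + t *\<^sub>R (C - A) = B + w *\<^sub>R (D - B)" ..
  have "(1 - t) *\<^sub>R A + t *\<^sub>R C \<in> affine hull {A, C}" "(1 - w) *\<^sub>R B + w *\<^sub>R D \<in> affine hull {B, D}"
    unfolding affine_hull_2 by force+
  moreover have "(1 - t) *\<^sub>R A + t *\<^sub>R C = A + t *\<^sub>R (C - A)" "(1 - w) *\<^sub>R B + w *\<^sub>R D = B + w *\<^sub>R (D - B)"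
    by (simp_all add: algebra_simps)
  ultimately show thesis using that e by metis
qed

text \<open>The reflection argument of \<open>touches_sideE\<close> again: a single common point
  must be the foot \<open>F\<close> of the perpendicular.\<close>

lemma hyperplane_sphere_singleton:
  fixes n p T :: "real^2"
  assumes "n \<noteq> 0" "{x. n \<bullet> x = h} \<inter> sphere p r = {T}"
  shows "T = p - ((n \<bullet> p - h) / (n \<bullet> n)) *\<^sub>R n" "(n \<bullet> p - h)^2 = r^2 * (n \<bullet> n)"
proof -
  have nn: "n \<bullet> n \<noteq> 0" using assms by simp
  have T: "T \<in> {x. n \<bullet> x = h}" "T \<in> sphere p r" using assms(2) by blast+
  define e where "e = (n \<bullet> p - h) / (n \<bullet> n)"
  have en: "e * (n \<bullet> n) = n \<bullet> p - h" using nn by (simp add: e_def)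
  define F where "F = p - e *\<^sub>R n"
  have "n \<bullet> F = h" using en by (simp add: F_def inner_diff_right)
  define T' where "T' = 2 *\<^sub>R F - T"
  have hT': "n \<bullet> T' = h" using T \<open>n \<bullet> F = h\<close> by (simp add: T'_def inner_diff_right)
  have o: "n \<bullet> (F - T) = 0" using T \<open>n \<bullet> F = h\<close> by (simp add: inner_diff_right)
  have "p - T' = e *\<^sub>R n - (F - T)" "p - T = e *\<^sub>R n + (F - T)" by (simp_all add: T'_def F_def scaleR_2)
  then have "(p - T') \<bullet> (p - T') = (p - T) \<bullet> (p - T)"
    using o by (simp only: inner_add_self inner_diff_self inner_scaleR_left)
  then have "norm (p - T') = norm (p - T)" by (simp add: norm_eq)
  then have "T' \<in> sphere p r" using T by (simp add: dist_norm)
  then have "T' = T" using hT' assms(2) by blast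
  then have "2 *\<^sub>R T = 2 *\<^sub>R F" by (metis T'_def diff_add_cancel scaleR_2)
  then have TF: "T = F" by simp
  then show "T = p - ((n \<bullet> p - h) / (n \<bullet> n)) *\<^sub>R n" by (simp add: F_def e_def)
  have "norm (p - T) = r" using T by (simp add: dist_norm)
  then have "r^2 = (e *\<^sub>R n) \<bullet> (e *\<^sub>R n)" unfolding TF F_def by (simp only: dot_square_norm) simp
  also have "\<dots> = e * (e * (n \<bullet> n))" by simp
  finally have "r^2 * (n \<bullet> n) = (e * (n \<bullet> n)) * (e * (n \<bullet> n))" by simp
  then show "(n \<bullet> p - h)^2 = r^2 * (n \<bullet> n)" unfolding en by (simp add: power2_eq_square)
qed

text \<open>Having both circles on the same side selects \<open>g * g' = r * r' * N\<close> with the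
  positive sign, and then the length does not depend on the tangent. This is the uniqueness behind
  the definite description in \<open>d_C\<close>.\<close>

lemma exterior_tangent_points_dist:
  assumes "exterior_tangent_points p r p' r' T T'" "r > 0" "r' > 0"
  shows "dist T T' = sqrt ((p - p') \<bullet> (p - p') - (r - r')^2)"
proof -
  from assms(1) obtain n h where n: "n \<noteq> 0" and T: "{x. n \<bullet> x = h} \<inter> sphere p r = {T}"
    and T': "{x. n \<bullet> x = h} \<inter> sphere p' r' = {T'}" and side: "0 < (n \<bullet> p - h) * (n \<bullet> p' - h)"
    unfolding exterior_tangent_points_def by blast
  define g where "g = n \<bullet> p - h"
  define g' where "g' = n \<bullet> p' - h"
  define N where "N = n \<bullet> n"
  have N: "N > 0" using n by (simp add: N_def)
  note 1 = hyperplane_sphere_singleton[OF n T, folded g_def N_def]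
  note 2 = hyperplane_sphere_singleton[OF n T', folded g'_def N_def]
  have "(g * g')^2 = (r * r' * N)^2" using 1(2) 2(2) by (simp add: power_mult_distrib) (simp add: power2_eq_square)
  then have gg: "g * g' = r * r' * N" using side assms N
    by (simp add: g_def g'_def power2_eq_iff_nonneg)
  have np: "n \<bullet> (p - p') = g - g'" by (simp add: g_def g'_def inner_diff_right)
  define w where "w = (g - g') / N"
  have TT: "T - T' = (p - p') - w *\<^sub>R n" unfolding 1(1) 2(1) w_def by (simp add: algebra_simps diff_divide_distrib)
  have "(T - T') \<bullet> (T - T') = (p - p') \<bullet> (p - p') - 2 * ((p - p') \<bullet> (w *\<^sub>R n)) + (w *\<^sub>R n) \<bullet> (w *\<^sub>R n)"
    unfolding TT by (rule inner_diff_self)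
  also have "\<dots> = (p - p') \<bullet> (p - p') - 2 * w * (n \<bullet> (p - p')) + w^2 * N"
    by (simp only: inner_scaleR_left inner_scaleR_right N_def inner_commute[of "p - p'" n] power2_eq_square mult.assoc)
  also have "\<dots> = (p - p') \<bullet> (p - p') - (g - g')^2 / N" unfolding np w_def using N by (simp add: power2_eq_square)
  also have "(g - g')^2 = (r - r')^2 * N" using gg 1(2) 2(2) by (simp add: power2_diff algebra_simps)
  finally have "(T - T') \<bullet> (T - T') = (p - p') \<bullet> (p - p') - (r - r')^2" using N by simp
  then show ?thesis by (simp add: dist_norm norm_eq_sqrt_inner)
qed

lemma tangent_line_singleton:
  fixes n p :: "real^2"
  assumes "norm n = 1" "n \<bullet> p - h = r" "r > 0"
  shows "{x. n \<bullet> x = h} \<inter> sphere p r = {p - r *\<^sub>R n}"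
proof (intro equalityI subsetI)
  have nn: "n \<bullet> n = 1" using assms by (simp add: dot_square_norm)
  fix x assume "x \<in> {x. n \<bullet> x = h} \<inter> sphere p r"
  then have x: "n \<bullet> x = h" "norm (p - x) = r" by (auto simp: dist_norm)
  define y where "y = p - x"
  have y: "n \<bullet> y = r" "y \<bullet> y = r^2" using x assms by (simp_all add: y_def inner_diff_right dot_square_norm)
  have "(y - r *\<^sub>R n) \<bullet> (y - r *\<^sub>R n) = 0"
    unfolding inner_diff_self using y nn by (simp add: inner_commute power2_eq_square)
  then have "p - x = r *\<^sub>R n" by (simp add: y_def)
  then show "x \<in> {p - r *\<^sub>R n}" by (simp flip: \<open>p - x = r *\<^sub>R n\<close>)
next
  have nn: "n \<bullet> n = 1" using assms by (simp add: dot_square_norm)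
  fix x assume "x \<in> {p - r *\<^sub>R n}"
  then show "x \<in> {x. n \<bullet> x = h} \<inter> sphere p r" using assms nn by (auto simp: dist_norm inner_diff_right)
qed

text \<open>The given line is itself a common exterior tangent and supplies the existence part of
  the definite description.\<close>

lemma d_C_eq:
  assumes ic: "inscribed_circle Q p r" "inscribed_circle Q' p' r'"
    and n: "norm n = 1" "n \<bullet> p - h = r" "n \<bullet> p' - h = r'"
  shows "d_C Q Q' = sqrt ((p - p') \<bullet> (p - p') - (r - r')^2)"
proof -
  have r: "r > 0" "r' > 0" using ic by (cases Q; cases Q'; auto)+
  have "exterior_tangent_points p r p' r' (p - r *\<^sub>R n) (p' - r' *\<^sub>R n)"
    unfolding exterior_tangent_points_def
    using tangent_line_singleton[OF n(1,2) r(1)] tangent_line_singleton[OF n(1,3) r(2)] n r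
    by (intro exI[of _ n] exI[of _ h]) auto
  then show ?thesis unfolding d_C_def
    using ic r by (intro the_equality) (metis exterior_tangent_points_dist inscribed_circle_unique)+
qed

lemma incenter_eq: "inscribed_circle Q p r \<Longrightarrow> incenter Q = p"
  unfolding incenter_def by (rule the_equality) (auto dest: inscribed_circle_unique(1))

context ic_net begin

text \<open>Rotating the directions \<open>- rot s (v j)\<close>, \<open>rot s (u i')\<close>,
  \<open>rot s (v j')\<close>, \<open>- rot s (u i)\<close> of the sides once more gives the inward
  normals, so \<open>tang\<close> is the signed form of tangency.\<close>

lemma inscribed:
  assumes sq: "sq i i' j j'" and K: "tang i i' j j' p r" and r: "0 < r"
  shows "inscribed_circle (f i j, f i' j, f i' j', f i j') p r"
proof -
  note c = sq_cross[OF sq]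
  have mem: "(i, j) \<in> P" "(i', j) \<in> P" "(i', j') \<in> P" "(i, j') \<in> P" and ii: "i < i'" and jj: "j < j'"
    using sq by (auto simp: sq_def mem_rectangle)
  obtain t1 where t1: "t1 > 0" "f i' j = f i j - t1 *\<^sub>R rot s (v j)" using row_dir[OF mem(1,2) ii] by blast
  obtain t2 where t2: "t2 > 0" "f i' j' = f i' j + t2 *\<^sub>R rot s (u i')" using col_dir[OF mem(2,3) jj] by blast
  obtain t3 where t3: "t3 > 0" "f i' j' = f i j' - t3 *\<^sub>R rot s (v j')" using row_dir[OF mem(4,3) ii] by blast
  obtain t4 where t4: "t4 > 0" "f i j' = f i j + t4 *\<^sub>R rot s (u i)" using col_dir[OF mem(1,4) jj] by blast
  have d: "u i \<bullet> (p - f i j) = r" "u i' \<bullet> (p - f i' j) = - r" "v j \<bullet> (p - f i j) = r" "v j' \<bullet> (p - f i' j') = - r"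
    "u i \<bullet> (p - f i j') = r"
    using K on_col[OF mem(1)] on_col[OF mem(2)] on_col[OF mem(4)] on_row[OF mem(1)] on_row[OF mem(3)] unfolding tang_def
    by (simp_all add: inner_diff_right)
  show ?thesis
  proof (rule inscribed_circleI_signed[where a = "- rot s (v j)" and b = "rot s (u i')" and c = "rot s (v j')" and d = "- rot s (u i)"])
    show "f i' j - f i j = t1 *\<^sub>R - rot s (v j)" using t1 by simp
    show "f i' j' - f i' j = t2 *\<^sub>R rot s (u i')" using t2 by simp
    show "f i j' - f i' j' = t3 *\<^sub>R rot s (v j')" using t3 by simp
    show "f i j - f i j' = t4 *\<^sub>R - rot s (u i)" using t4 by simp
    show "s = 1 \<or> s = -1" by (rule s)
  qed (use t1(1) t2(1) t3(1) t4(1) r c d in \<open>simp_all add: rot_minus rot_rot[OF s] norm_rot[OF s] unit_u unit_v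
    rot_skew rot_swap[of s "v b" "u a" for a b]\<close>)
qed

definition cen :: "int \<Rightarrow> int \<Rightarrow> real^2" where
  "cen i j = (SOME p. \<exists>r>0. tang i (i + 1) j (j + 1) p r)"

definition rad :: "int \<Rightarrow> int \<Rightarrow> real" where
  "rad i j = v j \<bullet> cen i j - k j"

lemma cen:
  assumes "is_unit_square P i j"
  shows "tang i (i + 1) j (j + 1) (cen i j) (rad i j)" "rad i j > 0"
proof -
  have "\<exists>p. \<exists>r>0. tang i (i + 1) j (j + 1) p r" using circle_exists[of i "i + 1" j "j + 1"] assms by (auto simp: sq_unit)
  then have "\<exists>r>0. tang i (i + 1) j (j + 1) (cen i j) r" unfolding cen_def by (rule someI_ex)
  then obtain r where r: "r > 0" "tang i (i + 1) j (j + 1) (cen i j) r" by blast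
  then have "r = rad i j" by (simp add: tang_def rad_def)
  then show "tang i (i + 1) j (j + 1) (cen i j) (rad i j)" "rad i j > 0" using r by auto
qed

lemma cenD:
  assumes "is_unit_square P i j"
  shows "u i \<bullet> cen i j = h i + rad i j" "u (i + 1) \<bullet> cen i j = h (i + 1) - rad i j"
    "v j \<bullet> cen i j = k j + rad i j" "v (j + 1) \<bullet> cen i j = k (j + 1) - rad i j"
  using cen[OF assms] by (simp_all add: tang_def)

lemma inscribed_unit: "is_unit_square P i j \<Longrightarrow> inscribed_circle (unit_square f i j) (cen i j) (rad i j)"
  using inscribed[OF _ cen] by (simp add: sq_unit net_square_def)

text \<open>Rows \<open>j\<close> and \<open>j + 1\<close> both touch the incircles between them, so
  displacements of tangent points agree on the two rows.\<close>

lemma row_switch: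
  assumes "is_unit_square P i j" "is_unit_square P i' j"
  shows "rot s (v (j + 1)) \<bullet> (cen i' j - cen i j) = rot s (v j) \<bullet> (cen i' j - cen i j)"
  using bisector_perp[of "v j" "- v (j + 1)" "cen i' j - cen i j" s] cenD[OF assms(1)] cenD[OF assms(2)]
    v_ne_minus[OF goodI(1,3)[OF assms(1)]]
  by (simp add: unit_v rot_minus inner_diff_right)

lemma col_switch:
  assumes "is_unit_square P i j" "is_unit_square P i j'"
  shows "rot s (u (i + 1)) \<bullet> (cen i j' - cen i j) = rot s (u i) \<bullet> (cen i j' - cen i j)"
  using bisector_perp[of "u i" "- u (i + 1)" "cen i j' - cen i j" s] cenD[OF assms(1)] cenD[OF assms(2)]
    u_ne_minus[OF goodI(1,2)[OF assms(1)]]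
  by (simp add: unit_u rot_minus inner_diff_right)

text \<open>Pitot's relation for the net-square of side \<open>c + 1\<close>, with the lines
  \<open>j + c + 1\<close> and \<open>i + c + 1\<close> replaced by \<open>j + c\<close> and
  \<open>i + c\<close>. In this form the relations of neighbouring net-squares share terms.\<close>

lemma corner_circles_sum:
  assumes c: "even c" "c \<ge> 0" and us: "is_unit_square P i j" "is_unit_square P (i + c) (j + c)"
  shows "rot s (v j) \<bullet> (cen (i + c) j - cen i j) + rot s (v (j + c)) \<bullet> (cen (i + c) (j + c) - cen i (j + c))
    + rot s (u i) \<bullet> (cen i (j + c) - cen i j) + rot s (u (i + c)) \<bullet> (cen (i + c) (j + c) - cen (i + c) j) = 0"
proof -
  have sq: "sq i (i + c + 1) j (j + c + 1)" using us c by (auto simp: is_unit_square_rectangle sq_def)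
  have us': "is_unit_square P (i + c) j" "is_unit_square P i (j + c)"
    using us c by (auto simp: is_unit_square_rectangle)
  obtain K \<rho> where K: "tang i (i + c + 1) j (j + c + 1) K \<rho>" using circle_exists[OF sq] by blast
  have "rot s (v j) \<bullet> (cen (i + c) j - cen i j) - rot s (u (i + c + 1)) \<bullet> (cen (i + c) j - cen (i + c) (j + c))
     - rot s (v (j + c + 1)) \<bullet> (cen i (j + c) - cen (i + c) (j + c)) + rot s (u i) \<bullet> (cen i (j + c) - cen i j) = 0"
    using cenD[OF us(1)] cenD[OF us(2)] cenD[OF us'(1)] cenD[OF us'(2)] by (intro sq_pitot[OF sq K]) simp_all
  then show ?thesis using row_switch[OF us'(2) us(2)] col_switch[OF us'(1) us(2)] by (simp add: inner_diff_right)
qed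

lemma ivory_aux:
  assumes c: "even c" "c \<ge> 0"
    and us: "is_unit_square P (i - c) j" "is_unit_square P (i + c) j" "is_unit_square P i (j - c)" "is_unit_square P i (j + c)"
  shows "d_C (unit_square f (i - c) j) (unit_square f (i + c) j) = d_C (unit_square f i (j - c)) (unit_square f i (j + c))"
proof -
  have r: "m1 < i - c" "i + c + 1 < m2" "n1 < j - c" "j + c + 1 < n2" "even (i + j)"
    using us c by (auto simp: is_unit_square_rectangle)
  have U: "is_unit_square P (i + a) (j + b)" if "even (a + b)" "- c \<le> a" "a \<le> c" "- c \<le> b" "b \<le> c" for a b
  proof -
    have "i + a + (j + b) = (i + j) + (a + b)" by simp
    then have "even (i + a + (j + b))" using r(5) that(1) by (metis even_add)
    then show ?thesis using r that by (auto simp: is_unit_square_rectangle)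
  qed
  \<comment> \<open>Four net-squares of side \<open>c + 1\<close> that share the unit net-square at
    \<open>(i, j)\<close>, and their union of side \<open>2 * c + 1\<close>.\<close>
  have S1: "rot s (v (j - c)) \<bullet> (cen i (j - c) - cen (i - c) (j - c)) + rot s (v j) \<bullet> (cen i j - cen (i - c) j)
    + rot s (u (i - c)) \<bullet> (cen (i - c) j - cen (i - c) (j - c)) + rot s (u i) \<bullet> (cen i j - cen i (j - c)) = 0"
    using corner_circles_sum[OF c, of "i - c" "j - c"] U[of "-c" "-c"] U[of 0 0] c by simp
  have S2: "rot s (v (j - c)) \<bullet> (cen (i + c) (j - c) - cen i (j - c)) + rot s (v j) \<bullet> (cen (i + c) j - cen i j)
    + rot s (u i) \<bullet> (cen i j - cen i (j - c)) + rot s (u (i + c)) \<bullet> (cen (i + c) j - cen (i + c) (j - c)) = 0"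
    using corner_circles_sum[OF c, of i "j - c"] U[of 0 "-c"] U[of c 0] c by simp
  have S3: "rot s (v j) \<bullet> (cen i j - cen (i - c) j) + rot s (v (j + c)) \<bullet> (cen i (j + c) - cen (i - c) (j + c))
    + rot s (u (i - c)) \<bullet> (cen (i - c) (j + c) - cen (i - c) j) + rot s (u i) \<bullet> (cen i (j + c) - cen i j) = 0"
    using corner_circles_sum[OF c, of "i - c" j] U[of "-c" 0] U[of 0 c] c by simp
  have S4: "rot s (v j) \<bullet> (cen (i + c) j - cen i j) + rot s (v (j + c)) \<bullet> (cen (i + c) (j + c) - cen i (j + c))
    + rot s (u i) \<bullet> (cen i (j + c) - cen i j) + rot s (u (i + c)) \<bullet> (cen (i + c) (j + c) - cen (i + c) j) = 0"
    using corner_circles_sum[OF c, of i j] U[of 0 0] U[of c c] c by simp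
  have S5: "rot s (v (j - c)) \<bullet> (cen (i + c) (j - c) - cen (i - c) (j - c)) + rot s (v (j + c)) \<bullet> (cen (i + c) (j + c) - cen (i - c) (j + c))
    + rot s (u (i - c)) \<bullet> (cen (i - c) (j + c) - cen (i - c) (j - c)) + rot s (u (i + c)) \<bullet> (cen (i + c) (j + c) - cen (i + c) (j - c)) = 0"
  proof -
    have "i - c + 2 * c = i + c" "j - c + 2 * c = j + c" by simp_all
    note * = corner_circles_sum[of "2 * c" "i - c" "j - c", unfolded this]
    show ?thesis by (rule *) (use U[of "-c" "-c"] U[of c c] c in simp_all)
  qed
  \<comment> \<open>In \<open>S1 + S2 + S3 + S4 - S5\<close> all terms on the outer rows and columns
    cancel, while those on row \<open>j\<close> and column \<open>i\<close> occur twice.\<close>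
  have main: "rot s (v j) \<bullet> (cen (i + c) j - cen (i - c) j) = - (rot s (u i) \<bullet> (cen i (j + c) - cen i (j - c)))"
    using S1 S2 S3 S4 S5 by (simp add: inner_diff_right)
  \<comment> \<open>The squared tangent length is the Lorentz square of the difference of the lifted
    circles; Pythagoras turns it into the displacement along the common line.\<close>
  have lor: "(p - p') \<bullet> (p - p') - (r - r')^2 = (rot s n \<bullet> (p' - p))^2"
    if n: "norm n = 1" "n \<bullet> p = l + r" "n \<bullet> p' = l + r'" for n p p' l r r'
  proof -
    have N: "n$1 * n$1 + n$2 * n$2 = 1" using n by (simp add: norm_eq_1_iff2)
    have s2: "s^2 = 1" using s by auto
    have "n \<bullet> (p - p') = r - r'" using n by (simp add: inner_diff_right)
    moreover have "(p - p') \<bullet> (p - p') - (n \<bullet> (p - p'))^2 = (rot s n \<bullet> (p' - p))^2"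
      using N s2 by (simp add: inner2) algebra
    ultimately show ?thesis by simp
  qed
  have "d_C (unit_square f (i - c) j) (unit_square f (i + c) j) = sqrt ((rot s (v j) \<bullet> (cen (i + c) j - cen (i - c) j))^2)"
    using d_C_eq[OF inscribed_unit[OF us(1)] inscribed_unit[OF us(2)] unit_v, of j "k j"]
      lor[OF unit_v cenD(3)[OF us(1)] cenD(3)[OF us(2)]] cenD(3)[OF us(1)] cenD(3)[OF us(2)] by simp
  moreover have "d_C (unit_square f i (j - c)) (unit_square f i (j + c)) = sqrt ((rot s (u i) \<bullet> (cen i (j + c) - cen i (j - c)))^2)"
    using d_C_eq[OF inscribed_unit[OF us(3)] inscribed_unit[OF us(4)] unit_u, of i "h i"]
      lor[OF unit_u cenD(1)[OF us(3)] cenD(1)[OF us(4)]] cenD(1)[OF us(3)] cenD(1)[OF us(4)] by simp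
  ultimately show ?thesis unfolding main by simp
qed

end

lemma d_C_commute: "d_C Q Q' = d_C Q' Q"
proof -
  have "exterior_tangent_points p r p' r' T T' \<longleftrightarrow> exterior_tangent_points p' r' p r T' T" for p r p' r' T T'
    unfolding exterior_tangent_points_def by (auto simp: mult.commute)
  then have "(\<exists>p r p' r' T T'. inscribed_circle Q p r \<and> inscribed_circle Q' p' r' \<and> exterior_tangent_points p r p' r' T T' \<and> d = dist T T')
    \<longleftrightarrow> (\<exists>p r p' r' T T'. inscribed_circle Q' p r \<and> inscribed_circle Q p' r' \<and> exterior_tangent_points p r p' r' T T' \<and> d = dist T T')" for d
    by (metis dist_commute)
  then show ?thesis unfolding d_C_def by simp
qed

context ic_net begin

theorem ivory:
  assumes "even c" "is_unit_square P (i - c) j" "is_unit_square P (i + c) j" "is_unit_square P i (j - c)" "is_unit_square P i (j + c)"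
  shows "d_C (unit_square f (i - c) j) (unit_square f (i + c) j) = d_C (unit_square f i (j - c)) (unit_square f i (j + c))"
proof (cases "c \<ge> 0")
  case True then show ?thesis using assms by (intro ivory_aux)
next
  case False
  then show ?thesis using assms ivory_aux[of "- c" i j] by (simp add: d_C_commute)
qed

end

section \<open>Perspective net-squares\<close>

lemma inner_eq_imp_zero:
  fixes x :: "real^2"
  assumes "rot s n \<bullet> n' \<noteq> 0" "n \<bullet> x = 0" "n' \<bullet> x = 0"
  shows "x = 0"
proof -
  have "x$1 * (rot s n \<bullet> n') = 0" "x$2 * (rot s n \<bullet> n') = 0" using assms(2,3) unfolding inner2 rot_nth by algebra+
  then show ?thesis using assms(1) by (simp add: eq2_iff)
qed

lemma inner_le_1: "norm a = 1 \<Longrightarrow> norm b = 1 \<Longrightarrow> a \<bullet> b \<le> 1" "norm a = 1 \<Longrightarrow> norm b = 1 \<Longrightarrow> -1 \<le> a \<bullet> b" for a b :: "'a::real_inner"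
  using Cauchy_Schwarz_ineq2[of a b] by auto

definition alt :: "int \<Rightarrow> real" where
  "alt a = (if even a then 1 else -1)"

context ic_net begin

text \<open>With alternating orientations of the lines, the incircle of every net-square becomes an oriented circle that
  touches all four lines of the net-square in the same sense; \<open>Lu a\<close> and \<open>Lv b\<close> are the oriented distances.\<close>

definition Lu :: "int \<Rightarrow> real^2 \<Rightarrow> real" where
  "Lu a p = alt a * (u a \<bullet> p - h a)"

definition Lv :: "int \<Rightarrow> real^2 \<Rightarrow> real" where
  "Lv b p = alt b * (v b \<bullet> p - k b)"

definition stang :: "int \<Rightarrow> int \<Rightarrow> int \<Rightarrow> int \<Rightarrow> real^2 \<Rightarrow> real \<Rightarrow> bool" where
  "stang a a' b b' p \<rho> \<longleftrightarrow> Lu a p = \<rho> \<and> Lu a' p = \<rho> \<and> Lv b p = \<rho> \<and> Lv b' p = \<rho>"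

text \<open>\<open>i\<close> and \<open>j\<close> have one parity, \<open>i'\<close> and
  \<open>j'\<close> the other, so up to a global sign \<open>alt\<close> reverses exactly the two
  outward normals.\<close>

lemma stang_of_tang:
  assumes "sq i i' j j'" "tang i i' j j' p r"
  shows "stang i i' j j' p (alt i * r)"
proof -
  have e: "alt i' = - alt i" "alt j = alt i" "alt j' = - alt i"
  proof -
    have "even i' \<longleftrightarrow> odd i" "even j \<longleftrightarrow> even i" "even j' \<longleftrightarrow> odd i"
      using assms(1) unfolding sq_def by presburger+
    then show "alt i' = - alt i" "alt j = alt i" "alt j' = - alt i" by (simp_all add: alt_def)
  qed
  show ?thesis using assms(2) unfolding stang_def tang_def Lu_def Lv_def e by (auto simp: algebra_simps)
qed

text \<open>The two points may be either pair of opposite corners in any order: \<open>stang\<close>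
  is symmetric in both pairs of lines, so minima and maxima enter only through the sign and the
  unsigned data.\<close>

lemma signed_circle:
  assumes rng: "(a, b) \<in> P" "(a', b') \<in> P" and "odd (a' - a)" "\<bar>a' - a\<bar> = \<bar>b' - b\<bar>" "even (min a a' + min b b')"
  obtains p r where "r > 0" "stang a a' b b' p (alt (min a a') * r)"
    "sq (min a a') (max a a') (min b b') (max b b')" "tang (min a a') (max a a') (min b b') (max b b') p r"
proof -
  have sq: "sq (min a a') (max a a') (min b b') (max b b')"
  proof -
    have "a \<noteq> a'" using assms(3) by auto
    then show ?thesis
      using assms unfolding sq_def mem_rectangle by (auto simp: min_def max_def split: if_splits)
  qed
  obtain p r where p: "r > 0" "tang (min a a') (max a a') (min b b') (max b b') p r" using circle_exists[OF sq] by blast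
  have "stang a a' b b' p (alt (min a a') * r)"
    using stang_of_tang[OF sq p(2)] unfolding stang_def by (auto simp: min_def max_def split: if_splits)
  then show thesis using that p sq by blast
qed

text \<open>The point \<open>x\<close> of the circle farthest in the direction \<open>u b'\<close>
  lies between the two rows and not beyond column \<open>b\<close>, so the order of the columns in
  the strip keeps it strictly before \<open>b'\<close>.\<close>

lemma column_gap_right:
  assumes sq: "sq a b c d" and K: "tang a b c d p r" and r: "r > 0" and bb: "b < b'"
    and g: "good P b' c" "good P b' d"
  shows "u b' \<bullet> p + r < h b'"
proof -
  define x where "x = p + r *\<^sub>R u b'"
  have cd: "c < d" using sq by (auto simp: sq_def)
  have i: "r * (w \<bullet> u b') \<le> r" "- r \<le> r * (w \<bullet> u b')" if "norm w = 1" for w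
    using mult_left_mono[OF inner_le_1(1)[OF that unit_u[of b']], of r] mult_left_mono[OF inner_le_1(2)[OF that unit_u[of b']], of r] r by simp_all
  have "u b' \<bullet> x < h b'"
  proof (rule strip_order[OF bb cd sq_good(2)[OF sq] g(1) sq_good(3)[OF sq] g(2)])
    show "k c \<le> v c \<bullet> x" "v d \<bullet> x \<le> k d" "u b \<bullet> x \<le> h b"
      using K i[OF unit_v[of c]] i[OF unit_v[of d]] i[OF unit_u[of b]] unfolding x_def tang_def by (simp_all add: inner_add_right)
  qed
  then show ?thesis unfolding x_def using unit_u[of b'] by (simp add: inner_add_right dot_square_norm)
qed

lemma column_gap_left:
  assumes sq: "sq a b c d" and K: "tang a b c d p r" and r: "r > 0" and aa: "a' < a"
    and g: "good P a' c" "good P a' d"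
  shows "h a' < u a' \<bullet> p - r"
proof (rule ccontr)
  define x where "x = p - r *\<^sub>R u a'"
  have cd: "c < d" using sq by (auto simp: sq_def)
  have i: "r * (w \<bullet> u a') \<le> r" "- r \<le> r * (w \<bullet> u a')" if "norm w = 1" for w
    using mult_left_mono[OF inner_le_1(1)[OF that unit_u[of a']], of r] mult_left_mono[OF inner_le_1(2)[OF that unit_u[of a']], of r] r by simp_all
  assume "\<not> h a' < u a' \<bullet> p - r"
  then have "u a' \<bullet> x \<le> h a'" unfolding x_def using unit_u[of a'] by (simp add: inner_diff_right dot_square_norm)
  then have "u a \<bullet> x < h a"
  proof (rule strip_order[OF aa cd g(1) sq_good(1)[OF sq] g(2) sq_good(4)[OF sq], rotated 2])
    show "k c \<le> v c \<bullet> x" "v d \<bullet> x \<le> k d"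
      using K i[OF unit_v[of c]] i[OF unit_v[of d]] unfolding x_def tang_def by (simp_all add: inner_diff_right)
  qed
  then show False using K i[OF unit_u[of a]] unfolding x_def tang_def by (simp add: inner_diff_right)
qed

text \<open>The inner circle stays strictly away from all four outer lines. Weighted with the outer
  side lengths the normals sum to zero, so these inequalities add up to: the perimeter times
  \<open>r' - r\<close> is positive.\<close>

lemma nested_radius:
  assumes sq: "sq a b c d" "sq a' b' c' d'" and nest: "a' < a" "b < b'" "c' < c" "d < d'"
    and K: "tang a b c d p r" "tang a' b' c' d' p' r'" and r: "r > 0"
  shows "r < r'"
proof -
  have *: "m1 < a'" "a < b" "b' < m2" "n1 < c'" "c < d" "d' < n2" using sq by (auto simp: sq_def)
  have g: "good P a' c" "good P a' d" "good P b' c" "good P b' d"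
    using * nest by (auto intro!: good_row_interior)
  have g': "good P a c'" "good P b c'" "good P a d'" "good P b d'"
    using * nest by (auto intro!: good_col_interior)
  note T = ic_net.column_gap_left[OF transpose, unfolded sq_transpose tang_transpose good_transpose, OF sq(1) K(1) r nest(3) g'(1,2)]
    ic_net.column_gap_right[OF transpose, unfolded sq_transpose tang_transpose good_transpose, OF sq(1) K(1) r nest(4) g'(3,4)]
    column_gap_left[OF sq(1) K(1) r nest(1) g(1,2)] column_gap_right[OF sq(1) K(1) r nest(2) g(3,4)]
  have mem: "(a', c') \<in> P" "(b', c') \<in> P" "(b', d') \<in> P" "(a', d') \<in> P" and ab': "a' < b'" and cd': "c' < d'"
    using sq by (auto simp: sq_def mem_rectangle)
  obtain t1 where t1: "t1 > 0" "f b' c' = f a' c' - t1 *\<^sub>R rot s (v c')" using row_dir[OF mem(1,2) ab'] by blast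
  obtain t2 where t2: "t2 > 0" "f b' d' = f b' c' + t2 *\<^sub>R rot s (u b')" using col_dir[OF mem(2,3) cd'] by blast
  obtain t3 where t3: "t3 > 0" "f b' d' = f a' d' - t3 *\<^sub>R rot s (v d')" using row_dir[OF mem(4,3) ab'] by blast
  obtain t4 where t4: "t4 > 0" "f a' d' = f a' c' + t4 *\<^sub>R rot s (u a')" using col_dir[OF mem(1,4) cd'] by blast
  have "f a' d' - t3 *\<^sub>R rot s (v d') = f a' c' - t1 *\<^sub>R rot s (v c') + t2 *\<^sub>R rot s (u b')"
    using t1(2) t2(2) t3(2) by metis
  then have "t4 *\<^sub>R rot s (u a') - t3 *\<^sub>R rot s (v d') + t1 *\<^sub>R rot s (v c') - t2 *\<^sub>R rot s (u b') = 0"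
    unfolding t4(2) by (simp add: algebra_simps)
  then have "rot s (t4 *\<^sub>R rot s (u a') - t3 *\<^sub>R rot s (v d') + t1 *\<^sub>R rot s (v c') - t2 *\<^sub>R rot s (u b')) = rot s 0"
    by simp
  then have "t4 *\<^sub>R u a' - t3 *\<^sub>R v d' + t1 *\<^sub>R v c' - t2 *\<^sub>R u b' = 0"
    unfolding rot_add rot_diff rot_scaleR rot_rot[OF s] by (simp add: eq2_iff)
  then have "(t4 *\<^sub>R u a' - t3 *\<^sub>R v d' + t1 *\<^sub>R v c' - t2 *\<^sub>R u b') \<bullet> (p' - p) = 0" by simp
  then have "t4 * (u a' \<bullet> (p' - p)) + t3 * (- (v d' \<bullet> (p' - p))) + t1 * (v c' \<bullet> (p' - p)) + t2 * (- (u b' \<bullet> (p' - p))) = 0"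
    by (simp only: inner_add_left inner_diff_left inner_scaleR_left)
  moreover have "u a' \<bullet> (p' - p) < r' - r" "- (v d' \<bullet> (p' - p)) < r' - r" "v c' \<bullet> (p' - p) < r' - r" "- (u b' \<bullet> (p' - p)) < r' - r"
    using K(2) T unfolding tang_def inner_diff_right by linarith+
  then have "t4 * (u a' \<bullet> (p' - p)) < t4 * (r' - r)" "t3 * (- (v d' \<bullet> (p' - p))) < t3 * (r' - r)"
    "t1 * (v c' \<bullet> (p' - p)) < t1 * (r' - r)" "t2 * (- (u b' \<bullet> (p' - p))) < t2 * (r' - r)"
    using t1(1) t2(1) t3(1) t4(1) by (auto intro!: mult_strict_left_mono simp only:)
  ultimately have "0 < t4 * (r' - r) + t3 * (r' - r) + t1 * (r' - r) + t2 * (r' - r)" by linarith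
  then have "0 < (t4 + t3 + t1 + t2) * (r' - r)" by (simp only: distrib_right)
  then show ?thesis using t1(1) t2(1) t3(1) t4(1) by (simp add: zero_less_mult_iff)
qed

text \<open>Both oriented circles touch the two lines through the vertex, so the line through their
  lifts meets the plane of radius zero at this vertex. The form without division covers equal
  radii.\<close>

lemma center_of_similitude:
  assumes g: "good P a b" and p: "Lu a p = \<rho>" "Lv b p = \<rho>" and q: "Lu a q = \<tau>" "Lv b q = \<tau>"
  shows "(\<tau> - \<rho>) *\<^sub>R f a b = \<tau> *\<^sub>R p - \<rho> *\<^sub>R q"
proof -
  define x where "x = (\<tau> - \<rho>) *\<^sub>R f a b - (\<tau> *\<^sub>R p - \<rho> *\<^sub>R q)"
  have on: "u a \<bullet> f a b = h a" "v b \<bullet> f a b = k b" using on_col on_row goodD[OF g] by auto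
  have a: "alt a * alt a = 1" for a by (simp add: alt_def)
  have lu: "u a \<bullet> y = h a + alt a * Lu a y" "v b \<bullet> y = k b + alt b * Lv b y" for y
    unfolding Lu_def Lv_def mult.assoc[symmetric] a by simp_all
  have "u a \<bullet> x = 0" "v b \<bullet> x = 0"
    unfolding x_def inner_diff_right inner_scaleR_right on unfolding lu p q by (simp_all add: algebra_simps)
  then have "x = 0" using inner_eq_imp_zero[of s "u a" "v b" x] good_cross[OF g] by simp
  then show ?thesis by (simp add: x_def)
qed

text \<open>Monge's theorem: in use \<open>q\<close> is the incircle of the net-square with opposite
  corners \<open>f a b\<close> and \<open>f a' b'\<close>; eliminating it from two similitude
  equations leaves the center of similitude of \<open>p\<close> and \<open>p'\<close>.\<close>

lemma perspective_point:
  assumes g: "good P a b" "good P a' b'" and q: "stang a a' b b' q \<tau>" and \<tau>: "\<tau> \<noteq> 0"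
    and p: "Lu a p = \<rho>" "Lv b p = \<rho>" and p': "Lu a' p' = \<rho>'" "Lv b' p' = \<rho>'" and ne: "\<rho>' \<noteq> \<rho>"
  shows "(1 / (\<rho>' - \<rho>)) *\<^sub>R (\<rho>' *\<^sub>R p - \<rho> *\<^sub>R p') \<in> affine hull {f a b, f a' b'}"
proof -
  have 1: "(\<tau> - \<rho>) *\<^sub>R f a b = \<tau> *\<^sub>R p - \<rho> *\<^sub>R q" using q by (intro center_of_similitude g p) (auto simp: stang_def)
  have 2: "(\<tau> - \<rho>') *\<^sub>R f a' b' = \<tau> *\<^sub>R p' - \<rho>' *\<^sub>R q" using q by (intro center_of_similitude g p') (auto simp: stang_def)
  define D where "D = \<tau> * (\<rho>' - \<rho>)"
  have D: "D \<noteq> 0" using \<tau> ne by (simp add: D_def)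
  have "(\<rho>' * (\<tau> - \<rho>)) *\<^sub>R f a b - (\<rho> * (\<tau> - \<rho>')) *\<^sub>R f a' b' = \<tau> *\<^sub>R (\<rho>' *\<^sub>R p - \<rho> *\<^sub>R p')"
    unfolding scaleR_scaleR[symmetric] 1 2 by (simp add: algebra_simps)
  then have "(1 / D) *\<^sub>R ((\<rho>' * (\<tau> - \<rho>)) *\<^sub>R f a b - (\<rho> * (\<tau> - \<rho>')) *\<^sub>R f a' b') = (1 / (\<rho>' - \<rho>)) *\<^sub>R (\<rho>' *\<^sub>R p - \<rho> *\<^sub>R p')"
    using \<tau> by (simp add: D_def)
  then have eq: "(1 / (\<rho>' - \<rho>)) *\<^sub>R (\<rho>' *\<^sub>R p - \<rho> *\<^sub>R p') = (\<rho>' * (\<tau> - \<rho>) / D) *\<^sub>R f a b + (- \<rho> * (\<tau> - \<rho>') / D) *\<^sub>R f a' b'"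
    by (simp add: scaleR_diff_right)
  have "\<rho>' * (\<tau> - \<rho>) / D + - \<rho> * (\<tau> - \<rho>') / D = (\<rho>' * (\<tau> - \<rho>) + - \<rho> * (\<tau> - \<rho>')) / D" by (rule add_divide_distrib[symmetric])
  also have "\<rho>' * (\<tau> - \<rho>) + - \<rho> * (\<tau> - \<rho>') = D" by (simp add: D_def algebra_simps)
  finally have "\<rho>' * (\<tau> - \<rho>) / D + - \<rho> * (\<tau> - \<rho>') / D = 1" using D by simp
  then show ?thesis unfolding eq affine_hull_2 by blast
qed

theorem perspective_net_squares:
  assumes l: "odd l" and ns: "is_net_square P i j c" "is_net_square P (i - l) (j - l) (c + 2 * l)" and lc: "l \<noteq> - c"
  shows "perspective (net_square f i j c) (net_square f (i - l) (j - l) (c + 2 * l))"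
proof -
  have *: "even (i + j)" "odd c" "(i, j) \<in> P" "(i + c, j) \<in> P" "(i, j + c) \<in> P" "(i + c, j + c) \<in> P"
    using ns(1) by (auto simp: is_net_square_def)
  have e: "i - l + (c + 2 * l) = i + c + l" "j - l + (c + 2 * l) = j + c + l" by simp_all
  have **: "(i - l, j - l) \<in> P" "(i + c + l, j - l) \<in> P" "(i - l, j + c + l) \<in> P" "(i + c + l, j + c + l) \<in> P"
    using ns(2) unfolding is_net_square_def e by auto
  obtain p r where p: "r > 0" "stang i (i + c) j (j + c) p (alt (min i (i + c)) * r)"
      "sq (min i (i + c)) (max i (i + c)) (min j (j + c)) (max j (j + c))" "tang (min i (i + c)) (max i (i + c)) (min j (j + c)) (max j (j + c)) p r"
    by (rule signed_circle[of i j "i + c" "j + c"]) (use * in \<open>auto simp: min_def\<close>)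
  obtain p' r' where p': "r' > 0" "stang (i - l) (i + c + l) (j - l) (j + c + l) p' (alt (min (i - l) (i + c + l)) * r')"
      "sq (min (i - l) (i + c + l)) (max (i - l) (i + c + l)) (min (j - l) (j + c + l)) (max (j - l) (j + c + l))"
      "tang (min (i - l) (i + c + l)) (max (i - l) (i + c + l)) (min (j - l) (j + c + l)) (max (j - l) (j + c + l)) p' r'"
    by (rule signed_circle[of "i - l" "j - l" "i + c + l" "j + c + l"]) (use * ** l in \<open>auto simp: min_def\<close>)
  define \<rho> where "\<rho> = alt (min i (i + c)) * r"
  define \<rho>' where "\<rho>' = alt (min (i - l) (i + c + l)) * r'"
  \<comment> \<open>The signs agree when \<open>c\<close> and \<open>c + 2 * l\<close> have opposite
    signs. One net-square is then nested in the other, which makes the radii different.\<close>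
  have ne: "\<rho>' \<noteq> \<rho>"
  proof
    assume eq: "\<rho>' = \<rho>"
    then have rr: "r' = r" using p(1) p'(1) unfolding \<rho>_def \<rho>'_def alt_def by (auto split: if_splits)
    consider "min (i - l) (i + c + l) = min i (i + c)" | "min (i - l) (i + c + l) < min i (i + c)" | "min (i - l) (i + c + l) > min i (i + c)"
      by linarith
    then show False
    proof cases
      case 1
      then have "l = 0 \<or> l = - c" by (auto simp: min_def split: if_splits)
      then show False using l lc by auto
    next
      case 2
      have "r < r'" by (rule nested_radius[OF p(3) p'(3) _ _ _ _ p(4) p'(4) p(1)]) (use 2 in \<open>auto simp: min_def max_def split: if_splits\<close>)
      then show False using rr by simp
    next
      case 3
      have "r' < r" by (rule nested_radius[OF p'(3) p(3) _ _ _ _ p'(4) p(4) p'(1)]) (use 3 in \<open>auto simp: min_def max_def split: if_splits\<close>)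
      then show False using rr by simp
    qed
  qed
  define X where "X = (1 / (\<rho>' - \<rho>)) *\<^sub>R (\<rho>' *\<^sub>R p - \<rho> *\<^sub>R p')"
  have key: "X \<in> affine hull {f a b, f a' b'}"
    if ab: "(a, b) \<in> P" "(a', b') \<in> P" "odd (a' - a)" "\<bar>a' - a\<bar> = \<bar>b' - b\<bar>" "even (min a a' + min b b')"
      and L: "Lu a p = \<rho>" "Lv b p = \<rho>" "Lu a' p' = \<rho>'" "Lv b' p' = \<rho>'" for a b a' b'
  proof -
    obtain q t where q: "t > 0" "stang a a' b b' q (alt (min a a') * t)" "sq (min a a') (max a a') (min b b') (max b b')"
      by (rule signed_circle[OF ab])
    have "good P a b" "good P a' b'"
      using sq_good[OF q(3)] by (auto simp: min_def max_def split: if_splits)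
    then show ?thesis unfolding X_def
      using q(1) by (intro perspective_point[OF _ _ q(2) _ L ne]) (auto simp: alt_def)
  qed
  note L = p(2)[folded \<rho>_def, unfolded stang_def] and L' = p'(2)[folded \<rho>'_def, unfolded stang_def]
  have "X \<in> affine hull {f i j, f (i - l) (j - l)}"
    by (rule key) (use * ** l L L' in \<open>auto simp: min_def\<close>)
  moreover have "X \<in> affine hull {f (i + c) j, f (i + c + l) (j - l)}"
    by (rule key) (use * ** l L L' in \<open>auto simp: min_def\<close>)
  moreover have "X \<in> affine hull {f (i + c) (j + c), f (i + c + l) (j + c + l)}"
    by (rule key) (use * ** l L L' in \<open>auto simp: min_def\<close>)
  moreover have "X \<in> affine hull {f i (j + c), f (i - l) (j + c + l)}"
    by (rule key) (use * ** l L L' in \<open>auto simp: min_def\<close>)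
  ultimately show ?thesis unfolding net_square_def perspective.simps e by blast
qed

end

section \<open>Quadrics through two families of lines\<close>

lemma inner3: "(x::real^3) \<bullet> y = x$1 * y$1 + x$2 * y$2 + x$3 * y$3"
  by (simp add: inner_vec_def sum_3)

lemma eq3_iff: "(x::real^3) = y \<longleftrightarrow> x$1 = y$1 \<and> x$2 = y$2 \<and> x$3 = y$3"
  by (simp add: vec_eq_iff forall_3)

text \<open>A dimension count, used for normals of planes as well as for coefficient vectors of
  quadrics and conics through given points.\<close>

lemma orthogonal_to_fewer:
  fixes S :: "'a::euclidean_space set"
  assumes "finite S" "card S < DIM('a)"
  shows "\<exists>n. n \<noteq> 0 \<and> (\<forall>x\<in>S. n \<bullet> x = 0)"
proof -
  have "dim S < DIM('a)" using dim_le_card'[OF assms(1)] assms(2) by simp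
  then obtain n where "n \<noteq> 0" "\<And>y. y \<in> span S \<Longrightarrow> orthogonal n y"
    using orthogonal_to_subspace_exists by metis
  then show ?thesis by (auto simp: orthogonal_def span_base)
qed

lemma collinear_line:
  fixes S :: "'a::real_vector set"
  assumes "collinear S"
  obtains u where "\<And>x y. x \<in> S \<Longrightarrow> y \<in> S \<Longrightarrow> \<exists>t. y = x + t *\<^sub>R u"
proof -
  from assms obtain u where u: "\<And>x y. x \<in> S \<Longrightarrow> y \<in> S \<Longrightarrow> \<exists>c. x - y = c *\<^sub>R u"
    unfolding collinear_def by blast
  have "\<exists>t. y = x + t *\<^sub>R u" if "x \<in> S" "y \<in> S" for x y
    using u[OF that(2,1)] by (metis add.commute diff_add_cancel)
  then show thesis using that by blast
qed

lemma collinear_affine_const: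
  fixes S :: "'a::real_inner set"
  assumes S: "collinear S" and xy: "x \<in> S" "y \<in> S" "x \<noteq> y" and n: "n \<bullet> x = c" "n \<bullet> y = c" and w: "w \<in> S"
  shows "n \<bullet> w = c"
proof -
  obtain u where u: "\<And>x y. x \<in> S \<Longrightarrow> y \<in> S \<Longrightarrow> \<exists>t. y = x + t *\<^sub>R u" using collinear_line[OF S] by blast
  obtain t where t: "y = x + t *\<^sub>R u" using u xy by blast
  obtain t' where t': "w = x + t' *\<^sub>R u" using u xy w by blast
  have "t * (n \<bullet> u) = 0" using n unfolding t by (simp add: inner_add_right)
  then have "n \<bullet> u = 0" using t xy by auto
  then show ?thesis using n unfolding t' by (simp add: inner_add_right)
qed

lemma collinear_in_plane:
  fixes S :: "(real^3) set"
  assumes "collinear S"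
  obtains n c where "n \<noteq> 0" "\<And>x. x \<in> S \<Longrightarrow> n \<bullet> x = c"
proof -
  obtain u where u: "\<And>x y. x \<in> S \<Longrightarrow> y \<in> S \<Longrightarrow> \<exists>t. y = x + t *\<^sub>R u" using collinear_line[OF assms] by blast
  obtain n where n: "n \<noteq> 0" "n \<bullet> u = 0" using orthogonal_to_fewer[of "{u}"] by auto
  show thesis
  proof (cases "S = {}")
    case True then show thesis using that n by blast
  next
    case False
    then obtain x where "x \<in> S" by blast
    then have "n \<bullet> y = n \<bullet> x" if "y \<in> S" for y using u[OF _ that] n by (metis add.right_neutral inner_add_right inner_scaleR_right mult_zero_right)
    then show thesis using that n by blast
  qed
qed

text \<open>Sums of two products of affine functions: the equations of quadrics that are limits of those of signature (2,2).\<close>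

definition split_form :: "(real^3 \<Rightarrow> real) \<Rightarrow> bool" where
  "split_form F \<longleftrightarrow> (\<exists>a \<alpha> b \<beta> c \<gamma> d \<delta>. F = (\<lambda>x. (a \<bullet> x + \<alpha>) * (b \<bullet> x + \<beta>) + (c \<bullet> x + \<gamma>) * (d \<bullet> x + \<delta>)))"

lemma split_form_line:
  assumes "split_form F"
  obtains L Q where "\<And>t. F (x + t *\<^sub>R u) = F x + t * L + t^2 * Q"
proof -
  from assms obtain a \<alpha> b \<beta> c \<gamma> d \<delta> where F: "F = (\<lambda>x. (a \<bullet> x + \<alpha>) * (b \<bullet> x + \<beta>) + (c \<bullet> x + \<gamma>) * (d \<bullet> x + \<delta>))"
    unfolding split_form_def by blast
  have "F (x + t *\<^sub>R u) = F x + t * ((a \<bullet> u) * (b \<bullet> x + \<beta>) + (a \<bullet> x + \<alpha>) * (b \<bullet> u) + (c \<bullet> u) * (d \<bullet> x + \<delta>) + (c \<bullet> x + \<gamma>) * (d \<bullet> u))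
      + t^2 * ((a \<bullet> u) * (b \<bullet> u) + (c \<bullet> u) * (d \<bullet> u))" for t
    unfolding F by (simp add: inner_add_right power2_eq_square algebra_simps)
  then show thesis using that by blast
qed

lemma split_form_vanishes_on_line:
  assumes F: "split_form F" and S: "collinear S" and xyz: "x \<in> S" "y \<in> S" "z \<in> S" "x \<noteq> y" "x \<noteq> z" "y \<noteq> z"
    and 0: "F x = 0" "F y = 0" "F z = 0" and w: "w \<in> S"
  shows "F w = 0"
proof -
  obtain u where u: "\<And>x y. x \<in> S \<Longrightarrow> y \<in> S \<Longrightarrow> \<exists>t. y = x + t *\<^sub>R u" using collinear_line[OF S] by blast
  obtain t1 t2 t3 where t: "y = x + t1 *\<^sub>R u" "z = x + t2 *\<^sub>R u" "w = x + t3 *\<^sub>R u" using u xyz w by metis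
  obtain L Q where LQ: "\<And>t. F (x + t *\<^sub>R u) = F x + t * L + t^2 * Q" using split_form_line[OF F] by blast
  have ne: "t1 \<noteq> 0" "t2 \<noteq> 0" "t1 \<noteq> t2" using xyz t by auto
  have "t1 * L + t1^2 * Q = 0" "t2 * L + t2^2 * Q = 0" using 0 LQ[of t1] LQ[of t2] t by simp_all
  then have "t1 * (L + t1 * Q) = 0" "t2 * (L + t2 * Q) = 0" by (simp_all add: power2_eq_square algebra_simps)
  then have e: "L + t1 * Q = 0" "L + t2 * Q = 0" using ne by simp_all
  have "(t1 - t2) * Q = (L + t1 * Q) - (L + t2 * Q)" by (simp add: left_diff_distrib)
  then have "Q = 0" using ne e by simp
  then show ?thesis using e LQ[of t3] 0 t by simp
qed

lemma split_form_plane_pair: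
  assumes "n \<noteq> 0" "m \<noteq> 0"
  shows "split_form (\<lambda>x. (n \<bullet> x - c) * (m \<bullet> x - d))" "\<exists>x. (n \<bullet> x - c) * (m \<bullet> x - d) \<noteq> 0"
proof -
  show "split_form (\<lambda>x. (n \<bullet> x - c) * (m \<bullet> x - d))"
    unfolding split_form_def
    by (rule exI[of _ n], rule exI[of _ "- c"], rule exI[of _ m], rule exI[of _ "- d"], rule exI[of _ 0], rule exI[of _ 0]) simp
  obtain v where v: "n \<bullet> v \<noteq> 0" "m \<bullet> v \<noteq> 0"
  proof (cases "n \<bullet> m = 0")
    case True
    then show thesis using that[of "n + m"] assms by (simp add: inner_add_right inner_commute)
  next
    case False
    then show thesis using that[of n] assms by (simp add: inner_commute)
  qed
  show "\<exists>x. (n \<bullet> x - c) * (m \<bullet> x - d) \<noteq> 0"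
  proof (rule ccontr)
    assume "\<nexists>x. (n \<bullet> x - c) * (m \<bullet> x - d) \<noteq> 0"
    then have z: "(n \<bullet> x - c) * (m \<bullet> x - d) = 0" for x by blast
    \<comment> \<open>Second difference at the origin along \<open>v\<close>, a direction parallel
      to neither plane.\<close>
    have "2 * ((n \<bullet> v) * (m \<bullet> v)) = (n \<bullet> v - c) * (m \<bullet> v - d) + (n \<bullet> (- v) - c) * (m \<bullet> (- v) - d) - 2 * ((n \<bullet> 0 - c) * (m \<bullet> 0 - d))"
      by (simp add: algebra_simps)
    also have "\<dots> = 0" unfolding z by simp
    finally show False using v by simp
  qed
qed

lemma two_or_three:
  fixes I :: "'a set"
  obtains (two) a b where "I \<subseteq> {a, b}" | (three) x y z where "x \<in> I" "y \<in> I" "z \<in> I" "x \<noteq> y" "x \<noteq> z" "y \<noteq> z"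
  by (metis insert_iff subsetI)

text \<open>If two rows lie in a common plane, then so do all points. Otherwise the four vertices chosen on two rows span a
  tetrahedron, the forms that vanish on both rows are the combinations of the products \<open>g0 g2, g0 g3, g1 g2, g1 g3\<close> of
  its barycentric coordinates, and one of these also vanishes at three points of a third row.\<close>

theorem ruled_grid_split_form:
  fixes C :: "'i \<Rightarrow> 'j \<Rightarrow> real^3"
  assumes row: "\<And>i. i \<in> I \<Longrightarrow> collinear (C i ` J)" and col: "\<And>j. j \<in> J \<Longrightarrow> collinear ((\<lambda>i. C i j) ` I)"
    and injr: "\<And>i. i \<in> I \<Longrightarrow> inj_on (C i) J" and injc: "\<And>j. j \<in> J \<Longrightarrow> inj_on (\<lambda>i. C i j) I"
  obtains F where "split_form F" "\<exists>x. F x \<noteq> 0" "\<And>i j. i \<in> I \<Longrightarrow> j \<in> J \<Longrightarrow> F (C i j) = 0"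
proof (cases rule: two_or_three[of I])
  case (two a b)
  have pl: "\<exists>n c. n \<noteq> 0 \<and> (a \<in> I \<longrightarrow> (\<forall>j\<in>J. n \<bullet> C a j = c))" for a
  proof (cases "a \<in> I")
    case True then show ?thesis using collinear_in_plane[OF row[OF True]] by (metis imageI)
  next
    \<comment> \<open>An absent row imposes no condition, so any plane will do.\<close>
    case False then show ?thesis by (intro exI[of _ "axis 1 1"]) (simp add: axis_eq_0_iff)
  qed
  from pl[of a] pl[of b] obtain n c m d where nm: "n \<noteq> 0" "m \<noteq> 0"
    and p: "a \<in> I \<longrightarrow> (\<forall>j\<in>J. n \<bullet> C a j = c)" "b \<in> I \<longrightarrow> (\<forall>j\<in>J. m \<bullet> C b j = d)" by blast
  show thesis
    by (rule that[OF split_form_plane_pair(1)[OF nm, of c d] split_form_plane_pair(2)[OF nm, of c d]]) (use p two in auto)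
next
  case Ithree: (three i0 i1 i2)
  show thesis
  proof (cases rule: two_or_three[of J])
    case (two a b)
    have pl: "\<exists>n c. n \<noteq> 0 \<and> (a \<in> J \<longrightarrow> (\<forall>i\<in>I. n \<bullet> C i a = c))" for a
    proof (cases "a \<in> J")
      case True then show ?thesis using collinear_in_plane[OF col[OF True]] by (metis (no_types, lifting) imageI)
    next
      case False then show ?thesis by (intro exI[of _ "axis 1 1"]) (simp add: axis_eq_0_iff)
    qed
    from pl[of a] pl[of b] obtain n c m d where nm: "n \<noteq> 0" "m \<noteq> 0"
      and p: "a \<in> J \<longrightarrow> (\<forall>i\<in>I. n \<bullet> C i a = c)" "b \<in> J \<longrightarrow> (\<forall>i\<in>I. m \<bullet> C i b = d)" by blast
    show thesis
      by (rule that[OF split_form_plane_pair(1)[OF nm, of c d] split_form_plane_pair(2)[OF nm, of c d]]) (use p two in auto)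
  next
    case Jthree: (three j0 j1 j2)
    define A0 where "A0 = C i0 j0"
    define e1 where "e1 = C i0 j1 - A0"
    define e2 where "e2 = C i1 j0 - A0"
    define e3 where "e3 = C i1 j1 - A0"
    show thesis
    proof (cases "\<exists>n. n \<noteq> 0 \<and> n \<bullet> e1 = 0 \<and> n \<bullet> e2 = 0 \<and> n \<bullet> e3 = 0")
      case True
      then obtain n where n: "n \<noteq> 0" "n \<bullet> e1 = 0" "n \<bullet> e2 = 0" "n \<bullet> e3 = 0" by blast
      define c where "c = n \<bullet> A0"
      have 4: "n \<bullet> C i0 j0 = c" "n \<bullet> C i0 j1 = c" "n \<bullet> C i1 j0 = c" "n \<bullet> C i1 j1 = c"
        using n by (simp_all add: c_def A0_def e1_def e2_def e3_def inner_diff_right)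
      have 5: "n \<bullet> C i j = c" if "i = i0 \<or> i = i1" "j \<in> J" for i j
      proof -
        have i: "i \<in> I" using that Ithree by auto
        have "C i j0 \<noteq> C i j1" using injr[OF i] Jthree by (auto dest: inj_onD)
        then show ?thesis using collinear_affine_const[OF row[OF i], of "C i j0" "C i j1" n c "C i j"] 4 that Jthree by auto
      qed
      have "n \<bullet> C i j = c" if "i \<in> I" "j \<in> J" for i j
      proof -
        have "C i0 j \<noteq> C i1 j" using injc[OF that(2)] Ithree by (auto dest: inj_onD)
        then show ?thesis using collinear_affine_const[OF col[OF that(2)], of "C i0 j" "C i1 j" n c "C i j"] 5 that Ithree by auto
      qed
      then show thesis by (intro that[OF split_form_plane_pair[OF n(1) n(1), of c c]]) auto
    next
      case False
      have dual: "\<exists>a. a \<bullet> x = 1 \<and> a \<bullet> y = 0 \<and> a \<bullet> z = 0" if "{x, y, z} = {e1, e2, e3}" for x y z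
      proof -
        have "card {y, z} \<le> 2" by (simp add: card_insert_if)
        then have "\<exists>a. a \<noteq> 0 \<and> (\<forall>v\<in>{y, z}. a \<bullet> v = 0)" by (intro orthogonal_to_fewer) auto
        then obtain a where a: "a \<noteq> 0" "a \<bullet> y = 0" "a \<bullet> z = 0" by blast
        have "\<not> (\<forall>v\<in>{x, y, z}. a \<bullet> v = 0)" unfolding that using False a(1) by blast
        then have "a \<bullet> x \<noteq> 0" using a by blast
        then show ?thesis using a by (intro exI[of _ "(1 / (a \<bullet> x)) *\<^sub>R a"]) simp
      qed
      obtain a1 where a1: "a1 \<bullet> e1 = 1" "a1 \<bullet> e2 = 0" "a1 \<bullet> e3 = 0" using dual[of e1 e2 e3] by auto
      obtain a2 where a2: "a2 \<bullet> e2 = 1" "a2 \<bullet> e1 = 0" "a2 \<bullet> e3 = 0" using dual[of e2 e1 e3] by auto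
      obtain a3 where a3: "a3 \<bullet> e3 = 1" "a3 \<bullet> e1 = 0" "a3 \<bullet> e2 = 0" using dual[of e3 e1 e2] by auto
      define g1 where "g1 = (\<lambda>x. a1 \<bullet> x - a1 \<bullet> A0)"
      define g2 where "g2 = (\<lambda>x. a2 \<bullet> x - a2 \<bullet> A0)"
      define g3 where "g3 = (\<lambda>x. a3 \<bullet> x - a3 \<bullet> A0)"
      define g0 where "g0 = (\<lambda>x. 1 - g1 x - g2 x - g3 x)"
      \<comment> \<open>Values of the four products on row \<open>i2\<close>. Pairs of plane vectors
        form a four-dimensional space, so three points leave a nontrivial combination
        \<open>(c, d)\<close>.\<close>
      define w where "w = (\<lambda>j. (vector [g0 (C i2 j) * g2 (C i2 j), g0 (C i2 j) * g3 (C i2 j)], vector [g1 (C i2 j) * g2 (C i2 j), g1 (C i2 j) * g3 (C i2 j)]) :: (real^2) \<times> (real^2))"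
      have "card {w j0, w j1, w j2} \<le> 3" by (simp add: card_insert_if)
      then have "\<exists>a. a \<noteq> 0 \<and> (\<forall>v\<in>{w j0, w j1, w j2}. a \<bullet> v = 0)" by (intro orthogonal_to_fewer) auto
      then obtain c d where c: "(c, d) \<noteq> 0" "(c, d) \<bullet> w j0 = 0" "(c, d) \<bullet> w j1 = 0" "(c, d) \<bullet> w j2 = 0" by fast
      define F where "F = (\<lambda>x. g0 x * (c$1 * g2 x + c$2 * g3 x) + g1 x * (d$1 * g2 x + d$2 * g3 x))"
      have Fw: "F (C i2 j) = (c, d) \<bullet> w j" for j
        by (simp add: F_def w_def inner2 algebra_simps)
      have sf: "split_form F"
        unfolding split_form_def
      proof (intro exI)
        show "F = (\<lambda>x. ((- a1 - a2 - a3) \<bullet> x + (1 + a1 \<bullet> A0 + a2 \<bullet> A0 + a3 \<bullet> A0)) * ((c$1 *\<^sub>R a2 + c$2 *\<^sub>R a3) \<bullet> x + (- c$1 * (a2 \<bullet> A0) - c$2 * (a3 \<bullet> A0)))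
          + (a1 \<bullet> x + (- a1 \<bullet> A0)) * ((d$1 *\<^sub>R a2 + d$2 *\<^sub>R a3) \<bullet> x + (- d$1 * (a2 \<bullet> A0) - d$2 * (a3 \<bullet> A0))))"
          by (simp add: F_def g0_def g1_def g2_def g3_def inner_add_left inner_diff_left algebra_simps)
      qed
      have val: "g1 (A0 + x) = a1 \<bullet> x" "g2 (A0 + x) = a2 \<bullet> x" "g3 (A0 + x) = a3 \<bullet> x" for x
        by (simp_all add: g1_def g2_def g3_def inner_add_right)
      have nz: "\<exists>x. F x \<noteq> 0"
      proof (rule ccontr)
        assume "\<nexists>x. F x \<noteq> 0"
        then have z: "F x = 0" for x by blast
        \<comment> \<open>At the midpoint of an edge joining the two rows exactly one of the four
          products is nonzero.\<close>
        have "c$1 = 0" using z[of "A0 + (1/2) *\<^sub>R e2"] by (simp add: F_def g0_def val a1 a2 a3)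
        moreover have "c$2 = 0" using z[of "A0 + (1/2) *\<^sub>R e3"] by (simp add: F_def g0_def val a1 a2 a3)
        moreover have "d$1 = 0" using z[of "A0 + ((1/2) *\<^sub>R e1 + (1/2) *\<^sub>R e2)"] by (simp add: F_def g0_def val a1 a2 a3 inner_add_right)
        moreover have "d$2 = 0" using z[of "A0 + ((1/2) *\<^sub>R e1 + (1/2) *\<^sub>R e3)"] by (simp add: F_def g0_def val a1 a2 a3 inner_add_right)
        ultimately show False using c(1) by (simp add: eq2_iff zero_prod_def)
      qed
      have pts: "C i0 j0 = A0" "C i0 j1 = A0 + e1" "C i1 j0 = A0 + e2" "C i1 j1 = A0 + e3"
        by (simp_all add: A0_def e1_def e2_def e3_def)
      have g23: "g2 (C i0 j) = 0" "g3 (C i0 j) = 0" if "j \<in> J" for j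
      proof -
        have i: "i0 \<in> I" using Ithree by auto
        have ne: "C i0 j0 \<noteq> C i0 j1" using injr[OF i] Jthree by (auto dest: inj_onD)
        have "a2 \<bullet> C i0 j = a2 \<bullet> A0"
          by (rule collinear_affine_const[OF row[OF i] imageI[OF Jthree(1)] imageI[OF Jthree(2)] ne _ _ imageI[OF that]]) (use a2 in \<open>auto simp: pts inner_add_right\<close>)
        then show "g2 (C i0 j) = 0" by (simp add: g2_def)
        have "a3 \<bullet> C i0 j = a3 \<bullet> A0"
          by (rule collinear_affine_const[OF row[OF i] imageI[OF Jthree(1)] imageI[OF Jthree(2)] ne _ _ imageI[OF that]]) (use a3 in \<open>auto simp: pts inner_add_right\<close>)
        then show "g3 (C i0 j) = 0" by (simp add: g3_def)
      qed
      have g01: "g0 (C i1 j) = 0" "g1 (C i1 j) = 0" if "j \<in> J" for j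
      proof -
        have i: "i1 \<in> I" using Ithree by auto
        have ne: "C i1 j0 \<noteq> C i1 j1" using injr[OF i] Jthree by (auto dest: inj_onD)
        have "a1 \<bullet> C i1 j = a1 \<bullet> A0"
          by (rule collinear_affine_const[OF row[OF i] imageI[OF Jthree(1)] imageI[OF Jthree(2)] ne _ _ imageI[OF that]]) (use a1 in \<open>auto simp: pts inner_add_right\<close>)
        then show z: "g1 (C i1 j) = 0" by (simp add: g1_def)
        have "(a2 + a3) \<bullet> C i1 j = (a2 + a3) \<bullet> A0 + 1"
          by (rule collinear_affine_const[OF row[OF i] imageI[OF Jthree(1)] imageI[OF Jthree(2)] ne _ _ imageI[OF that]]) (use a2 a3 in \<open>auto simp: pts inner_add_right inner_add_left\<close>)
        then show "g0 (C i1 j) = 0" using z by (simp add: g0_def g2_def g3_def inner_add_left)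
      qed
      have z0: "F (C i0 j) = 0" "F (C i1 j) = 0" if "j \<in> J" for j
        using g23[OF that] g01[OF that] by (simp_all add: F_def)
      \<comment> \<open>Each of the columns \<open>j0\<close>, \<open>j1\<close>, \<open>j2\<close>
        has three zeros on the rows \<open>i0\<close>, \<open>i1\<close>, \<open>i2\<close>;
        afterwards every row has three zeros on these columns.\<close>
      have zc: "F (C i j) = 0" if "i \<in> I" "j \<in> {j0, j1, j2}" for i j
      proof -
        have j: "j \<in> J" using that Jthree by auto
        have "F (C i2 j) = 0" using that c by (auto simp: Fw)
        moreover have "C i0 j \<noteq> C i1 j" "C i0 j \<noteq> C i2 j" "C i1 j \<noteq> C i2 j" using injc[OF j] Ithree by (auto dest: inj_onD)
        ultimately show ?thesis
          using split_form_vanishes_on_line[OF sf col[OF j], of "C i0 j" "C i1 j" "C i2 j" "C i j"] z0[OF j] Ithree that by auto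
      qed
      have "F (C i j) = 0" if "i \<in> I" "j \<in> J" for i j
      proof -
        have "C i j0 \<noteq> C i j1" "C i j0 \<noteq> C i j2" "C i j1 \<noteq> C i j2" using injr[OF that(1)] Jthree by (auto dest: inj_onD)
        then show ?thesis
          using split_form_vanishes_on_line[OF sf row[OF that(1)], of "C i j0" "C i j1" "C i j2" "C i j"] zc[OF that(1)] Jthree that by auto
      qed
      then show thesis using that sf nz by blast
    qed
  qed
qed

section \<open>Plane conics and plane sections of quadrics\<close>

definition conic_poly :: "real^3 \<Rightarrow> real^3 \<Rightarrow> real^2 \<Rightarrow> real" where
  "conic_poly m b x = m$1 * (x$1)^2 + m$2 * (x$1 * x$2) + m$3 * (x$2)^2 + b$1 * x$1 + b$2 * x$2 + b$3"

text \<open>\<open>conic\<close> demands a nonzero quadratic part. A nonconstant affine polynomial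
  is replaced by its square; a nonzero constant leaves \<open>S\<close> empty.\<close>

lemma conic_of_poly:
  assumes ne: "m \<noteq> 0 \<or> b \<noteq> 0" and S: "\<And>x. x \<in> S \<Longrightarrow> conic_poly m b x = 0"
  shows "\<exists>S'. conic S' \<and> S \<subseteq> S'"
proof -
  have main: "\<exists>S'. conic S' \<and> S \<subseteq> S'" if m: "m \<noteq> 0" and S: "\<And>x. x \<in> S \<Longrightarrow> conic_poly m b x = 0" for m b
  proof -
    define M :: "real^2^2" where "M = vector [vector [m$1, m$2 / 2], vector [m$2 / 2, m$3]]"
    define B :: "real^2" where "B = vector [b$1, b$2]"
    have "transpose M = M" by (simp add: M_def transpose_def vec_eq_iff forall_2)
    moreover have "M \<noteq> 0" using m by (auto simp: M_def vec_eq_iff forall_2 forall_3)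
    moreover have "x \<bullet> (M *v x) + B \<bullet> x + b$3 = conic_poly m b x" for x
      by (simp add: M_def B_def conic_poly_def inner2 matrix_vector_mult_def sum_2 power2_eq_square algebra_simps)
    ultimately have "conic (quadric M B (b$3))" "S \<subseteq> quadric M B (b$3)"
      using S unfolding conic_def by (blast, auto simp: quadric_def)
    then show ?thesis by blast
  qed
  show ?thesis
  proof (cases "m = 0")
    case False then show ?thesis using main S by blast
  next
    case True
    show ?thesis
    proof (cases "b$1 = 0 \<and> b$2 = 0")
      case b: True
      then have "b$3 \<noteq> 0" using ne True by (auto simp: eq3_iff)
      then have "S = {}" using S b True by (auto simp: conic_poly_def)
      then show ?thesis using main[of "axis 1 1" 0] by simp
    next
      case b: False
      define m' :: "real^3" where "m' = vector [(b$1)^2, 2 * b$1 * b$2, (b$2)^2]"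
      define b' :: "real^3" where "b' = vector [2 * b$1 * b$3, 2 * b$2 * b$3, (b$3)^2]"
      have "conic_poly m' b' x = (conic_poly m b x)^2" for x
        by (simp add: conic_poly_def True m'_def b'_def power2_eq_square algebra_simps)
      moreover have "m' \<noteq> 0" using b by (auto simp: m'_def eq3_iff)
      ultimately show ?thesis using main[of m' b'] S by simp
    qed
  qed
qed

text \<open>Six coefficients against at most five linear conditions. This disposes of short
  diagonals.\<close>

lemma conic_through_five_points:
  assumes "finite S" "card S \<le> 5"
  shows "\<exists>S'. conic S' \<and> S \<subseteq> S'"
proof -
  define w :: "real^2 \<Rightarrow> (real^3) \<times> (real^3)" where
    "w = (\<lambda>x. (vector [(x$1)^2, x$1 * x$2, (x$2)^2], vector [x$1, x$2, 1]))"
  have "card (w ` S) < DIM((real^3) \<times> (real^3))" using card_image_le[OF assms(1), of w] assms(2) by simp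
  then obtain n where n: "n \<noteq> 0" "\<forall>y\<in>w ` S. n \<bullet> y = 0" using orthogonal_to_fewer[of "w ` S"] assms(1) by blast
  obtain m b where mb: "n = (m, b)" by (cases n)
  have "conic_poly m b x = n \<bullet> w x" for x
    by (simp add: mb w_def conic_poly_def inner3 algebra_simps)
  then show ?thesis using n by (intro conic_of_poly[of m b]) (auto simp: mb zero_prod_def)
qed

definition lift :: "real^2 \<Rightarrow> real \<Rightarrow> real^3" where
  "lift x z = vector [x$1, x$2, z]"

lemma lift_nth [simp]: "lift x z $ 1 = x$1" "lift x z $ 2 = x$2" "lift x z $ 3 = z"
  by (simp_all add: lift_def)

text \<open>The section with the plane \<open>z = 0\<close> is a conic; the explicit cofactor of
  \<open>z\<close> is needed when this section vanishes identically.\<close>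

lemma split_form_lift:
  assumes "split_form F"
  shows "\<exists>m b g \<eta> \<kappa>. \<forall>x z. F (lift x z) = conic_poly m b x + z * (g \<bullet> x + \<eta> * z + \<kappa>)"
proof -
  from assms obtain a \<alpha> b \<beta> c \<gamma> d \<delta> where F: "F = (\<lambda>x. (a \<bullet> x + \<alpha>) * (b \<bullet> x + \<beta>) + (c \<bullet> x + \<gamma>) * (d \<bullet> x + \<delta>))"
    unfolding split_form_def by blast
  define m :: "real^3" where "m = vector [a$1 * b$1 + c$1 * d$1, a$1 * b$2 + a$2 * b$1 + c$1 * d$2 + c$2 * d$1, a$2 * b$2 + c$2 * d$2]"
  define l :: "real^3" where "l = vector [a$1 * \<beta> + b$1 * \<alpha> + c$1 * \<delta> + d$1 * \<gamma>, a$2 * \<beta> + b$2 * \<alpha> + c$2 * \<delta> + d$2 * \<gamma>, \<alpha> * \<beta> + \<gamma> * \<delta>]"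
  define g :: "real^2" where "g = vector [a$3 * b$1 + b$3 * a$1 + c$3 * d$1 + d$3 * c$1, a$3 * b$2 + b$3 * a$2 + c$3 * d$2 + d$3 * c$2]"
  show ?thesis
    by (intro exI[of _ m] exI[of _ l] exI[of _ g] exI[of _ "a$3 * b$3 + c$3 * d$3"]
        exI[of _ "a$3 * \<beta> + b$3 * \<alpha> + c$3 * \<delta> + d$3 * \<gamma>"] allI)
      (simp add: F m_def l_def g_def conic_poly_def inner2 inner3 power2_eq_square algebra_simps)
qed

section \<open>Limits of one-sheeted hyperboloids\<close>

definition indep3 :: "real^3 \<Rightarrow> real^3 \<Rightarrow> real^3 \<Rightarrow> bool" where
  "indep3 a b c \<longleftrightarrow> (\<forall>x. a \<bullet> x = 0 \<and> b \<bullet> x = 0 \<and> c \<bullet> x = 0 \<longrightarrow> x = 0)"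

lemma indep3_combination:
  assumes "indep3 a b c"
  obtains x y z where "d = x *\<^sub>R a + y *\<^sub>R b + z *\<^sub>R c"
proof -
  have "span {a, b, c} = UNIV"
  proof (rule ccontr)
    assume "span {a, b, c} \<noteq> UNIV"
    then have "dim {a, b, c} < DIM(real^3)"
      by (metis dim_eq_full dim_subset_UNIV le_neq_implies_less)
    then obtain n where n: "n \<noteq> 0" "\<And>y. y \<in> span {a, b, c} \<Longrightarrow> orthogonal n y"
      using orthogonal_to_subspace_exists by metis
    then have "a \<bullet> n = 0 \<and> b \<bullet> n = 0 \<and> c \<bullet> n = 0" by (auto simp: orthogonal_def inner_commute span_base)
    then show False using assms n by (auto simp: indep3_def)
  qed
  then have "d \<in> span {a, b, c}" by simp
  then obtain x where x: "d - x *\<^sub>R a \<in> span {b, c}" by (auto simp: span_breakdown_eq)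
  then obtain y where y: "d - x *\<^sub>R a - y *\<^sub>R b \<in> span {c}" by (auto simp: span_breakdown_eq)
  then obtain z where "d - x *\<^sub>R a - y *\<^sub>R b = z *\<^sub>R c" by (auto simp: span_singleton)
  then have "d = x *\<^sub>R a + y *\<^sub>R b + z *\<^sub>R c" by (simp add: algebra_simps)
  then show thesis using that by blast
qed

text \<open>Independent linear forms are coordinates, so the set is an affine preimage, hence also
  an affine image, of the standard hyperboloid.\<close>

lemma one_sheeted_hyperboloid_affine:
  assumes ind: "indep3 l1 l2 l3"
  shows "one_sheeted_hyperboloid {x. (l1 \<bullet> x + \<mu>1)^2 + (l2 \<bullet> x + \<mu>2)^2 - (l3 \<bullet> x + \<mu>3)^2 = 1}"
proof -
  define L :: "real^3 \<Rightarrow> real^3" where "L x = vector [l1 \<bullet> x, l2 \<bullet> x, l3 \<bullet> x]" for x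
  define m :: "real^3" where "m = vector [\<mu>1, \<mu>2, \<mu>3]"
  have lin: "linear L" by (rule linearI) (simp_all add: L_def eq3_iff inner_add_right)
  have inj: "inj L"
    unfolding linear_injective_0[OF lin] using ind by (auto simp: L_def eq3_iff indep3_def)
  have bij: "bij L" using inj linear_injective_imp_surjective[OF lin inj] by (simp add: bij_def)
  define g where "g = inv L"
  have g: "L (g y) = y" "g (L x) = x" for x y
    using bij by (simp_all add: g_def bij_is_inj bij_is_surj surj_f_inv_f)
  have ling: "linear g"
  proof (rule linearI)
    show "g (x + y) = g x + g y" for x y using linear_add[OF lin, of "g x" "g y"] by (metis g)
    show "g (c *\<^sub>R x) = c *\<^sub>R g x" for c x using linear_scale[OF lin, of c "g x"] by (metis g)
  qed
  have bijg: "bij g" unfolding g_def using bij by (rule bij_imp_bij_inv)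
  have "{x. (l1 \<bullet> x + \<mu>1)^2 + (l2 \<bullet> x + \<mu>2)^2 - (l3 \<bullet> x + \<mu>3)^2 = 1}
    = (\<lambda>y. g (- m) + g y) ` {y. (y$1)\<^sup>2 + (y$2)\<^sup>2 - (y$3)\<^sup>2 = 1}"
  proof (intro equalityI subsetI)
    fix x assume x: "x \<in> {x. (l1 \<bullet> x + \<mu>1)^2 + (l2 \<bullet> x + \<mu>2)^2 - (l3 \<bullet> x + \<mu>3)^2 = 1}"
    have "x = g (- m) + g (L x + m)" unfolding linear_add[OF ling, symmetric] by (simp add: g)
    moreover have "L x + m \<in> {y. (y$1)\<^sup>2 + (y$2)\<^sup>2 - (y$3)\<^sup>2 = 1}" using x by (simp add: L_def m_def)
    ultimately show "x \<in> (\<lambda>y. g (- m) + g y) ` {y. (y$1)\<^sup>2 + (y$2)\<^sup>2 - (y$3)\<^sup>2 = 1}" by blast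
  next
    fix x assume "x \<in> (\<lambda>y. g (- m) + g y) ` {y. (y$1)\<^sup>2 + (y$2)\<^sup>2 - (y$3)\<^sup>2 = 1}"
    then obtain y where y: "x = g (- m) + g y" "(y$1)\<^sup>2 + (y$2)\<^sup>2 - (y$3)\<^sup>2 = 1" by blast
    have "L x = y - m" unfolding y(1) linear_add[OF ling, symmetric] g by simp
    then have "l1 \<bullet> x = y$1 - \<mu>1" "l2 \<bullet> x = y$2 - \<mu>2" "l3 \<bullet> x = y$3 - \<mu>3"
      by (simp_all add: L_def m_def eq3_iff)
    then show "x \<in> {x. (l1 \<bullet> x + \<mu>1)^2 + (l2 \<bullet> x + \<mu>2)^2 - (l3 \<bullet> x + \<mu>3)^2 = 1}" using y(2) by simp
  qed
  then show ?thesis unfolding one_sheeted_hyperboloid_def using ling bijg by blast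
qed

text \<open>Substituting \<open>d = x a + y b + z c\<close> turns the form into \<open>X Y + \<kappa> C\<^sup>2 + \<Delta> C\<close> with \<open>X = A + y C\<close>, \<open>Y = B + x C\<close>.\<close>

lemma generic_split_form_hyperboloid:
  fixes a b c :: "real^3"
  assumes ind: "indep3 a b c" and d: "d = x *\<^sub>R a + y *\<^sub>R b + z *\<^sub>R c"
    and \<kappa>: "z - x * y \<noteq> 0" and \<Delta>: "\<delta> - x * \<alpha> - y * \<beta> - z * \<gamma> \<noteq> 0"
  shows "one_sheeted_hyperboloid {w. (a \<bullet> w + \<alpha>) * (b \<bullet> w + \<beta>) + (c \<bullet> w + \<gamma>) * (d \<bullet> w + \<delta>) = 0}"
proof -
  define k where "k = z - x * y"
  define D where "D = \<delta> - x * \<alpha> - y * \<beta> - z * \<gamma>"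
  \<comment> \<open>Completing the square in \<open>k C^2 + D C\<close> produces a constant of
    absolute value \<open>N\<close>; \<open>p\<close> and \<open>q\<close> scale by it to reach the
    right-hand side 1.\<close>
  define N where "N = D^2 / (4 * \<bar>k\<bar>)"
  have N: "N > 0" using \<kappa> \<Delta> by (simp add: N_def k_def D_def)
  define X where "X = (\<lambda>w. (a + y *\<^sub>R c) \<bullet> w + (\<alpha> + y * \<gamma>))"
  define Y where "Y = (\<lambda>w. (b + x *\<^sub>R c) \<bullet> w + (\<beta> + x * \<gamma>))"
  define C where "C = (\<lambda>w. c \<bullet> w + \<gamma>)"
  have F: "(a \<bullet> w + \<alpha>) * (b \<bullet> w + \<beta>) + (c \<bullet> w + \<gamma>) * (d \<bullet> w + \<delta>) = X w * Y w + k * (C w)^2 + D * C w" for w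
    unfolding d X_def Y_def C_def k_def D_def by (simp add: inner_add_left power2_eq_square algebra_simps)
  define q where "q = 1 / (2 * sqrt N)"
  define p where "p = sqrt (\<bar>k\<bar> / N)"
  have p0: "p \<noteq> 0" and q0: "q \<noteq> 0" using N \<kappa> by (simp_all add: p_def q_def k_def)
  have q2: "4 * q^2 * N = 1" and p2: "p^2 * N = \<bar>k\<bar>"
    using N by (simp_all add: q_def p_def power_divide power_mult_distrib)
  have X': "q *\<^sub>R (a + y *\<^sub>R c + (b + x *\<^sub>R c)) \<bullet> w + q * (\<alpha> + y * \<gamma> + (\<beta> + x * \<gamma>)) = q * (X w + Y w)"
    and Y': "q *\<^sub>R (a + y *\<^sub>R c - (b + x *\<^sub>R c)) \<bullet> w + q * (\<alpha> + y * \<gamma> - (\<beta> + x * \<gamma>)) = q * (X w - Y w)"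
    and C': "(p *\<^sub>R c) \<bullet> w + p * (\<gamma> + D / (2 * k)) = p * (C w + D / (2 * k))" for w
    unfolding X_def Y_def C_def by (simp_all add: inner_add_left inner_diff_left algebra_simps)
  have ind': "a \<bullet> w = 0 \<and> b \<bullet> w = 0 \<and> c \<bullet> w = 0"
    if "q *\<^sub>R (a + y *\<^sub>R c + (b + x *\<^sub>R c)) \<bullet> w = 0" "q *\<^sub>R (a + y *\<^sub>R c - (b + x *\<^sub>R c)) \<bullet> w = 0" "(p *\<^sub>R c) \<bullet> w = 0" for w
    using that p0 q0 by (auto simp: inner_add_left inner_diff_left)
  have sq: "(q * (X w + Y w))^2 - (q * (X w - Y w))^2 = 4 * q^2 * (X w * Y w)" for w
    by (simp add: power2_eq_square algebra_simps)
  have kN: "k * (D / (2 * k))^2 = (if k > 0 then N else - N)" using \<kappa> unfolding N_def k_def[symmetric]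
    by (simp add: power2_eq_square field_simps)
  have cs: "k * (C w + D / (2 * k))^2 = k * (C w)^2 + D * C w + (if k > 0 then N else - N)" for w
  proof -
    have "k * (C w + D / (2 * k))^2 = k * (C w)^2 + D * C w + k * (D / (2 * k))^2"
      using \<kappa> unfolding k_def[symmetric] by (simp add: power2_eq_square field_simps)
    then show ?thesis using kN by simp
  qed
  have Nm: "(4 * q^2 * u = v) \<longleftrightarrow> u = N * v" for u v :: real
    proof -
    have "4 * q^2 * N * v = v" unfolding q2 by simp
    then have "4 * q^2 * u = v \<longleftrightarrow> 4 * q^2 * u = 4 * q^2 * (N * v)" by (simp only: mult.assoc)
    also have "\<dots> \<longleftrightarrow> u = N * v" using q0 by simp
    finally show ?thesis .
  qed
  show ?thesis
  \<comment> \<open>\<open>X Y\<close> is a difference of squares of \<open>X + Y\<close> and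
    \<open>X - Y\<close>. For positive \<open>k\<close> the negative square is that of
    \<open>X - Y\<close>, for negative \<open>k\<close> that of \<open>X + Y\<close>; either way the
    surface has one sheet.\<close>
  proof (cases "k > 0")
    case True
    have eq: "(q * (X w + Y w))^2 + (p * (C w + D / (2 * k)))^2 - (q * (X w - Y w))^2 = 1 \<longleftrightarrow> X w * Y w + k * (C w)^2 + D * C w = 0" for w
    proof -
      have "(p * (C w + D / (2 * k)))^2 * N = k * (C w + D / (2 * k))^2" using p2 True by (simp add: power_mult_distrib)
      also have "\<dots> = k * (C w)^2 + D * C w + N" using cs True by simp
      finally have e: "(p * (C w + D / (2 * k)))^2 = 4 * q^2 * (k * (C w)^2 + D * C w + N)"
        using q2 N by (metis Nm mult.commute)
      have "(q * (X w + Y w))^2 + (p * (C w + D / (2 * k)))^2 - (q * (X w - Y w))^2 = 4 * q^2 * (X w * Y w + (k * (C w)^2 + D * C w)) + 1"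
        using sq[of w] e q2 by (simp add: algebra_simps)
      then show ?thesis using q0 by auto
    qed
    have "indep3 (q *\<^sub>R (a + y *\<^sub>R c + (b + x *\<^sub>R c))) (p *\<^sub>R c) (q *\<^sub>R (a + y *\<^sub>R c - (b + x *\<^sub>R c)))"
      using ind ind' unfolding indep3_def by blast
    from one_sheeted_hyperboloid_affine[OF this, of "q * (\<alpha> + y * \<gamma> + (\<beta> + x * \<gamma>))" "p * (\<gamma> + D / (2 * k))" "q * (\<alpha> + y * \<gamma> - (\<beta> + x * \<gamma>))"]
    show ?thesis unfolding X' Y' C' eq F .
  next
    case False
    then have k: "k < 0" using \<kappa> by (simp add: k_def)
    have eq: "(q * (X w - Y w))^2 + (p * (C w + D / (2 * k)))^2 - (q * (X w + Y w))^2 = 1 \<longleftrightarrow> X w * Y w + k * (C w)^2 + D * C w = 0" for w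
    proof -
      have "(p * (C w + D / (2 * k)))^2 * N = (p^2 * N) * (C w + D / (2 * k))^2" by (simp add: power_mult_distrib)
      also have "\<dots> = - (k * (C w + D / (2 * k))^2)" unfolding p2 using k by simp
      also have "\<dots> = - (k * (C w)^2 + D * C w) + N" using cs k by simp
      finally have e: "(p * (C w + D / (2 * k)))^2 = 4 * q^2 * (- (k * (C w)^2 + D * C w) + N)"
        using q2 N by (metis Nm mult.commute)
      have "(q * (X w - Y w))^2 + (p * (C w + D / (2 * k)))^2 - (q * (X w + Y w))^2 = - (4 * q^2 * (X w * Y w + (k * (C w)^2 + D * C w))) + 1"
        using sq[of w] e q2 by (simp add: algebra_simps)
      then show ?thesis using q0 by auto
    qed
    have "indep3 (q *\<^sub>R (a + y *\<^sub>R c - (b + x *\<^sub>R c))) (p *\<^sub>R c) (q *\<^sub>R (a + y *\<^sub>R c + (b + x *\<^sub>R c)))"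
      using ind ind' unfolding indep3_def by blast
    from one_sheeted_hyperboloid_affine[OF this, of "q * (\<alpha> + y * \<gamma> - (\<beta> + x * \<gamma>))" "p * (\<gamma> + D / (2 * k))" "q * (\<alpha> + y * \<gamma> + (\<beta> + x * \<gamma>))"]
    show ?thesis unfolding X' Y' C' eq F .
  qed
qed

text \<open>Adding \<open>t\<close> times the unit vectors to the rows turns the determinant into a
  monic cubic in \<open>t\<close>, which has finitely many zeros.\<close>

lemma indep3_perturbation:
  fixes a b c :: "real^3"
  assumes "\<epsilon> > 0"
  obtains t where "0 < t" "t < \<epsilon>" "indep3 (a + t *\<^sub>R axis 1 1) (b + t *\<^sub>R axis 2 1) (c + t *\<^sub>R axis 3 1)"
proof -
  define A :: "real \<Rightarrow> real^3^3" where "A t = vector [a + t *\<^sub>R axis 1 1, b + t *\<^sub>R axis 2 1, c + t *\<^sub>R axis 3 1]" for t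
  \<comment> \<open>The coefficients are the determinant, the sum of the principal 2 by 2 minors,
    the trace and 1.\<close>
  define p where "p = [: a$1 * b$2 * c$3 + a$2 * b$3 * c$1 + a$3 * b$1 * c$2 - a$1 * b$3 * c$2 - a$2 * b$1 * c$3 - a$3 * b$2 * c$1,
    a$1 * b$2 + a$1 * c$3 + b$2 * c$3 - b$3 * c$2 - a$2 * b$1 - a$3 * c$1, a$1 + b$2 + c$3, 1 :]"
  have det: "det (A t) = poly p t" for t
    unfolding p_def det_3 A_def by (simp add: axis_def algebra_simps)
  have "p \<noteq> 0" by (simp add: p_def)
  then have "finite {t. poly p t = 0}" by (rule poly_roots_finite)
  moreover have "infinite {0<..<\<epsilon>}" using assms by simp
  ultimately have "infinite ({0<..<\<epsilon>} - {t. poly p t = 0})" by (rule Diff_infinite_finite)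
  then have "{0<..<\<epsilon>} - {t. poly p t = 0} \<noteq> {}" by (rule infinite_imp_nonempty)
  then obtain t where "t \<in> {0<..<\<epsilon>} - {t. poly p t = 0}" by blast
  then have t: "0 < t" "t < \<epsilon>" "poly p t \<noteq> 0" by simp_all
  then have "invertible (A t)" by (simp add: invertible_det_nz det)
  then obtain B where "B ** A t = mat 1" by (auto simp: invertible_def)
  then have z: "A t *v x = 0 \<Longrightarrow> x = 0" for x using matrix_left_invertible_ker by blast
  have "indep3 (a + t *\<^sub>R axis 1 1) (b + t *\<^sub>R axis 2 1) (c + t *\<^sub>R axis 3 1)"
    unfolding indep3_def
  proof (intro allI impI)
    fix x assume "(a + t *\<^sub>R axis 1 1) \<bullet> x = 0 \<and> (b + t *\<^sub>R axis 2 1) \<bullet> x = 0 \<and> (c + t *\<^sub>R axis 3 1) \<bullet> x = 0"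
    then have "A t *v x = 0" by (simp add: matrix_vector_mult_def A_def inner3 sum_3 vec_eq_iff forall_3)
    then show "x = 0" by (rule z)
  qed
  then show thesis using that t by blast
qed

definition split_matrix :: "real^3 \<Rightarrow> real^3 \<Rightarrow> real^3 \<Rightarrow> real^3 \<Rightarrow> real^3^3" where
  "split_matrix a b c d = (\<chi> i j. (a$i * b$j + b$i * a$j + c$i * d$j + d$i * c$j) / 2)"

lemma split_matrix_quadratic: "x \<bullet> (split_matrix a b c d *v x) = (a \<bullet> x) * (b \<bullet> x) + (c \<bullet> x) * (d \<bullet> x)"
  by (simp add: split_matrix_def matrix_vector_mult_def inner3 sum_3) (simp add: field_simps)

lemma quadric_split:
  "quadric (split_matrix a b c d) (\<beta> *\<^sub>R a + \<alpha> *\<^sub>R b + \<delta> *\<^sub>R c + \<gamma> *\<^sub>R d) (\<alpha> * \<beta> + \<gamma> * \<delta>)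
    = {x. (a \<bullet> x + \<alpha>) * (b \<bullet> x + \<beta>) + (c \<bullet> x + \<gamma>) * (d \<bullet> x + \<delta>) = 0}"
  unfolding quadric_def split_matrix_quadratic by (simp add: inner_add_left algebra_simps)

text \<open>Three small changes make the form generic: \<open>t\<close> makes \<open>a\<close>,
  \<open>b\<close>, \<open>c\<close> independent, \<open>\<sigma>\<close> moves
  \<open>z - x * y\<close> off zero, and \<open>\<tau>\<close> does the same for the remaining
  linear coefficient. All are below \<open>1 / Suc n\<close>, so the coefficients converge.\<close>

lemma limit_hyperboloid_split:
  assumes M: "split_matrix a b c d \<noteq> 0"
  shows "limit_one_sheeted_hyperboloid {x. (a \<bullet> x + \<alpha>) * (b \<bullet> x + \<beta>) + (c \<bullet> x + \<gamma>) * (d \<bullet> x + \<delta>) = 0}"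
proof -
  define G where "G n t \<sigma> \<tau> \<longleftrightarrow> 0 < t \<and> t < 1 / real (Suc n) \<and> (\<sigma> = 0 \<or> \<sigma> = t) \<and> (\<tau> = 0 \<or> \<tau> = t) \<and>
    one_sheeted_hyperboloid {x. ((a + t *\<^sub>R axis 1 1) \<bullet> x + \<alpha>) * ((b + t *\<^sub>R axis 2 1) \<bullet> x + \<beta>)
       + ((c + t *\<^sub>R axis 3 1) \<bullet> x + \<gamma>) * ((d + \<sigma> *\<^sub>R (c + t *\<^sub>R axis 3 1)) \<bullet> x + (\<delta> + \<tau>)) = 0}" for n t \<sigma> \<tau>
  have ex: "\<exists>x. G n (fst x) (fst (snd x)) (snd (snd x))" for n
  proof -
    obtain t where t: "0 < t" "t < 1 / real (Suc n)" and ind: "indep3 (a + t *\<^sub>R axis 1 1) (b + t *\<^sub>R axis 2 1) (c + t *\<^sub>R axis 3 1)"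
      using indep3_perturbation[of "1 / real (Suc n)" a b c] by auto
    obtain x y z where d: "d = x *\<^sub>R (a + t *\<^sub>R axis 1 1) + y *\<^sub>R (b + t *\<^sub>R axis 2 1) + z *\<^sub>R (c + t *\<^sub>R axis 3 1)"
      by (rule indep3_combination[OF ind])
    \<comment> \<open>Adding \<open>\<sigma>\<close> times the perturbed \<open>c\<close> to
      \<open>d\<close> changes \<open>z\<close> into \<open>z + \<sigma>\<close> and leaves
      \<open>x\<close> and \<open>y\<close> alone.\<close>
    obtain \<sigma> where \<sigma>: "\<sigma> = 0 \<or> \<sigma> = t" "(z + \<sigma>) - x * y \<noteq> 0" using t by (cases "z - x * y = 0") force+
    obtain \<tau> where \<tau>: "\<tau> = 0 \<or> \<tau> = t" "(\<delta> + \<tau>) - x * \<alpha> - y * \<beta> - (z + \<sigma>) * \<gamma> \<noteq> 0"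
      using t by (cases "\<delta> - x * \<alpha> - y * \<beta> - (z + \<sigma>) * \<gamma> = 0") force+
    have "d + \<sigma> *\<^sub>R (c + t *\<^sub>R axis 3 1) = x *\<^sub>R (a + t *\<^sub>R axis 1 1) + y *\<^sub>R (b + t *\<^sub>R axis 2 1) + (z + \<sigma>) *\<^sub>R (c + t *\<^sub>R axis 3 1)"
      unfolding scaleR_add_left by (subst d) (simp only: add.assoc)
    from generic_split_form_hyperboloid[OF ind this \<sigma>(2) \<tau>(2)] have "G n t \<sigma> \<tau>"
      unfolding G_def using t \<sigma>(1) \<tau>(1) by blast
    then show ?thesis by (intro exI[of _ "(t, \<sigma>, \<tau>)"]) simp
  qed
  then have "\<forall>n. \<exists>x. G n (fst x) (fst (snd x)) (snd (snd x))" by blast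
  from choice[OF this] obtain X where X: "\<forall>n. G n (fst (X n)) (fst (snd (X n))) (snd (snd (X n)))" ..
  define t where "t n = fst (X n)" for n
  define \<sigma> where "\<sigma> n = fst (snd (X n))" for n
  define \<tau> where "\<tau> n = snd (snd (X n))" for n
  have GX: "G n (t n) (\<sigma> n) (\<tau> n)" for n using X by (simp add: t_def \<sigma>_def \<tau>_def)
  note T = GX[unfolded G_def, THEN conjunct1] GX[unfolded G_def, THEN conjunct2, THEN conjunct1]
    GX[unfolded G_def, THEN conjunct2, THEN conjunct2, THEN conjunct1]
    GX[unfolded G_def, THEN conjunct2, THEN conjunct2, THEN conjunct2, THEN conjunct1]
    GX[unfolded G_def, THEN conjunct2, THEN conjunct2, THEN conjunct2, THEN conjunct2]
  have lim0: "(\<lambda>n. 1 / real (Suc n)) \<longlonglongrightarrow> 0" using LIMSEQ_inverse_real_of_nat by (simp add: inverse_eq_divide)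
  have tb: "0 \<le> t n" "t n \<le> 1 / real (Suc n)" for n using T(1,2)[of n] by auto
  have \<sigma>b: "0 \<le> \<sigma> n" "\<sigma> n \<le> 1 / real (Suc n)" for n using T(3)[of n] tb[of n] by auto
  have \<tau>b: "0 \<le> \<tau> n" "\<tau> n \<le> 1 / real (Suc n)" for n using T(4)[of n] tb[of n] by auto
  have tl: "t \<longlonglongrightarrow> 0" by (rule tendsto_sandwich[OF _ _ tendsto_const lim0]) (simp_all only: tb eventually_True)
  have \<sigma>l: "\<sigma> \<longlonglongrightarrow> 0" by (rule tendsto_sandwich[OF _ _ tendsto_const lim0]) (simp_all only: \<sigma>b eventually_True)
  have \<tau>l: "\<tau> \<longlonglongrightarrow> 0" by (rule tendsto_sandwich[OF _ _ tendsto_const lim0]) (simp_all only: \<tau>b eventually_True)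
  define a' where "a' n = a + t n *\<^sub>R axis 1 1" for n
  define b' where "b' n = b + t n *\<^sub>R axis 2 1" for n
  define c' where "c' n = c + t n *\<^sub>R axis 3 1" for n
  define d' where "d' n = d + \<sigma> n *\<^sub>R c' n" for n
  define \<delta>' where "\<delta>' n = \<delta> + \<tau> n" for n
  have "a' \<longlonglongrightarrow> a + 0 *\<^sub>R axis 1 1" unfolding a'_def by (intro tendsto_intros tl)
  then have al: "a' \<longlonglongrightarrow> a" by simp
  have "b' \<longlonglongrightarrow> b + 0 *\<^sub>R axis 2 1" unfolding b'_def by (intro tendsto_intros tl)
  then have bl: "b' \<longlonglongrightarrow> b" by simp
  have "c' \<longlonglongrightarrow> c + 0 *\<^sub>R axis 3 1" unfolding c'_def by (intro tendsto_intros tl)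
  then have cl: "c' \<longlonglongrightarrow> c" by simp
  have "d' \<longlonglongrightarrow> d + 0 *\<^sub>R c" unfolding d'_def by (intro tendsto_intros \<sigma>l cl)
  then have dl: "d' \<longlonglongrightarrow> d" by simp
  have "\<delta>' \<longlonglongrightarrow> \<delta> + 0" unfolding \<delta>'_def by (intro tendsto_intros \<tau>l)
  then have \<delta>l: "\<delta>' \<longlonglongrightarrow> \<delta>" by simp
  have "(\<lambda>n. split_matrix (a' n) (b' n) (c' n) (d' n)) \<longlonglongrightarrow> split_matrix a b c d"
    unfolding split_matrix_def by (intro tendsto_intros al bl cl dl) simp_all
  moreover have "(\<lambda>n. \<beta> *\<^sub>R a' n + \<alpha> *\<^sub>R b' n + \<delta>' n *\<^sub>R c' n + \<gamma> *\<^sub>R d' n) \<longlonglongrightarrow> \<beta> *\<^sub>R a + \<alpha> *\<^sub>R b + \<delta> *\<^sub>R c + \<gamma> *\<^sub>R d"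
    by (intro tendsto_intros al bl cl dl \<delta>l)
  moreover have "(\<lambda>n. \<alpha> * \<beta> + \<gamma> * \<delta>' n) \<longlonglongrightarrow> \<alpha> * \<beta> + \<gamma> * \<delta>" by (intro tendsto_intros \<delta>l)
  moreover have "one_sheeted_hyperboloid (quadric (split_matrix (a' n) (b' n) (c' n) (d' n))
      (\<beta> *\<^sub>R a' n + \<alpha> *\<^sub>R b' n + \<delta>' n *\<^sub>R c' n + \<gamma> *\<^sub>R d' n) (\<alpha> * \<beta> + \<gamma> * \<delta>' n))" for n
    unfolding quadric_split using T(5)[of n] by (simp only: a'_def b'_def c'_def d'_def \<delta>'_def)
  moreover have "transpose (split_matrix a b c d) = split_matrix a b c d"
    by (simp add: transpose_def split_matrix_def vec_eq_iff algebra_simps)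
  ultimately show ?thesis unfolding limit_one_sheeted_hyperboloid_def quadric_split[symmetric] using M by blast
qed

text \<open>A split form may lose its quadratic part. It is then affine, and its zero plane counted
  twice is again of the required kind; a nonzero constant leaves \<open>S\<close> empty.\<close>

theorem limit_hyperboloid_of_split_form:
  assumes F: "split_form F" "\<exists>x. F x \<noteq> 0" and S: "\<And>x. x \<in> S \<Longrightarrow> F x = 0"
  shows "\<exists>S'. limit_one_sheeted_hyperboloid S' \<and> S \<subseteq> S'"
proof -
  from F(1) obtain a \<alpha> b \<beta> c \<gamma> d \<delta> where Fd: "F = (\<lambda>x. (a \<bullet> x + \<alpha>) * (b \<bullet> x + \<beta>) + (c \<bullet> x + \<gamma>) * (d \<bullet> x + \<delta>))"
    unfolding split_form_def by blast
  show ?thesis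
  proof (cases "split_matrix a b c d = 0")
    case False
    from limit_hyperboloid_split[OF False, of \<alpha> \<beta> \<gamma> \<delta>] show ?thesis using S unfolding Fd by blast
  next
    case True
    define l where "l = \<beta> *\<^sub>R a + \<alpha> *\<^sub>R b + \<delta> *\<^sub>R c + \<gamma> *\<^sub>R d"
    have "(a \<bullet> x) * (b \<bullet> x) + (c \<bullet> x) * (d \<bullet> x) = 0" for x
      using split_matrix_quadratic[of x a b c d] unfolding True by simp
    then have Fl: "F x = l \<bullet> x + (\<alpha> * \<beta> + \<gamma> * \<delta>)" for x
      unfolding Fd l_def by (simp add: inner_add_left algebra_simps)
    have sq: "split_matrix n n 0 0 \<noteq> 0" if "n \<noteq> 0" for n
      using split_matrix_quadratic[of n n n 0 0] that by auto
    show ?thesis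
    proof (cases "l = 0")
      case True
      then have "S = {}" using F(2) S Fl by auto
      then show ?thesis using limit_hyperboloid_split[OF sq[of "axis 1 1"], of 0 0 0 0] by (auto simp: axis_eq_0_iff)
    next
      case False
      from limit_hyperboloid_split[OF sq[OF False], of "\<alpha> * \<beta> + \<gamma> * \<delta>" "\<alpha> * \<beta> + \<gamma> * \<delta>" 0 0]
      have "limit_one_sheeted_hyperboloid {x. F x = 0}" unfolding Fl by simp
      then show ?thesis using S by blast
    qed
  qed
qed

section \<open>Apexes and diagonals\<close>

text \<open>A vertical plane meets the graph of an affine function in a line. In use the plane
  stands over a bisector, and the graph represents the circles touching one of the two
  lines.\<close>

lemma collinear_graph_over_line:
  fixes S :: "(real^3) set"
  assumes N: "N \<noteq> 0" and S: "\<And>y. y \<in> S \<Longrightarrow> \<exists>x z. y = lift x z \<and> N \<bullet> x = c \<and> z = w \<bullet> x + d"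
  shows "collinear S"
  unfolding collinear_def
proof (rule exI[of _ "lift (rot 1 N) (w \<bullet> rot 1 N)"], intro ballI)
  fix y y' assume "y \<in> S" "y' \<in> S"
  then obtain x z x' z' where y: "y = lift x z" "N \<bullet> x = c" "z = w \<bullet> x + d" "y' = lift x' z'" "N \<bullet> x' = c" "z' = w \<bullet> x' + d"
    using S by metis
  define e where "e = x - x'"
  have Ne: "N \<bullet> e = 0" using y by (simp add: e_def inner_diff_right)
  have NN: "N \<bullet> N \<noteq> 0" using N by simp
  define t where "t = (rot 1 N \<bullet> e) / (N \<bullet> N)"
  have "(N \<bullet> N) *\<^sub>R e = (rot 1 N \<bullet> e) *\<^sub>R rot 1 N + (N \<bullet> e) *\<^sub>R N"
    by (simp add: eq2_iff inner2) algebra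
  then have "(N \<bullet> N) *\<^sub>R e = (N \<bullet> N) *\<^sub>R (t *\<^sub>R rot 1 N)" using Ne NN by (simp add: t_def)
  then have e: "e = t *\<^sub>R rot 1 N" using NN by (metis scaleR_left_imp_eq)
  have "z - z' = w \<bullet> e" using y by (simp add: e_def inner_diff_right)
  then have "z - z' = t * (w \<bullet> rot 1 N)" unfolding e by simp
  moreover have "x - x' = t *\<^sub>R rot 1 N" using e by (simp add: e_def)
  ultimately have "y - y' = t *\<^sub>R lift (rot 1 N) (w \<bullet> rot 1 N)"
    unfolding y(1,4) by (simp add: eq3_iff eq2_iff)
  then show "\<exists>c. y - y' = c *\<^sub>R lift (rot 1 N) (w \<bullet> rot 1 N)" by blast
qed

lemma lift_eq_iff: "lift x z = lift x' z' \<longleftrightarrow> x = x' \<and> z = z'"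
  by (auto simp: eq3_iff eq2_iff)

lemma lift_surj: obtains x z where "y = lift x z"
proof
  show "y = lift (vector [y$1, y$2]) (y$3)" by (simp add: eq3_iff)
qed

context ic_net begin

text \<open>A common center would lie before column \<open>i + 1\<close>, hence before column
  \<open>i'\<close>, whereas touching the second pair of columns puts it behind \<open>i'\<close>.
  The distinctness of lifted centers rests on this.\<close>

lemma tang_separated:
  assumes us: "is_unit_square P i j" "is_unit_square P i' j" and ii: "i + 1 < i'"
    and K: "tang i (i + 1) j (j + 1) p r" "0 < r" and K': "tang i' (i' + 1) j (j + 1) p r'" "0 < r'"
  shows False
proof -
  have "u i' \<bullet> p < h i'"
    by (rule strip_order[OF ii _ goodI(2)[OF us(1)] goodI(1)[OF us(2)] goodI(4)[OF us(1)] goodI(3)[OF us(2)]])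
      (use K K' in \<open>auto simp: tang_def\<close>)
  then show False using K' by (simp add: tang_def)
qed

lemma tang_separated':
  assumes us: "is_unit_square P i j" "is_unit_square P i j'" and jj: "j + 1 < j'"
    and K: "tang i (i + 1) j (j + 1) p r" "0 < r" and K': "tang i (i + 1) j' (j' + 1) p r'" "0 < r'"
  shows False
proof -
  have us': "is_unit_square (rectangle n1 n2 m1 m2) j i" "is_unit_square (rectangle n1 n2 m1 m2) j' i"
    using us by (auto simp: is_unit_square_rectangle add.commute)
  show False
    using ic_net.tang_separated[OF transpose us' jj, unfolded tang_transpose, OF K K'] .
qed

text \<open>Fixing the parity \<open>e\<close> of both indices gives a full product grid of unit
  net-squares. Lifted incircles between columns \<open>i\<close> and \<open>i + 1\<close> satisfy
  the affine equations of both, hence are collinear; likewise for rows. The factor \<open>t\<close>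
  only stretches the height; it will be the tangent of the cone angle.\<close>

theorem apex_hyperboloid:
  "\<exists>S. limit_one_sheeted_hyperboloid S \<and>
    {lift (cen i j) (t * rad i j) | i j. is_unit_square P i j \<and> even i = e \<and> even j = e} \<subseteq> S"
proof -
  define I where "I = {i. m1 < i \<and> i + 1 < m2 \<and> even i = e}"
  define J where "J = {j. n1 < j \<and> j + 1 < n2 \<and> even j = e}"
  have us: "is_unit_square P i j" if "i \<in> I" "j \<in> J" for i j
    using that by (auto simp: I_def J_def is_unit_square_rectangle)
  define C where "C i j = lift (cen i j) (t * rad i j)" for i j
  have row: "collinear (C i ` J)" if i: "i \<in> I" for i
  proof (cases "J = {}")
    case True then show ?thesis by simp
  next
    case False
    then obtain j0 where "j0 \<in> J" by blast
    then have "u i + u (i + 1) \<noteq> 0" using u_ne_minus[OF goodI(1,2)[OF us[OF i \<open>j0 \<in> J\<close>]]] by (simp add: eq_neg_iff_add_eq_0)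
    then show ?thesis
    proof (rule collinear_graph_over_line)
      fix y assume "y \<in> C i ` J"
      then obtain j where j: "j \<in> J" "y = C i j" by blast
      note cn = cenD[OF us[OF i j(1)]]
      have "(u i + u (i + 1)) \<bullet> cen i j = h i + h (i + 1)" using cn by (simp add: inner_add_left)
      moreover have "t * rad i j = (t *\<^sub>R u i) \<bullet> cen i j + (- t * h i)" using cn by (simp add: algebra_simps)
      ultimately show "\<exists>x z. y = lift x z \<and> (u i + u (i + 1)) \<bullet> x = h i + h (i + 1) \<and> z = (t *\<^sub>R u i) \<bullet> x + (- t * h i)"
        using j by (auto simp: C_def)
    qed
  qed
  have col: "collinear ((\<lambda>i. C i j) ` I)" if j: "j \<in> J" for j
  proof (cases "I = {}")
    case True then show ?thesis by simp
  next
    case False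
    then obtain i0 where "i0 \<in> I" by blast
    then have "v j + v (j + 1) \<noteq> 0" using v_ne_minus[OF goodI(1,3)[OF us[OF \<open>i0 \<in> I\<close> j]]] by (simp add: eq_neg_iff_add_eq_0)
    then show ?thesis
    proof (rule collinear_graph_over_line)
      fix y assume "y \<in> (\<lambda>i. C i j) ` I"
      then obtain i where i: "i \<in> I" "y = C i j" by blast
      note cn = cenD[OF us[OF i(1) j]]
      have "(v j + v (j + 1)) \<bullet> cen i j = k j + k (j + 1)" using cn by (simp add: inner_add_left)
      moreover have "t * rad i j = (t *\<^sub>R v j) \<bullet> cen i j + (- t * k j)" using cn by (simp add: algebra_simps)
      ultimately show "\<exists>x z. y = lift x z \<and> (v j + v (j + 1)) \<bullet> x = k j + k (j + 1) \<and> z = (t *\<^sub>R v j) \<bullet> x + (- t * k j)"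
        using i by (auto simp: C_def)
    qed
  qed
  \<comment> \<open>Strips of equal parity are never adjacent, so their columns are
    distinct.\<close>
  have gap: "a + 1 < b" if "a < b" "even a = e" "even b = e" for a b :: int
  proof -
    have "b \<noteq> a + 1" using that by auto
    then show ?thesis using that by linarith
  qed
  have injr: "inj_on (C i) J" if i: "i \<in> I" for i
  proof (rule linorder_inj_onI')
    fix j j' assume j: "j \<in> J" "j' \<in> J" "j < j'"
    then have "j + 1 < j'" using gap by (auto simp: J_def)
    then show "C i j \<noteq> C i j'"
      using tang_separated'[OF us[OF i j(1)] us[OF i j(2)] _ cen[OF us[OF i j(1)]]] cen[OF us[OF i j(2)]]
      by (auto simp: C_def lift_eq_iff)
  qed
  have injc: "inj_on (\<lambda>i. C i j) I" if j: "j \<in> J" for j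
  proof (rule linorder_inj_onI')
    fix i i' assume i: "i \<in> I" "i' \<in> I" "i < i'"
    then have "i + 1 < i'" using gap by (auto simp: I_def)
    then show "C i j \<noteq> C i' j"
      using tang_separated[OF us[OF i(1) j] us[OF i(2) j] _ cen[OF us[OF i(1) j]]] cen[OF us[OF i(2) j]]
      by (auto simp: C_def lift_eq_iff)
  qed
  obtain F where F: "split_form F" "\<exists>x. F x \<noteq> 0" "\<And>i j. i \<in> I \<Longrightarrow> j \<in> J \<Longrightarrow> F (C i j) = 0"
    using ruled_grid_split_form[of I C J] row col injr injc by blast
  show ?thesis
    by (rule limit_hyperboloid_of_split_form[OF F(1,2)])
      (use F(3) in \<open>auto simp: C_def I_def J_def is_unit_square_rectangle\<close>)
qed

section \<open>Lifted circles over a diagonal of the net\<close>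

definition diag_circle :: "(int \<Rightarrow> int) \<Rightarrow> int \<Rightarrow> int \<Rightarrow> real^2 \<Rightarrow> real \<Rightarrow> bool" where
  "diag_circle \<pi> i j p r \<longleftrightarrow> 0 < r \<and> stang i j (\<pi> i) (\<pi> j) p (alt (min i j) * r) \<and>
    sq (min i j) (max i j) (min (\<pi> i) (\<pi> j)) (max (\<pi> i) (\<pi> j)) \<and>
    tang (min i j) (max i j) (min (\<pi> i) (\<pi> j)) (max (\<pi> i) (\<pi> j)) p r"

lemma diag_circle_commute: "diag_circle \<pi> i j p r \<longleftrightarrow> diag_circle \<pi> j i p r"
  by (auto simp: diag_circle_def stang_def min.commute max.commute)

text \<open>If \<open>i\<close> lies between \<open>j\<close> and \<open>j'\<close>, the two signs
  differ. Otherwise the two net-squares share the corner at \<open>i\<close>, and the circle of the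
  smaller one cannot reach the far column of the larger one, which an equal circle would have to
  touch.\<close>

lemma diag_circle_distinct_aux:
  assumes iso: "\<And>i j. \<bar>\<pi> j - \<pi> i\<bar> = \<bar>j - i\<bar>" and odd: "odd (j - i)" "odd (j' - i)" and jj: "j < j'"
    and K: "diag_circle \<pi> i j p r" "diag_circle \<pi> i j' p r'"
  shows "alt (min i j) * r \<noteq> alt (min i j') * r'"
proof
  assume eq: "alt (min i j) * r = alt (min i j') * r'"
  have r: "r > 0" "r' > 0" using K by (auto simp: diag_circle_def)
  have rr: "r' = r" "alt (min i j) = alt (min i j')" using eq r by (auto simp: alt_def split: if_splits)
  note K' = K[unfolded diag_circle_def rr(1)]
  have ne: "i \<noteq> j" "i \<noteq> j'" using odd by auto
  consider "i < j" | "j < i" "i < j'" | "j' < i" using ne by linarith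
  then show False
  proof cases
    case 1
    have mm: "min i j = i" "max i j = j" "min i j' = i" "max i j' = j'" using 1 jj by auto
    note A = K'(1)[unfolded mm] and B = K'(2)[unfolded mm]
    have gB: "good P j' (\<pi> i)" using sq_good(2,3)[of i j' "min (\<pi> i) (\<pi> j')" "max (\<pi> i) (\<pi> j')"] B by (auto simp: min_def max_def split: if_splits)
    have bd: "m1 < j'" "j' < m2" "n1 < min (\<pi> i) (\<pi> j')" "max (\<pi> i) (\<pi> j') < n2" using B 1 jj by (auto simp: sq_def)
    \<comment> \<open>Row \<open>\<pi> j\<close> lies strictly between \<open>\<pi> i\<close> and
      \<open>\<pi> j'\<close>, hence is not an extreme row of the rectangle.\<close>
    have "good P j' (\<pi> j)"
      by (rule good_row_interior) (use bd iso[of i j] iso[of j j'] iso[of i j'] 1 jj in auto)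
    then have g: "good P j' (min (\<pi> i) (\<pi> j))" "good P j' (max (\<pi> i) (\<pi> j))" using gB by (auto simp: min_def max_def)
    have "u j' \<bullet> p + r < h j'" by (rule column_gap_right[OF _ _ r(1) jj g]) (use A in auto)
    then show False using B by (simp add: tang_def)
  next
    case 2
    then have "min i j = j" "min i j' = i" by auto
    then show False using rr(2) odd(1) by (auto simp: alt_def split: if_splits)
  next
    case 3
    have mm: "min i j = j" "max i j = i" "min i j' = j'" "max i j' = i" using 3 jj by auto
    note A = K'(1)[unfolded mm] and B = K'(2)[unfolded mm]
    have gA: "good P j (\<pi> i)" using sq_good(1,4)[of j i "min (\<pi> i) (\<pi> j)" "max (\<pi> i) (\<pi> j)"] A by (auto simp: min_def max_def split: if_splits)
    have bd: "m1 < j" "j < m2" "n1 < min (\<pi> i) (\<pi> j)" "max (\<pi> i) (\<pi> j) < n2" using A 3 jj by (auto simp: sq_def)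
    have "good P j (\<pi> j')"
      by (rule good_row_interior) (use bd iso[of i j] iso[of j j'] iso[of i j'] 3 jj in auto)
    then have g: "good P j (min (\<pi> i) (\<pi> j'))" "good P j (max (\<pi> i) (\<pi> j'))" using gA by (auto simp: min_def max_def)
    have "h j < u j \<bullet> p - r" by (rule column_gap_left[OF _ _ r(1) jj g]) (use B in auto)
    then show False using A by (simp add: tang_def)
  qed
qed

lemma diag_circle_distinct:
  assumes "\<And>i j. \<bar>\<pi> j - \<pi> i\<bar> = \<bar>j - i\<bar>" and odd: "odd (j - i)" "odd (j' - i)" and jj: "j \<noteq> j'"
    and K: "diag_circle \<pi> i j p r" "diag_circle \<pi> i j' p r'"
  shows "alt (min i j) * r \<noteq> alt (min i j') * r'"
proof (cases "j < j'")
  case True then show ?thesis using diag_circle_distinct_aux[of \<pi> j i j' p r r'] assms by blast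
next
  case False
  then have "j' < j" using jj by simp
  then show ?thesis using diag_circle_distinct_aux[of \<pi> j' i j p r' r] assms by fastforce
qed

text \<open>The assumptions on \<open>\<pi>\<close> cover both kinds of diagonals: two vertices with
  indices of opposite parity are opposite corners of a net-square. Even indices become rows and odd
  indices columns of the grid of lifted incircles \<open>C i j\<close>.\<close>

theorem diagonal_conic:
  assumes iso: "\<And>i j. \<bar>\<pi> j - \<pi> i\<bar> = \<bar>j - i\<bar>" and par: "\<And>i j. odd (j - i) \<Longrightarrow> even (min i j + min (\<pi> i) (\<pi> j))"
  shows "\<exists>S. conic S \<and> {f i (\<pi> i) | i. (i, \<pi> i) \<in> P} \<subseteq> S"
proof -
  define I where "I = {i. (i, \<pi> i) \<in> P}"
  have I: "i \<in> I \<longleftrightarrow> m1 < i \<and> i < m2 \<and> n1 < \<pi> i \<and> \<pi> i < n2" for i by (auto simp: I_def mem_rectangle)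
  have "I \<subseteq> {m1<..<m2}" by (auto simp: I)
  then have fin: "finite I" using finite_subset by blast
  have set: "{f i (\<pi> i) | i. (i, \<pi> i) \<in> P} = (\<lambda>i. f i (\<pi> i)) ` I" by (auto simp: I_def)
  show ?thesis
  proof (cases "card I \<le> 5")
    case True
    show ?thesis unfolding set
      by (rule conic_through_five_points) (use fin True card_image_le[OF fin, of "\<lambda>i. f i (\<pi> i)"] in auto)
  next
    case False
    define a where "a = Min I"
    have "I \<noteq> {}" using False by auto
    then have a: "a \<in> I" "Max I \<in> I" using fin by (simp_all add: a_def)
    have "I \<subseteq> {a..Max I}" using fin by (auto simp: a_def)
    then have "card I \<le> card {a..Max I}" by (intro card_mono) auto
    then have M: "a + 5 \<le> Max I" using False by simp
    \<comment> \<open>With more than five vertices the diagonal contains six consecutive indices,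
      three of either parity.\<close>
    have seg: "a + d \<in> I" if "0 \<le> d" "d \<le> 5" for d
      using that a M iso[of a "a + d"] iso[of "a + d" "Max I"] iso[of a "Max I"] unfolding I by linarith
    define T where "T e = {i \<in> I. even i = e}" for e
    have three: "\<exists>x y z. x \<in> T e \<and> y \<in> T e \<and> z \<in> T e \<and> x \<noteq> y \<and> x \<noteq> z \<and> y \<noteq> z" for e
    proof (cases "even a = e")
      case True
      then show ?thesis using seg[of 0] seg[of 2] seg[of 4]
        by (intro exI[of _ "a"] exI[of _ "a + 2"] exI[of _ "a + 4"]) (auto simp: T_def)
    next
      case False
      then show ?thesis using seg[of 1] seg[of 3] seg[of 5]
        by (intro exI[of _ "a + 1"] exI[of _ "a + 3"] exI[of _ "a + 5"]) (auto simp: T_def)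
    qed
    have ex: "\<exists>p r. diag_circle \<pi> i j p r" if ij: "i \<in> I" "j \<in> I" "odd (j - i)" for i j
    proof -
      obtain p r where "r > 0" "stang i j (\<pi> i) (\<pi> j) p (alt (min i j) * r)"
        "sq (min i j) (max i j) (min (\<pi> i) (\<pi> j)) (max (\<pi> i) (\<pi> j))"
        "tang (min i j) (max i j) (min (\<pi> i) (\<pi> j)) (max (\<pi> i) (\<pi> j)) p r"
        by (rule signed_circle[of i "\<pi> i" j "\<pi> j"]) (use ij par[OF ij(3)] iso[of i j] in \<open>auto simp: I_def\<close>)
      then show ?thesis unfolding diag_circle_def by blast
    qed
    define D where "D i j = (SOME x. diag_circle \<pi> i j (fst x) (snd x))" for i j
    have D: "diag_circle \<pi> i j (fst (D i j)) (snd (D i j))" if "i \<in> I" "j \<in> I" "odd (j - i)" for i j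
    proof -
      from ex[OF that] have "\<exists>x. diag_circle \<pi> i j (fst x) (snd x)" by auto
      then show ?thesis unfolding D_def by (rule someI_ex)
    qed
    define C where "C i j = lift (fst (D i j)) (alt (min i j) * snd (D i j))" for i j
    have opp: "odd (j - i)" "odd (i - j)" if "i \<in> T True" "j \<in> T False" for i j using that by (auto simp: T_def)
    have TI: "i \<in> I" if "i \<in> T e" for i e using that by (simp add: T_def)
    have goodI': "good P i (\<pi> i)" if i: "i \<in> I" for i
    proof -
      obtain j where j: "j \<in> I" "odd (j - i)"
      proof -
        obtain j where "j \<in> T (odd i)" using three by blast
        then show thesis using that[of j] by (auto simp: T_def)
      qed
      then obtain p r where "diag_circle \<pi> i j p r" using ex i by blast
      then have s: "sq (min i j) (max i j) (min (\<pi> i) (\<pi> j)) (max (\<pi> i) (\<pi> j))" by (simp add: diag_circle_def)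
      show ?thesis using sq_good[OF s] by (auto simp: min_def max_def split: if_splits)
    qed
    have line: "collinear (insert (lift (f i (\<pi> i)) 0) S)"
      if i: "i \<in> I" and S: "\<And>y. y \<in> S \<Longrightarrow> \<exists>p \<rho>. y = lift p \<rho> \<and> Lu i p = \<rho> \<and> Lv (\<pi> i) p = \<rho>" for i S
    proof -
      \<comment> \<open>The planes of the two lines through a vertex are not parallel, because the
        lines cross.\<close>
      have "alt i *\<^sub>R u i - alt (\<pi> i) *\<^sub>R v (\<pi> i) \<noteq> 0"
      proof
        assume "alt i *\<^sub>R u i - alt (\<pi> i) *\<^sub>R v (\<pi> i) = 0"
        then have "rot s (alt i *\<^sub>R u i) \<bullet> v (\<pi> i) = 0" by (simp add: rot_scaleR)
        then show False using good_cross[OF goodI'[OF i]] by (simp add: rot_scaleR alt_def split: if_splits)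
      qed
      then show ?thesis
      proof (rule collinear_graph_over_line)
        fix y assume y: "y \<in> insert (lift (f i (\<pi> i)) 0) S"
        have on: "Lu i (f i (\<pi> i)) = 0" "Lv (\<pi> i) (f i (\<pi> i)) = 0"
          using i on_col on_row unfolding I_def Lu_def Lv_def by auto
        have "\<exists>p \<rho>. y = lift p \<rho> \<and> Lu i p = \<rho> \<and> Lv (\<pi> i) p = \<rho>"
          using y S on by (cases "y = lift (f i (\<pi> i)) 0") blast+
        then obtain p \<rho> where p: "y = lift p \<rho>" "Lu i p = \<rho>" "Lv (\<pi> i) p = \<rho>" by blast
        have "(alt i *\<^sub>R u i - alt (\<pi> i) *\<^sub>R v (\<pi> i)) \<bullet> p = alt i * h i - alt (\<pi> i) * k (\<pi> i)"
          using p(2,3) unfolding Lu_def Lv_def by (simp add: inner_diff_left algebra_simps)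
        moreover have "\<rho> = (alt i *\<^sub>R u i) \<bullet> p + (- alt i * h i)"
          using p(2) unfolding Lu_def by (simp add: algebra_simps)
        ultimately show "\<exists>x z. y = lift x z \<and> (alt i *\<^sub>R u i - alt (\<pi> i) *\<^sub>R v (\<pi> i)) \<bullet> x = alt i * h i - alt (\<pi> i) * k (\<pi> i) \<and>
          z = (alt i *\<^sub>R u i) \<bullet> x + (- alt i * h i)" using p(1) by blast
      qed
    qed
    have st: "stang i j (\<pi> i) (\<pi> j) (fst (D i j)) (alt (min i j) * snd (D i j))" if "i \<in> T True" "j \<in> T False" for i j
      using D[of i j] that TI opp[OF that] by (auto simp: diag_circle_def)
    have rowc: "collinear (insert (lift (f i (\<pi> i)) 0) (C i ` T False))" if i: "i \<in> T True" for i
    proof (rule line[OF TI[OF i]])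
      fix y assume "y \<in> C i ` T False"
      then obtain j where "j \<in> T False" "y = C i j" by blast
      then show "\<exists>p \<rho>. y = lift p \<rho> \<and> Lu i p = \<rho> \<and> Lv (\<pi> i) p = \<rho>" using st[OF i, of j]
        by (intro exI[of _ "fst (D i j)"] exI[of _ "alt (min i j) * snd (D i j)"]) (simp add: C_def stang_def)
    qed
    have colc: "collinear (insert (lift (f j (\<pi> j)) 0) ((\<lambda>i. C i j) ` T True))" if j: "j \<in> T False" for j
    proof (rule line[OF TI[OF j]])
      fix y assume "y \<in> (\<lambda>i. C i j) ` T True"
      then obtain i where "i \<in> T True" "y = C i j" by blast
      then show "\<exists>p \<rho>. y = lift p \<rho> \<and> Lu j p = \<rho> \<and> Lv (\<pi> j) p = \<rho>" using st[OF _ j, of i]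
        by (intro exI[of _ "fst (D i j)"] exI[of _ "alt (min i j) * snd (D i j)"]) (simp add: C_def stang_def)
    qed
    have injr: "inj_on (C i) (T False)" if i: "i \<in> T True" for i
    proof (rule inj_onI, rule ccontr)
      fix j j' assume j: "j \<in> T False" "j' \<in> T False" and eq: "C i j = C i j'" and ne: "j \<noteq> j'"
      have "fst (D i j) = fst (D i j')" "alt (min i j) * snd (D i j) = alt (min i j') * snd (D i j')"
        using eq by (simp_all add: C_def lift_eq_iff)
      then show False
        using diag_circle_distinct[OF iso opp(1)[OF i j(1)] opp(1)[OF i j(2)] ne, of "fst (D i j)" "snd (D i j)" "snd (D i j')"]
          D[OF TI[OF i] TI[OF j(1)] opp(1)[OF i j(1)]] D[OF TI[OF i] TI[OF j(2)] opp(1)[OF i j(2)]] by simp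
    qed
    have injc: "inj_on (\<lambda>i. C i j) (T True)" if j: "j \<in> T False" for j
    proof (rule inj_onI, rule ccontr)
      fix i i' assume i: "i \<in> T True" "i' \<in> T True" and eq: "C i j = C i' j" and ne: "i \<noteq> i'"
      have "fst (D i j) = fst (D i' j)" "alt (min j i) * snd (D i j) = alt (min j i') * snd (D i' j)"
        using eq by (simp_all add: C_def lift_eq_iff min.commute)
      then show False
        using diag_circle_distinct[OF iso opp(2)[OF i(1) j] opp(2)[OF i(2) j] ne, of "fst (D i j)" "snd (D i j)" "snd (D i' j)"]
          D[OF TI[OF i(1)] TI[OF j] opp(1)[OF i(1) j]] D[OF TI[OF i(2)] TI[OF j] opp(1)[OF i(2) j]]
        by (simp add: diag_circle_commute[of \<pi> j])
    qed
    obtain F where F: "split_form F" "\<exists>x. F x \<noteq> 0" "\<And>i j. i \<in> T True \<Longrightarrow> j \<in> T False \<Longrightarrow> F (C i j) = 0"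
    proof (rule ruled_grid_split_form[of "T True" C "T False"])
      show "collinear (C i ` T False)" if "i \<in> T True" for i using rowc[OF that] by (rule collinear_subset) auto
      show "collinear ((\<lambda>i. C i j) ` T True)" if "j \<in> T False" for j using colc[OF that] by (rule collinear_subset) auto
    qed (use injr injc in auto)
    obtain m b g \<eta> \<kappa> where FL: "\<And>x z. F (lift x z) = conic_poly m b x + z * (g \<bullet> x + \<eta> * z + \<kappa>)"
      using split_form_lift[OF F(1)] by blast
    obtain x1 y1 z1 where t1: "x1 \<in> T True" "y1 \<in> T True" "z1 \<in> T True" "x1 \<noteq> y1" "x1 \<noteq> z1" "y1 \<noteq> z1"
      using three[of True] by (elim exE conjE) (rule that)
    obtain x2 y2 z2 where t2: "x2 \<in> T False" "y2 \<in> T False" "z2 \<in> T False" "x2 \<noteq> y2" "x2 \<noteq> z2" "y2 \<noteq> z2"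
      using three[of False] by (elim exE conjE) (rule that)
    \<comment> \<open>A property that passes from three points to the whole line spreads from the
      grid to the lifted vertices. It is applied to the zeros of \<open>F\<close> and to membership
      in a plane.\<close>
    have cases: "Q (lift (f i (\<pi> i)) 0)"
      if i: "i \<in> I" and Q: "\<And>S x y z w. collinear S \<Longrightarrow> x \<in> S \<Longrightarrow> y \<in> S \<Longrightarrow> z \<in> S \<Longrightarrow> x \<noteq> y \<Longrightarrow> x \<noteq> z \<Longrightarrow> y \<noteq> z \<Longrightarrow>
        Q x \<Longrightarrow> Q y \<Longrightarrow> Q z \<Longrightarrow> w \<in> S \<Longrightarrow> Q w" and QC: "\<And>i j. i \<in> T True \<Longrightarrow> j \<in> T False \<Longrightarrow> Q (C i j)" for Q i
    proof (cases "even i")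
      case True
      then have iT: "i \<in> T True" using i by (simp add: T_def)
      have "C i x2 \<noteq> C i y2" "C i x2 \<noteq> C i z2" "C i y2 \<noteq> C i z2" using inj_onD[OF injr[OF iT]] t2 by blast+
      then show ?thesis using Q[OF rowc[OF iT], of "C i x2" "C i y2" "C i z2"] QC[OF iT] t2 by blast
    next
      case False
      then have iT: "i \<in> T False" using i by (simp add: T_def)
      have "C x1 i \<noteq> C y1 i" "C x1 i \<noteq> C z1 i" "C y1 i \<noteq> C z1 i" using inj_onD[OF injc[OF iT]] t1 by blast+
      then show ?thesis using Q[OF colc[OF iT], of "C x1 i" "C y1 i" "C z1 i"] QC[OF _ iT] t1 by blast
    qed
    have F0: "F (lift (f i (\<pi> i)) 0) = 0" if "i \<in> I" for i
      using cases[OF that, of "\<lambda>y. F y = 0"] split_form_vanishes_on_line[OF F(1)] F(3) by blast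
    show ?thesis unfolding set
    proof (cases "m \<noteq> 0 \<or> b \<noteq> 0")
      case True
      then show "\<exists>S. conic S \<and> (\<lambda>i. f i (\<pi> i)) ` I \<subseteq> S"
        by (rule conic_of_poly) (use F0 FL[of _ 0] in auto)
    next
      case False
      \<comment> \<open>The plane \<open>z = 0\<close> is itself a component of the quadric. No
        \<open>C i j\<close> lies in it, so all of them, and with them the lifted vertices, lie in
        the other component, a plane; the diagonal is then straight.\<close>
      then have FL': "F (lift x z) = z * (g \<bullet> x + \<eta> * z + \<kappa>)" for x z using FL by (simp add: conic_poly_def)
      define n :: "real^3" where "n = vector [g$1, g$2, \<eta>]"
      have nl: "n \<bullet> lift x z = g \<bullet> x + \<eta> * z" for x z by (simp add: n_def inner3 inner2)
      have nz: "alt (min i j) * snd (D i j) \<noteq> 0" if "i \<in> T True" "j \<in> T False" for i j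
        using D[of i j] that TI opp[OF that] by (auto simp: diag_circle_def alt_def)
      have nC: "n \<bullet> C i j = - \<kappa>" if "i \<in> T True" "j \<in> T False" for i j
        using F(3)[OF that] nz[OF that] unfolding C_def FL' nl by (simp add: eq_neg_iff_add_eq_0)
      have n0: "n \<bullet> lift (f i (\<pi> i)) 0 = - \<kappa>" if "i \<in> I" for i
        using cases[OF that, of "\<lambda>y. n \<bullet> y = - \<kappa>"] collinear_affine_const nC by blast
      define b' :: "real^3" where "b' = vector [g$1, g$2, \<kappa>]"
      have "b' \<noteq> 0"
      proof
        assume "b' = 0"
        then have g: "g = 0" "\<kappa> = 0" by (simp_all add: b'_def eq3_iff eq2_iff)
        have "\<eta> * (alt (min x1 x2) * snd (D x1 x2)) = 0" using nC[OF t1(1) t2(1)] unfolding C_def nl g by simp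
        then have "\<eta> = 0" using nz[OF t1(1) t2(1)] by simp
        then have "F (lift x z) = 0" for x z using FL' g by simp
        then show False using F(2) lift_surj by metis
      qed
      then show "\<exists>S. conic S \<and> (\<lambda>i. f i (\<pi> i)) ` I \<subseteq> S"
        by (intro conic_of_poly[of 0 b']) (use n0 in \<open>auto simp: nl conic_poly_def b'_def inner2\<close>)
    qed
  qed
qed

end

section \<open>The net of centers\<close>

lemma bisector_direction:
  fixes n n' x :: "real^2"
  assumes unit: "norm n = 1" "norm n' = 1" and cr: "rot s n \<bullet> n' \<noteq> 0" and x: "n \<bullet> x = w" "n' \<bullet> x = w" and w: "w > 0"
  shows "\<exists>l>0. x = l *\<^sub>R (n + n')"
proof -
  have "n \<noteq> - n'" using cr by (auto simp: rot_minus)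
  then have "n \<bullet> (- n') < 1" using unit by (intro inner_unit_less_1) auto
  then have p: "1 + n \<bullet> n' > 0" by simp
  have nn: "n \<bullet> n = 1" "n' \<bullet> n' = 1" using unit by (simp_all add: dot_square_norm)
  define l where "l = w / (1 + n \<bullet> n')"
  have l: "l * (1 + n \<bullet> n') = w" using p by (simp add: l_def)
  have "x - l *\<^sub>R (n + n') = 0"
  proof (rule inner_eq_imp_zero[OF cr])
    show "n \<bullet> (x - l *\<^sub>R (n + n')) = 0" "n' \<bullet> (x - l *\<^sub>R (n + n')) = 0"
      using l x nn by (simp_all add: inner_diff_right inner_add_right inner_commute[of n' n] add.commute)
  qed
  then show ?thesis using p w by (intro exI[of _ l]) (simp add: l_def)
qed

lemma lagrange_identity: "(rot 1 a \<bullet> b)^2 + (a \<bullet> b)^2 = (a \<bullet> a) * (b \<bullet> b)"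
  by (simp add: inner2) algebra

text \<open>The angle at \<open>z2\<close> equals the angle at \<open>z4\<close> modulo \<open>\<pi>\<close>.\<close>

lemma concyclic_by_angles:
  fixes z1 z2 z3 z4 :: "real^2"
  assumes nz: "rot 1 (z1 - z2) \<bullet> (z3 - z2) \<noteq> 0"
    and ang: "(rot 1 (z1 - z2) \<bullet> (z3 - z2)) * ((z1 - z4) \<bullet> (z3 - z4)) = ((z1 - z2) \<bullet> (z3 - z2)) * (rot 1 (z1 - z4) \<bullet> (z3 - z4))"
  shows "concyclic {z1, z2, z3, z4}"
proof -
  define a where "a = z1 - z2"
  define b where "b = z3 - z2"
  define w where "w = z4 - z2"
  \<comment> \<open>\<open>z2 + y\<close> is the circumcenter of \<open>z1\<close>,
    \<open>z2\<close>, \<open>z3\<close>.\<close>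
  obtain y where y: "a \<bullet> y = a \<bullet> a / 2" "b \<bullet> y = b \<bullet> b / 2" using solve_2x2[OF nz, folded a_def b_def] by metis
  have "(rot 1 a \<bullet> b) * ((a - w) \<bullet> (b - w)) = (a \<bullet> b) * (rot 1 (a - w) \<bullet> (b - w))"
    using ang by (simp add: a_def b_def w_def)
  moreover have "(rot 1 a \<bullet> b) * (w \<bullet> w - 2 * (w \<bullet> y)) = (rot 1 a \<bullet> b) * ((a - w) \<bullet> (b - w)) - (a \<bullet> b) * (rot 1 (a - w) \<bullet> (b - w))
    + (rot 1 w \<bullet> b) * (a \<bullet> a - 2 * (a \<bullet> y)) + (rot 1 a \<bullet> w) * (b \<bullet> b - 2 * (b \<bullet> y))"
    by (simp add: inner2) algebra
  ultimately have "(rot 1 a \<bullet> b) * (w \<bullet> w - 2 * (w \<bullet> y)) = 0" using y by simp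
  then have w: "w \<bullet> w = 2 * (w \<bullet> y)" using nz by (simp add: a_def b_def)
  have on: "norm (y - x) = norm y" if "x \<bullet> x = 2 * (x \<bullet> y)" for x
    using that unfolding norm_eq inner_diff_self by (simp add: inner_commute)
  have "a \<noteq> 0" using nz by (auto simp: a_def inner2)
  then have "y \<noteq> 0" using y(1) by auto
  have sph: "z2 + x \<in> sphere (z2 + y) (norm y)" if "x \<bullet> x = 2 * (x \<bullet> y)" for x using on[OF that] by (simp add: dist_norm)
  have "z2 + a \<in> sphere (z2 + y) (norm y)" "z2 + b \<in> sphere (z2 + y) (norm y)" "z2 + w \<in> sphere (z2 + y) (norm y)" "z2 + 0 \<in> sphere (z2 + y) (norm y)"
    using y w by (intro sph; simp)+
  then have "{z1, z2, z3, z4} \<subseteq> sphere (z2 + y) (norm y)" by (simp add: a_def b_def w_def)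
  then show ?thesis using \<open>y \<noteq> 0\<close> unfolding concyclic_def by (intro exI[of _ "z2 + y"] exI[of _ "norm y"]) auto
qed

text \<open>The bisectors of \<open>n, m\<close> and \<open>n, m'\<close> enclose half the angle between \<open>m\<close> and \<open>m'\<close>.\<close>

lemma half_angle:
  fixes n m m' :: "real^2"
  assumes "norm n = 1" "norm m = 1" "norm m' = 1"
  shows "((m + n) \<bullet> (n + m')) * (rot s m \<bullet> m') = (rot s (m + n) \<bullet> (n + m')) * (1 + m \<bullet> m')"
proof -
  have N: "n$1 * n$1 + n$2 * n$2 = 1" and M: "m$1 * m$1 + m$2 * m$2 = 1" and M': "m'$1 * m'$1 + m'$2 * m'$2 = 1"
    using assms by (auto simp: norm_eq_1_iff2)
  have "((m + n) \<bullet> (n + m')) * (rot 1 m \<bullet> m') = (rot 1 (m + n) \<bullet> (n + m')) * (1 + m \<bullet> m')"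
    using N M M' by (simp add: inner2) algebra
  moreover have "rot s x \<bullet> y = s * (rot 1 x \<bullet> y)" for x y by (simp add: inner2 algebra_simps)
  ultimately show ?thesis by (metis mult.assoc mult.left_commute)
qed

text \<open>Since \<open>m + n\<close> and \<open>n + m'\<close> have squared lengths
  \<open>2 (1 + m \<bullet> n)\<close> and \<open>2 (1 + n \<bullet> m')\<close>, the squared cosine
  of the angle between the bisectors is \<open>(1 + m \<bullet> m') / 2\<close>.\<close>

lemma half_angle_square:
  fixes n m m' :: "real^2"
  assumes "norm n = 1" "norm m = 1" "norm m' = 1"
  shows "((m + n) \<bullet> (n + m'))^2 = 2 * (1 + m \<bullet> n) * (1 + n \<bullet> m') * (1 + m \<bullet> m')"
proof -
  have N: "n$1 * n$1 + n$2 * n$2 = 1" and M: "m$1 * m$1 + m$2 * m$2 = 1" and M': "m'$1 * m'$1 + m'$2 * m'$2 = 1"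
    using assms by (auto simp: norm_eq_1_iff2)
  show ?thesis using N M M' by (simp add: inner2) algebra
qed

text \<open>The square determines the cosine \<open>C\<close> up to sign; the third conclusion gives
  it the sign of the oriented cross product of \<open>n1\<close> and \<open>n3\<close>, and the last
  one excludes that this product vanishes unless \<open>n3 = - n1\<close>.\<close>

lemma angle_at_bisectors:
  fixes n1 n2 n3 :: "real^2"
  assumes unit: "norm n1 = 1" "norm n2 = 1" "norm n3 = 1" and cr: "rot s n1 \<bullet> n2 > 0" "rot s n2 \<bullet> n3 > 0"
    and A: "A - V = l *\<^sub>R (n1 + n2)" "l > 0" and B: "B - V = l' *\<^sub>R (n2 + n3)" "l' > 0"
  obtains C where "angle_at A V B = arccos C" "C^2 = (1 + n1 \<bullet> n3) / 2" "\<exists>q>0. q * C * (rot s n1 \<bullet> n3) = 1 + n1 \<bullet> n3"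
    "1 + n1 \<bullet> n3 = 0 \<or> rot s n1 \<bullet> n3 \<noteq> 0"
proof -
  have "n1 \<noteq> - n2" "n2 \<noteq> - n3" using cr by (auto simp: rot_minus)
  then have "n1 \<bullet> (- n2) < 1" "n2 \<bullet> (- n3) < 1" using unit by (intro inner_unit_less_1; simp)+
  then have p: "1 + n1 \<bullet> n2 > 0" "1 + n2 \<bullet> n3 > 0" by simp_all
  have nn: "n1 \<bullet> n1 = 1" "n2 \<bullet> n2 = 1" "n3 \<bullet> n3 = 1" using unit by (simp_all add: dot_square_norm)
  have l1: "norm (n1 + n2) ^ 2 = 2 * (1 + n1 \<bullet> n2)" and l2: "norm (n2 + n3) ^ 2 = 2 * (1 + n2 \<bullet> n3)"
    unfolding power2_norm_eq_inner inner_add_self using nn by simp_all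
  define L where "L = norm (n1 + n2) * norm (n2 + n3)"
  have L2: "L^2 = 4 * (1 + n1 \<bullet> n2) * (1 + n2 \<bullet> n3)" by (simp add: L_def power_mult_distrib l1 l2 algebra_simps)
  then have "L \<noteq> 0" using p by auto
  then have L: "L > 0" by (simp add: L_def zero_less_mult_iff)
  define C where "C = ((n1 + n2) \<bullet> (n2 + n3)) / L"
  have CL: "C * L = (n1 + n2) \<bullet> (n2 + n3)" using L by (simp add: C_def)
  have 1: "angle_at A V B = arccos C"
  proof -
    have "norm (A - V) * norm (B - V) = (l * l') * L" using A B by (simp add: L_def)
    moreover have "(A - V) \<bullet> (B - V) = (l * l') * ((n1 + n2) \<bullet> (n2 + n3))" unfolding A(1) B(1) by simp
    ultimately show ?thesis unfolding angle_at_def C_def using A(2) B(2) by simp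
  qed
  have "C^2 * L^2 = 2 * (1 + n1 \<bullet> n2) * (1 + n2 \<bullet> n3) * (1 + n1 \<bullet> n3)"
    unfolding power_mult_distrib[symmetric] CL by (rule half_angle_square[OF unit(2,1,3)])
  then have "(1 + n1 \<bullet> n2) * (1 + n2 \<bullet> n3) * (2 * C^2 - (1 + n1 \<bullet> n3)) = 0" unfolding L2 by algebra
  then have 2: "C^2 = (1 + n1 \<bullet> n3) / 2" using p by simp
  have tri: "rot s n1 \<bullet> n3 = (rot s n1 \<bullet> n2) * (n2 \<bullet> n3) + (n1 \<bullet> n2) * (rot s n2 \<bullet> n3)"
  proof -
    have "n2$1 * n2$1 + n2$2 * n2$2 = 1" using unit by (simp add: norm_eq_1_iff2)
    then show ?thesis by (simp add: inner2) algebra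
  qed
  have X: "rot s (n1 + n2) \<bullet> (n2 + n3) = (rot s n1 \<bullet> n2) * (1 + n2 \<bullet> n3) + (rot s n2 \<bullet> n3) * (1 + n1 \<bullet> n2)"
    by (simp add: rot_add inner_add_left inner_add_right tri algebra_simps)
  then have Xp: "rot s (n1 + n2) \<bullet> (n2 + n3) > 0" using p cr by (simp add: add_pos_pos)
  have h: "((n1 + n2) \<bullet> (n2 + n3)) * (rot s n1 \<bullet> n3) = (rot s (n1 + n2) \<bullet> (n2 + n3)) * (1 + n1 \<bullet> n3)"
    by (rule half_angle[OF unit(2,1,3)])
  define q where "q = L / (rot s (n1 + n2) \<bullet> (n2 + n3))"
  have "q * C * (rot s n1 \<bullet> n3) = ((n1 + n2) \<bullet> (n2 + n3)) * (rot s n1 \<bullet> n3) / (rot s (n1 + n2) \<bullet> (n2 + n3))"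
    unfolding q_def CL[symmetric] by simp
  also have "\<dots> = 1 + n1 \<bullet> n3" unfolding h using Xp by simp
  finally have 3: "\<exists>q>0. q * C * (rot s n1 \<bullet> n3) = 1 + n1 \<bullet> n3" using L Xp by (intro exI[of _ q]) (simp add: q_def)
  have 4: "1 + n1 \<bullet> n3 = 0 \<or> rot s n1 \<bullet> n3 \<noteq> 0" using 3 by auto
  show thesis by (rule that[OF 1 2 3 4])
qed

text \<open>The two angles belong to the pairs \<open>n1, n3\<close> and \<open>n3, n1\<close>: the
  squared cosines agree and the cross products are opposite, hence so are the cosines. If
  \<open>n3 = - n1\<close>, both angles are right.\<close>

lemma opposite_angles_sum:
  fixes n1 n2 n3 n4 :: "real^2"
  assumes unit: "norm n1 = 1" "norm n2 = 1" "norm n3 = 1" "norm n4 = 1"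
    and cr: "rot s n1 \<bullet> n2 > 0" "rot s n2 \<bullet> n3 > 0" "rot s n3 \<bullet> n4 > 0" "rot s n4 \<bullet> n1 > 0"
    and A: "A - V = l1 *\<^sub>R (n1 + n2)" "l1 > 0" and B: "B - V = l2 *\<^sub>R (n2 + n3)" "l2 > 0"
    and A': "A' - V = l3 *\<^sub>R (n3 + n4)" "l3 > 0" and B': "B' - V = l4 *\<^sub>R (n4 + n1)" "l4 > 0"
  shows "angle_at A V B + angle_at A' V B' = pi"
proof -
  obtain C where C: "angle_at A V B = arccos C" "C^2 = (1 + n1 \<bullet> n3) / 2" "\<exists>q>0. q * C * (rot s n1 \<bullet> n3) = 1 + n1 \<bullet> n3"
    "1 + n1 \<bullet> n3 = 0 \<or> rot s n1 \<bullet> n3 \<noteq> 0"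
    by (rule angle_at_bisectors[OF unit(1-3) cr(1,2) A B])
  obtain C' where C': "angle_at A' V B' = arccos C'" "C'^2 = (1 + n3 \<bullet> n1) / 2" "\<exists>q>0. q * C' * (rot s n3 \<bullet> n1) = 1 + n3 \<bullet> n1"
    by (rule angle_at_bisectors[OF unit(3,4,1) cr(3,4) A' B'])
  have sw: "rot s n3 \<bullet> n1 = - (rot s n1 \<bullet> n3)" by (rule rot_swap)
  have "C' = - C"
  proof (cases "1 + n1 \<bullet> n3 = 0")
    case True
    then have "C^2 = 0" "C'^2 = 0" using C(2) C'(2) by (simp_all add: inner_commute)
    then show ?thesis by simp
  next
    case False
    then have x: "rot s n1 \<bullet> n3 \<noteq> 0" using C(4) by blast
    obtain q where q: "q > 0" "q * C * (rot s n1 \<bullet> n3) = 1 + n1 \<bullet> n3" using C(3) by blast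
    obtain q' where q': "q' > 0" "q' * C' * (rot s n3 \<bullet> n1) = 1 + n3 \<bullet> n1" using C'(3) by blast
    have "q * C * (rot s n1 \<bullet> n3) = - (q' * C' * (rot s n1 \<bullet> n3))" using q q' sw by (simp add: inner_commute)
    then have "(q * C + q' * C') * (rot s n1 \<bullet> n3) = 0" by (simp add: algebra_simps)
    then have qq: "q * C = - (q' * C')" using x by simp
    have "C^2 = C'^2" using C(2) C'(2) by (simp add: inner_commute)
    then consider "C = C'" | "C = - C'" by (auto simp: power2_eq_iff)
    then show ?thesis
    proof cases
      case 1
      then have "(q + q') * C = 0" using qq by (simp add: algebra_simps)
      then show ?thesis using q(1) q'(1) 1 by simp
    qed simp
  qed
  have "n1 \<bullet> n3 \<le> 1" using inner_le_1(1) unit by blast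
  then have "C^2 \<le> 1" using C(2) by simp
  then have "-1 \<le> C" "C \<le> 1" using abs_square_le_1[of C] by auto
  then show ?thesis unfolding C(1) C'(1) \<open>C' = - C\<close> by (simp add: arccos_minus)
qed

context ic_net begin

text \<open>The two incircles lie in vertical angles at the common vertex; the difference of the
  centers has the sum of the radii as product with both normals there.\<close>

lemma center_step_NE:
  assumes us: "is_unit_square P i j" "is_unit_square P (i + 1) (j + 1)"
  shows "\<exists>l>0. cen (i + 1) (j + 1) - cen i j = l *\<^sub>R (u (i + 1) + v (j + 1))"
  by (rule bisector_direction[OF unit_u unit_v, of s _ _ _ "rad i j + rad (i + 1) (j + 1)"])
    (use good_cross[OF goodI(4)[OF us(1)]] cenD[OF us(1)] cenD[OF us(2)] cen(2)[OF us(1)] cen(2)[OF us(2)] in \<open>auto simp: inner_diff_right\<close>)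

lemma center_step_NW:
  assumes us: "is_unit_square P i j" "is_unit_square P (i - 1) (j + 1)"
  shows "\<exists>l>0. cen (i - 1) (j + 1) - cen i j = l *\<^sub>R (v (j + 1) - u i)"
proof -
  have "\<exists>l>0. cen (i - 1) (j + 1) - cen i j = l *\<^sub>R (v (j + 1) + - u i)"
    by (rule bisector_direction[of _ _ s _ "rad i j + rad (i - 1) (j + 1)"])
      (use good_cross[OF goodI(3)[OF us(1)]] rot_swap[of s "v (j + 1)" "u i"] cenD[OF us(1)] cenD[OF us(2)] cen(2)[OF us(1)] cen(2)[OF us(2)]
        in \<open>auto simp: inner_diff_right unit_u unit_v\<close>)
  then show ?thesis by simp
qed

text \<open>At the right and the left center the sides bisect angles between a column and the rows
  \<open>j + 1\<close> and \<open>j + 2\<close>. Modulo \<pi>, the angle there depends only on these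
  two rows and not on the column.\<close>

theorem centers_concyclic:
  assumes us: "is_unit_square P i j" "is_unit_square P (i + 1) (j + 1)" "is_unit_square P i (j + 2)" "is_unit_square P (i - 1) (j + 1)"
  shows "concyclic {cen i j, cen (i + 1) (j + 1), cen i (j + 2), cen (i - 1) (j + 1)}"
proof -
  define U1 where "U1 = u (i + 1)"
  define U0 where "U0 = u i"
  define V1 where "V1 = v (j + 1)"
  define V2 where "V2 = v (j + 2)"
  have unit: "norm U1 = 1" "norm U0 = 1" "norm V1 = 1" "norm V2 = 1" by (simp_all add: U1_def U0_def V1_def V2_def unit_u unit_v)
  obtain l1 where l1: "l1 > 0" "cen (i + 1) (j + 1) - cen i j = l1 *\<^sub>R (U1 + V1)"
    using center_step_NE[OF us(1,2)] by (auto simp: U1_def V1_def)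
  obtain l2 where l2: "l2 > 0" "cen i (j + 2) - cen (i + 1) (j + 1) = l2 *\<^sub>R (V2 - U1)"
    using center_step_NW[of "i + 1" "j + 1"] us by (auto simp: U1_def V2_def add.commute)
  obtain l3 where l3: "l3 > 0" "cen i (j + 2) - cen (i - 1) (j + 1) = l3 *\<^sub>R (U0 + V2)"
    using center_step_NE[of "i - 1" "j + 1"] us by (auto simp: U0_def V2_def add.commute)
  obtain l4 where l4: "l4 > 0" "cen (i - 1) (j + 1) - cen i j = l4 *\<^sub>R (V1 - U0)"
    using center_step_NW[OF us(1,4)] by (auto simp: U0_def V1_def)
  have a: "cen i j - cen (i + 1) (j + 1) = l1 *\<^sub>R (- (U1 + V1))" using l1(2) by (metis minus_diff_eq scaleR_minus_right)
  have b: "cen i j - cen (i - 1) (j + 1) = l4 *\<^sub>R (U0 - V1)" using l4(2) by (metis minus_diff_eq scaleR_minus_right)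
  have v12: "V1 \<noteq> - V2" unfolding V1_def V2_def
    using v_ne_minus[OF goodI(1,3)[OF us(2)]] by (simp add: add.commute)
  have H1: "((V1 + U1) \<bullet> (- U1 + V2)) * (1 + V1 \<bullet> V2) = - ((rot 1 (V1 + U1) \<bullet> (- U1 + V2)) * (rot 1 V1 \<bullet> V2))"
    and H2: "((V1 + - U0) \<bullet> (U0 + V2)) * (1 + V1 \<bullet> V2) = - ((rot 1 (V1 + - U0) \<bullet> (U0 + V2)) * (rot 1 V1 \<bullet> V2))"
  proof -
    have *: "((m + n) \<bullet> (- n + m')) * (1 + m \<bullet> m') = - ((rot 1 (m + n) \<bullet> (- n + m')) * (rot 1 m \<bullet> m'))"
      if "norm n = 1" "norm m = 1" "norm m' = 1" for n m m' :: "real^2"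
    proof -
      have N: "n$1 * n$1 + n$2 * n$2 = 1" and M: "m$1 * m$1 + m$2 * m$2 = 1" and M': "m'$1 * m'$1 + m'$2 * m'$2 = 1"
        using that by (auto simp: norm_eq_1_iff2)
      show ?thesis using N M M' by (simp add: inner2) algebra
    qed
    show "((V1 + U1) \<bullet> (- U1 + V2)) * (1 + V1 \<bullet> V2) = - ((rot 1 (V1 + U1) \<bullet> (- U1 + V2)) * (rot 1 V1 \<bullet> V2))"
      using unit by (intro *)
    show "((V1 + - U0) \<bullet> (U0 + V2)) * (1 + V1 \<bullet> V2) = - ((rot 1 (V1 + - U0) \<bullet> (U0 + V2)) * (rot 1 V1 \<bullet> V2))"
      using *[of "- U0" V1 V2] unit by simp
  qed
  have "V1 \<bullet> (- V2) < 1" using v12 unit by (intro inner_unit_less_1) auto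
  then have c: "1 + V1 \<bullet> V2 > 0" by simp
  define X where "X = rot 1 (V1 + U1) \<bullet> (- U1 + V2)"
  define X' where "X' = rot 1 (V1 + - U0) \<bullet> (U0 + V2)"
  define Y where "Y = (V1 + U1) \<bullet> (- U1 + V2)"
  define Y' where "Y' = (V1 + - U0) \<bullet> (U0 + V2)"
  have "(X * Y') * (1 + V1 \<bullet> V2) = (Y * X') * (1 + V1 \<bullet> V2)"
    using H1 H2 unfolding X_def[symmetric] X'_def[symmetric] Y_def[symmetric] Y'_def[symmetric] by algebra
  then have XY: "X * Y' = Y * X'" using c by simp
  have "cen (i + 1) (j + 1) \<noteq> cen i j" "cen i (j + 2) \<noteq> cen (i + 1) (j + 1)"
    using cenD(2)[OF us(1)] cenD(1)[OF us(2)] cenD(4)[OF us(2)] cenD(3)[OF us(3)] cen(2)[OF us(1)] cen(2)[OF us(2)] cen(2)[OF us(3)]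
    by (auto simp: add.commute)
  then have ne: "V1 + U1 \<noteq> 0" "- U1 + V2 \<noteq> 0" using l1 l2 by (auto simp: add.commute)
  \<comment> \<open>Otherwise \<open>Y\<close> vanishes as well, and by Lagrange's identity one of
    the two steps between centers would be zero.\<close>
  have X0: "X \<noteq> 0"
  proof
    assume "X = 0"
    then have "Y * (1 + V1 \<bullet> V2) = 0" using H1 by (simp add: X_def Y_def)
    then have "Y = 0" using c by simp
    then have "((V1 + U1) \<bullet> (V1 + U1)) * ((- U1 + V2) \<bullet> (- U1 + V2)) = 0"
      using \<open>X = 0\<close> lagrange_identity[of "V1 + U1" "- U1 + V2"] by (simp only: X_def Y_def) simp
    then show False using ne by simp
  qed
  show ?thesis
  proof (rule concyclic_by_angles)
    have e1: "rot 1 (cen i j - cen (i + 1) (j + 1)) \<bullet> (cen i (j + 2) - cen (i + 1) (j + 1)) = - l1 * l2 * X"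
      unfolding a l2(2) X_def by (simp add: inner2) algebra
    have e2: "(cen i j - cen (i + 1) (j + 1)) \<bullet> (cen i (j + 2) - cen (i + 1) (j + 1)) = - l1 * l2 * Y"
      unfolding a l2(2) Y_def by (simp add: inner2) algebra
    have e3: "rot 1 (cen i j - cen (i - 1) (j + 1)) \<bullet> (cen i (j + 2) - cen (i - 1) (j + 1)) = - l3 * l4 * X'"
      unfolding b l3(2) X'_def by (simp add: inner2) algebra
    have e4: "(cen i j - cen (i - 1) (j + 1)) \<bullet> (cen i (j + 2) - cen (i - 1) (j + 1)) = - l3 * l4 * Y'"
      unfolding b l3(2) Y'_def by (simp add: inner2) algebra
    show "rot 1 (cen i j - cen (i + 1) (j + 1)) \<bullet> (cen i (j + 2) - cen (i + 1) (j + 1)) \<noteq> 0" unfolding e1 using X0 l1 l2 by simp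
    show "(rot 1 (cen i j - cen (i + 1) (j + 1)) \<bullet> (cen i (j + 2) - cen (i + 1) (j + 1))) * ((cen i j - cen (i - 1) (j + 1)) \<bullet> (cen i (j + 2) - cen (i - 1) (j + 1)))
      = ((cen i j - cen (i + 1) (j + 1)) \<bullet> (cen i (j + 2) - cen (i + 1) (j + 1))) * (rot 1 (cen i j - cen (i - 1) (j + 1)) \<bullet> (cen i (j + 2) - cen (i - 1) (j + 1)))"
      unfolding e1 e2 e3 e4 using XY by (simp add: algebra_simps)
  qed
qed

text \<open>With the outward normals \<open>n1\<close>, \<open>n2\<close>, \<open>n3\<close>,
  \<open>n4\<close> in cyclic order, the neighbouring centers lie in the directions of the sums of
  successive normals; the two equations differ by a cyclic shift.\<close>

theorem centers_conical:
  assumes us: "is_unit_square P i j" "is_unit_square P (i + 1) (j + 1)" "is_unit_square P (i - 1) (j + 1)"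
    "is_unit_square P (i - 1) (j - 1)" "is_unit_square P (i + 1) (j - 1)"
  shows "angle_at (cen (i + 1) (j + 1)) (cen i j) (cen (i - 1) (j + 1)) + angle_at (cen (i - 1) (j - 1)) (cen i j) (cen (i + 1) (j - 1)) = pi"
    "angle_at (cen (i - 1) (j + 1)) (cen i j) (cen (i - 1) (j - 1)) + angle_at (cen (i + 1) (j - 1)) (cen i j) (cen (i + 1) (j + 1)) = pi"
proof -
  define n1 where "n1 = u (i + 1)"
  define n2 where "n2 = v (j + 1)"
  define n3 where "n3 = - u i"
  define n4 where "n4 = - v j"
  have unit: "norm n1 = 1" "norm n2 = 1" "norm n3 = 1" "norm n4 = 1" by (simp_all add: n1_def n2_def n3_def n4_def unit_u unit_v)
  note g = goodI[OF us(1), THEN good_cross]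
  have cr: "rot s n1 \<bullet> n2 > 0" "rot s n2 \<bullet> n3 > 0" "rot s n3 \<bullet> n4 > 0" "rot s n4 \<bullet> n1 > 0"
    using g rot_swap[of s "v (j + 1)" "u i"] rot_swap[of s "v j" "u (i + 1)"] by (simp_all add: n1_def n2_def n3_def n4_def rot_minus)
  obtain l1 where l1: "l1 > 0" "cen (i + 1) (j + 1) - cen i j = l1 *\<^sub>R (n1 + n2)"
    using center_step_NE[OF us(1,2)] by (auto simp: n1_def n2_def)
  obtain l2 where l2: "l2 > 0" "cen (i - 1) (j + 1) - cen i j = l2 *\<^sub>R (n2 + n3)"
    using center_step_NW[OF us(1,3)] by (auto simp: n2_def n3_def)
  obtain l3 where l3: "l3 > 0" "cen i j - cen (i - 1) (j - 1) = l3 *\<^sub>R (u i + v j)"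
    using center_step_NE[of "i - 1" "j - 1"] us by auto
  obtain l4 where l4: "l4 > 0" "cen i j - cen (i + 1) (j - 1) = l4 *\<^sub>R (v j - u (i + 1))"
    using center_step_NW[of "i + 1" "j - 1"] us by auto
  have l3': "cen (i - 1) (j - 1) - cen i j = l3 *\<^sub>R (n3 + n4)"
  proof -
    have "cen (i - 1) (j - 1) - cen i j = - (l3 *\<^sub>R (u i + v j))" unfolding l3(2)[symmetric] by simp
    then show ?thesis by (simp add: n3_def n4_def algebra_simps)
  qed
  have l4': "cen (i + 1) (j - 1) - cen i j = l4 *\<^sub>R (n4 + n1)"
  proof -
    have "cen (i + 1) (j - 1) - cen i j = - (l4 *\<^sub>R (v j - u (i + 1)))" unfolding l4(2)[symmetric] by simp
    then show ?thesis by (simp add: n1_def n4_def algebra_simps)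
  qed
  show "angle_at (cen (i + 1) (j + 1)) (cen i j) (cen (i - 1) (j + 1)) + angle_at (cen (i - 1) (j - 1)) (cen i j) (cen (i + 1) (j - 1)) = pi"
    by (rule opposite_angles_sum[OF unit cr l1(2,1) l2(2,1) l3' l3(1) l4' l4(1)])
  show "angle_at (cen (i - 1) (j + 1)) (cen i j) (cen (i - 1) (j - 1)) + angle_at (cen (i + 1) (j - 1)) (cen i j) (cen (i + 1) (j + 1)) = pi"
    by (rule opposite_angles_sum[OF unit(2-4,1) cr(2-4,1) l2(2,1) l3' l3(1) l4' l4(1) l1(2,1)])
qed

end

section \<open>Coordinates for a checkerboard IC-net\<close>

text \<open>Betweenness of a triple passes the direction of one step on to the next; the size
  guarantees a first triple, hence a nonzero first step.\<close>

lemma monotone_on_line: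
  fixes g :: "int \<Rightarrow> real^2"
  assumes size: "m1 + 4 \<le> m2"
    and seg: "\<And>i. m1 < i - 1 \<Longrightarrow> i + 1 < m2 \<Longrightarrow> g i \<in> open_segment (g (i - 1)) (g (i + 1))"
  shows "\<exists>a. norm a = 1 \<and> (\<forall>i i'. m1 < i \<and> i < i' \<and> i' < m2 \<longrightarrow> (\<exists>t>0. g i' = g i + t *\<^sub>R a))"
proof -
  define i0 where "i0 = m1 + 1"
  have seg': "g (i + 1) \<in> open_segment (g i) (g (i + 2))" if "m1 < i" "i + 2 < m2" for i
  proof -
    have e: "i + 1 - 1 = i" "i + 1 + 1 = i + 2" by simp_all
    show ?thesis using seg[of "i + 1", unfolded e] that by blast
  qed
  have "g (i0 + 1) \<in> open_segment (g i0) (g (i0 + 2))" using seg'[of i0] size by (simp add: i0_def)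
  then have ne: "g (i0 + 1) \<noteq> g i0" by (auto simp: open_segment_def)
  define a where "a = sgn (g (i0 + 1) - g i0)"
  have one_step: "i + 1 < m2 \<longrightarrow> (\<exists>t>0. g (i + 1) = g i + t *\<^sub>R a)" if "i0 \<le> i" for i
    using that
  proof (induction i rule: int_ge_induct)
    case base
    have "g (i0 + 1) = g i0 + norm (g (i0 + 1) - g i0) *\<^sub>R a" using ne by (simp add: a_def sgn_div_norm)
    then show ?case using ne by (intro impI exI[of _ "norm (g (i0 + 1) - g i0)"]) simp
  next
    case (step i)
    show ?case
    proof
      assume i: "i + 1 + 1 < m2"
      then obtain t where t: "t > 0" "g (i + 1) = g i + t *\<^sub>R a" using step by auto
      have "g (i + 1) \<in> open_segment (g i) (g (i + 2))" using seg'[of i] i step(1) by (simp add: i0_def)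
      then obtain w where w: "0 < w" "w < 1" "g (i + 1) = (1 - w) *\<^sub>R g i + w *\<^sub>R g (i + 2)"
        by (auto simp: in_segment)
      have gi: "g (i + 1) - t *\<^sub>R a = g i" using t(2) by simp
      have c: "w * ((1 - w) * t / w) = (1 - w) * t" using w(1) by simp
      have "w *\<^sub>R g (i + 2) = g (i + 1) - (1 - w) *\<^sub>R g i" using w(3) by (metis add_diff_cancel_left')
      also have "\<dots> = g (i + 1) - (1 - w) *\<^sub>R (g (i + 1) - t *\<^sub>R a)" by (simp only: gi)
      also have "\<dots> = w *\<^sub>R g (i + 1) + ((1 - w) * t) *\<^sub>R a" by (simp add: algebra_simps)
      also have "\<dots> = w *\<^sub>R (g (i + 1) + ((1 - w) * t / w) *\<^sub>R a)" by (simp only: scaleR_add_right scaleR_scaleR c)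
      finally have "g (i + 2) = g (i + 1) + ((1 - w) * t / w) *\<^sub>R a" using w(1) by (metis scaleR_left_imp_eq less_irrefl)
      then show "\<exists>t>0. g (i + 1 + 1) = g (i + 1) + t *\<^sub>R a"
        using w t by (intro exI[of _ "(1 - w) * t / w"]) (simp add: add.commute)
    qed
  qed
  have "i' < m2 \<longrightarrow> (\<exists>t>0. g i' = g i + t *\<^sub>R a)" if "m1 < i" "i < i'" for i i'
    using that(2)
  proof (induction i' rule: int_gr_induct)
    case base then show ?case using one_step[of i] that by (simp add: i0_def)
  next
    case (step i')
    show ?case
    proof
      assume "i' + 1 < m2"
      moreover have "i0 \<le> i'" using step(1) that(1) by (simp add: i0_def)
      ultimately obtain t' where t': "t' > 0" "g (i' + 1) = g i' + t' *\<^sub>R a" using one_step by blast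
      obtain t where t: "t > 0" "g i' = g i + t *\<^sub>R a" using step \<open>i' + 1 < m2\<close> by auto
      show "\<exists>t>0. g (i' + 1) = g i + t *\<^sub>R a" using t t' by (intro exI[of _ "t + t'"]) (simp add: scaleR_add_left)
    qed
  qed
  moreover have "norm a = 1" using ne by (simp add: a_def norm_sgn)
  ultimately show ?thesis by blast
qed

text \<open>Unit net-squares in a single strip share no vertex; a second strip connects them.
  Starting at \<open>(m1 + 1, b)\<close>, each one is reached diagonally or, along the boundary, in
  two steps through a neighbour in the next strip.\<close>

lemma unit_squares_connected:
  fixes m1 m2 n1 n2 :: int
  defines "U \<equiv> is_unit_square (rectangle m1 m2 n1 n2)"
  assumes size: "m1 + 4 \<le> m2" "n1 + 4 \<le> n2"
    and ex: "\<And>i j. U i j \<Longrightarrow> \<exists>s. Q i j s"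
    and NE: "\<And>i j s s'. U i j \<Longrightarrow> U (i + 1) (j + 1) \<Longrightarrow> Q i j s \<Longrightarrow> Q (i + 1) (j + 1) s' \<Longrightarrow> s = s'"
    and NW: "\<And>i j s s'. U (i + 1) j \<Longrightarrow> U i (j + 1) \<Longrightarrow> Q (i + 1) j s \<Longrightarrow> Q i (j + 1) s' \<Longrightarrow> s = s'"
  shows "\<exists>s. \<forall>i j. U i j \<longrightarrow> Q i j s"
proof -
  have U: "U i j \<longleftrightarrow> even (i + j) \<and> m1 < i \<and> i + 1 < m2 \<and> n1 < j \<and> j + 1 < n2" for i j
    unfolding U_def by (rule is_unit_square_rectangle)
  define b where "b = (if even (m1 + n1) then n1 + 1 else n1 + 2)"
  have base: "U (m1 + 1) b" unfolding U b_def using size by auto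
  then obtain s where s: "Q (m1 + 1) b s" using ex by blast
  have "U i j \<longrightarrow> Q i j s" for i j
  proof (induction "nat (i + j - m1 - n1)" arbitrary: i j rule: less_induct)
    case less
    show ?case
    proof
      assume u: "U i j"
      then obtain s' where s': "Q i j s'" using ex by blast
      have r: "even (i + j)" "m1 < i" "i + 1 < m2" "n1 < j" "j + 1 < n2" using u unfolding U by auto
      consider "m1 + 1 < i" "n1 + 1 < j" | "i = m1 + 1" "n1 + 2 < j" | "j = n1 + 1" "m1 + 2 < i"
        | "i = m1 + 1" "j \<le> n1 + 2" | "i = m1 + 2" "j = n1 + 1" using r by linarith
      then have "s' = s"
      proof cases
        case 1
        then have u': "U (i - 1) (j - 1)" using r unfolding U by auto
        then have "Q (i - 1) (j - 1) s" using less[of "i - 1" "j - 1"] r by auto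
        then show ?thesis using NE[OF u', of s s'] u s' by simp
      next
        case 2
        then have u': "U (i + 1) (j - 1)" "U i (j - 2)" using r size unfolding U by auto
        then have "Q i (j - 2) s" using less[of i "j - 2"] r by auto
        moreover obtain q where q: "Q (i + 1) (j - 1) q" using ex u' by blast
        ultimately show ?thesis using NE[of i "j - 2" s q] NW[of i "j - 1" q s'] u u' s' by simp
      next
        case 3
        then have u': "U (i - 1) (j + 1)" "U (i - 2) j" using r size unfolding U by auto
        then have "Q (i - 2) j s" using less[of "i - 2" j] r by auto
        moreover obtain q where q: "Q (i - 1) (j + 1) q" using ex u' by blast
        ultimately show ?thesis using NE[of "i - 2" j s q] NW[of "i - 1" j s' q] u u' s' by simp
      next
        \<comment> \<open>This is the starting square itself. \<open>Q\<close> is not assumed to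
          determine the sign, so \<open>s\<close> and \<open>s'\<close> are both compared with the
          sign of a neighbour.\<close>
        case 4
        then have "j = b" using r unfolding b_def by (auto; presburger)
        then show ?thesis using NE NW u s s' 4 ex
        proof -
          have u': "U (i + 1) (j + 1) \<or> U (i + 1) (j - 1)" using r size 4 unfolding U by auto
          then show ?thesis
          proof
            assume w: "U (i + 1) (j + 1)"
            then obtain q where q: "Q (i + 1) (j + 1) q" using ex by blast
            show ?thesis using NE[OF u w _ q, of s] NE[OF u w s' q] s 4 \<open>j = b\<close> by simp
          next
            assume w: "U (i + 1) (j - 1)"
            then obtain q where q: "Q (i + 1) (j - 1) q" using ex by blast
            show ?thesis using NW[of i "j - 1" q s] NW[of i "j - 1" q s'] w u q s s' 4 \<open>j = b\<close> by simp
          qed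
        qed
      next
        case 5
        then have "b = n1 + 2" using r unfolding b_def by auto
        then show ?thesis using NW[of "m1 + 1" "n1 + 1" s' s] u base s s' 5 by (simp add: add.commute)
      qed
      then show "Q i j s" using s' by simp
    qed
  qed
  then show ?thesis by blast
qed

text \<open>The order of the points gives directions \<open>a\<close> of rows and \<open>b\<close>
  of columns. Each incircle determines an orientation; unit net-squares sharing a vertex agree
  because the same two lines cross there, and connectedness makes the choice global.\<close>

theorem ic_net_of_checkerboard:
  assumes net: "checkerboard_IC_net (rectangle m1 m2 n1 n2) f" and size: "m1 + 4 \<le> m2" "n1 + 4 \<le> n2"
  shows "\<exists>s u v h k. ic_net m1 m2 n1 n2 f s u v h k"
proof -
  let ?P = "rectangle m1 m2 n1 n2"
  have "\<exists>a. norm a = 1 \<and> (n1 < j \<and> j < n2 \<longrightarrow> (\<forall>i i'. m1 < i \<and> i < i' \<and> i' < m2 \<longrightarrow> (\<exists>t>0. f i' j = f i j + t *\<^sub>R a)))" for j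
  proof (cases "n1 < j \<and> j < n2")
    case True
    then show ?thesis
      using monotone_on_line[OF size(1), of "\<lambda>i. f i j"] net unfolding checkerboard_IC_net_def mem_rectangle by simp
  next
    \<comment> \<open>Indices outside the rectangle get a default unit direction, since the normals
      are total functions.\<close>
    case False then show ?thesis by (intro exI[of _ "axis 1 1"]) (auto simp: norm_axis_1)
  qed
  then obtain a where a: "\<And>j. norm (a j) = 1"
    "\<And>i i' j. n1 < j \<Longrightarrow> j < n2 \<Longrightarrow> m1 < i \<Longrightarrow> i < i' \<Longrightarrow> i' < m2 \<Longrightarrow> \<exists>t>0. f i' j = f i j + t *\<^sub>R a j" by metis
  have "\<exists>b. norm b = 1 \<and> (m1 < i \<and> i < m2 \<longrightarrow> (\<forall>j j'. n1 < j \<and> j < j' \<and> j' < n2 \<longrightarrow> (\<exists>t>0. f i j' = f i j + t *\<^sub>R b)))" for i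
  proof (cases "m1 < i \<and> i < m2")
    case True
    then show ?thesis
      using monotone_on_line[OF size(2), of "\<lambda>j. f i j"] net unfolding checkerboard_IC_net_def mem_rectangle by simp
  next
    case False then show ?thesis by (intro exI[of _ "axis 1 1"]) (auto simp: norm_axis_1)
  qed
  then obtain b where b: "\<And>i. norm (b i) = 1"
    "\<And>i j j'. m1 < i \<Longrightarrow> i < m2 \<Longrightarrow> n1 < j \<Longrightarrow> j < j' \<Longrightarrow> j' < n2 \<Longrightarrow> \<exists>t>0. f i j' = f i j + t *\<^sub>R b i" by metis
  define Q where "Q i j s \<longleftrightarrow> (s = 1 \<or> s = -1) \<and> rot s (a j) \<bullet> b i > 0 \<and> rot s (a j) \<bullet> b (i + 1) > 0 \<and>
    rot s (a (j + 1)) \<bullet> b i > 0 \<and> rot s (a (j + 1)) \<bullet> b (i + 1) > 0 \<and>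
    (\<exists>p r. 0 < r \<and> rot s (a j) \<bullet> (p - f i j) = r \<and> rot s (b (i + 1)) \<bullet> (p - f (i + 1) j) = r \<and>
      rot s (- a (j + 1)) \<bullet> (p - f (i + 1) (j + 1)) = r \<and> rot s (- b i) \<bullet> (p - f i (j + 1)) = r)" for i j and s :: real
  have ex: "\<exists>s. Q i j s" if us: "is_unit_square ?P i j" for i j
  proof -
    have r: "m1 < i" "i + 1 < m2" "n1 < j" "j + 1 < n2" using us by (auto simp: is_unit_square_rectangle)
    obtain p r where ic: "inscribed_circle (f i j, f (i + 1) j, f (i + 1) (j + 1), f i (j + 1)) p r"
      using net us unfolding checkerboard_IC_net_def circumscribed_def net_square_def by blast
    obtain t1 where t1: "t1 > 0" "f (i + 1) j = f i j + t1 *\<^sub>R a j" using a(2)[of j i "i + 1"] r by auto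
    obtain t2 where t2: "t2 > 0" "f (i + 1) (j + 1) = f (i + 1) j + t2 *\<^sub>R b (i + 1)" using b(2)[of "i + 1" j "j + 1"] r by auto
    obtain t3 where t3: "t3 > 0" "f (i + 1) (j + 1) = f i (j + 1) + t3 *\<^sub>R a (j + 1)" using a(2)[of "j + 1" i "i + 1"] r by auto
    obtain t4 where t4: "t4 > 0" "f i (j + 1) = f i j + t4 *\<^sub>R b i" using b(2)[of i j "j + 1"] r by auto
    have e1: "f (i + 1) j - f i j = t1 *\<^sub>R a j" using t1(2) by simp
    have e2: "f (i + 1) (j + 1) - f (i + 1) j = t2 *\<^sub>R b (i + 1)" using t2(2) by simp
    have e3: "f i (j + 1) - f (i + 1) (j + 1) = t3 *\<^sub>R (- a (j + 1))" using t3(2) by simp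
    have e4: "f i j - f i (j + 1) = t4 *\<^sub>R (- b i)" using t4(2) by simp
    have nn: "norm (- a (j + 1)) = 1" "norm (- b i) = 1" using a(1) b(1) by simp_all
    have r0: "0 < r" using ic by simp
    have sw: "rot s (b x) \<bullet> a y = - (rot s (a y) \<bullet> b x)" for s x y by (rule rot_swap)
    from inscribed_circle_signed[OF ic e1 e2 e3 e4 t1(1) t2(1) t3(1) t4(1) a(1) b(1) nn]
    obtain s where "(s = 1 \<or> s = -1)" "rot s (a j) \<bullet> b (i + 1) > 0" "rot s (b (i + 1)) \<bullet> (- a (j + 1)) > 0"
      "rot s (- a (j + 1)) \<bullet> (- b i) > 0" "rot s (- b i) \<bullet> a j > 0"
      "rot s (a j) \<bullet> (p - f i j) = r" "rot s (b (i + 1)) \<bullet> (p - f (i + 1) j) = r"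
      "rot s (- a (j + 1)) \<bullet> (p - f (i + 1) (j + 1)) = r" "rot s (- b i) \<bullet> (p - f i (j + 1)) = r"
      by blast
    then have "Q i j s" unfolding Q_def using r0 by (auto simp: rot_minus sw)
    then show ?thesis ..
  qed
  have same: "s = s'" if "rot s x \<bullet> y > 0" "rot s' x \<bullet> y > 0" "s = 1 \<or> s = -1" "s' = 1 \<or> s' = -1" for s s' x y
    using that by (auto simp: inner2)
  have "\<exists>s. \<forall>i j. is_unit_square ?P i j \<longrightarrow> Q i j s"
  proof (rule unit_squares_connected[OF size ex])
    show "s = s'" if "Q i j s" "Q (i + 1) (j + 1) s'" for i j s s'
      using that same[of s "a (j + 1)" "b (i + 1)" s'] by (auto simp: Q_def)
    show "s = s'" if "Q (i + 1) j s" "Q i (j + 1) s'" for i j s s'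
      using that same[of s "a (j + 1)" "b (i + 1)" s'] by (auto simp: Q_def)
  qed
  then obtain s where Q: "\<And>i j. is_unit_square ?P i j \<Longrightarrow> Q i j s" by blast
  have "is_unit_square ?P (m1 + 1) (if even (m1 + n1) then n1 + 1 else n1 + 2)"
    using size by (auto simp: is_unit_square_rectangle)
  from Q[OF this] have s: "s = 1 \<or> s = -1" by (simp add: Q_def)
  define u where "u i = - rot s (b i)" for i
  define v where "v j = rot s (a j)" for j
  define h where "h i = u i \<bullet> f i (n1 + 1)" for i
  define k where "k j = v j \<bullet> f (m1 + 1) j" for j
  have col: "u i \<bullet> f i j = h i" if ij: "(i, j) \<in> ?P" for i j
  proof (cases "j = n1 + 1")
    case False
    then obtain t where "f i j = f i (n1 + 1) + t *\<^sub>R b i" using b(2)[of i "n1 + 1" j] ij by (auto simp: mem_rectangle)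
    then show ?thesis by (simp add: h_def u_def inner_add_right)
  qed (simp add: h_def)
  have row: "v j \<bullet> f i j = k j" if ij: "(i, j) \<in> ?P" for i j
  proof (cases "i = m1 + 1")
    case False
    then obtain t where "f i j = f (m1 + 1) j + t *\<^sub>R a j" using a(2)[of j "m1 + 1" i] ij by (auto simp: mem_rectangle)
    then show ?thesis by (simp add: k_def v_def inner_add_right)
  qed (simp add: k_def)
  have "ic_net m1 m2 n1 n2 f s u v h k"
  proof
    show "s = 1 \<or> s = -1" "m1 + 4 \<le> m2" "n1 + 4 \<le> n2" by fact+
    show "norm (u i) = 1" "norm (v i) = 1" for i by (simp_all add: u_def v_def norm_rot[OF s] a b)
    show "u i \<bullet> f i j = h i" "v j \<bullet> f i j = k j" if "(i, j) \<in> ?P" for i j using that col row by auto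
    show "\<exists>t>0. f i' j = f i j - t *\<^sub>R rot s (v j)" if "(i, j) \<in> ?P" "(i', j) \<in> ?P" "i < i'" for i i' j
      using that a(2)[of j i i'] by (simp add: mem_rectangle v_def rot_rot[OF s])
    show "\<exists>t>0. f i j' = f i j + t *\<^sub>R rot s (u i)" if "(i, j) \<in> ?P" "(i, j') \<in> ?P" "j < j'" for i j j'
      using that b(2)[of i j j'] by (simp add: mem_rectangle u_def rot_rot[OF s] rot_minus)
    show "rot s (u i) \<bullet> v j > 0" if "good ?P i j" for i j
    proof -
      have "rot s (a j) \<bullet> b i > 0" using that Q by (auto simp: good_def Q_def)
      then show ?thesis by (simp add: u_def v_def rot_minus rot_rot[OF s] inner_commute)
    qed
    show "\<exists>p r. 0 < r \<and> u i \<bullet> p - h i = r \<and> h (i + 1) - u (i + 1) \<bullet> p = r \<and> v j \<bullet> p - k j = r \<and> k (j + 1) - v (j + 1) \<bullet> p = r"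
      if us: "is_unit_square ?P i j" for i j
    proof -
      have mem: "(i, j) \<in> ?P" "(i + 1, j) \<in> ?P" "(i + 1, j + 1) \<in> ?P" "(i, j + 1) \<in> ?P"
        using us by (auto simp: is_unit_square_rectangle mem_rectangle)
      obtain p r where p: "0 < r" "rot s (a j) \<bullet> (p - f i j) = r" "rot s (b (i + 1)) \<bullet> (p - f (i + 1) j) = r"
        "rot s (- a (j + 1)) \<bullet> (p - f (i + 1) (j + 1)) = r" "rot s (- b i) \<bullet> (p - f i (j + 1)) = r"
        using Q[OF us] unfolding Q_def by blast
      have "u i \<bullet> (p - f i (j + 1)) = r" "- (u (i + 1) \<bullet> (p - f (i + 1) j)) = r" "v j \<bullet> (p - f i j) = r" "- (v (j + 1) \<bullet> (p - f (i + 1) (j + 1))) = r"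
        using p unfolding u_def v_def by (simp_all add: rot_minus)
      then show ?thesis
        using p(1) col[OF mem(2)] col[OF mem(4)] row[OF mem(1)] row[OF mem(3)]
        by (intro exI[of _ p] exI[of _ r]) (simp add: inner_diff_right)
    qed
  qed
  then show ?thesis by blast
qed

text \<open>The points \<open>p + r b\<close> and \<open>p - r b\<close> are equidistant from
  \<open>q\<close>, so \<open>p - q\<close> is orthogonal to every basis vector
  \<open>b\<close>.\<close>

lemma sphere_center_unique:
  fixes p q :: "'a::euclidean_space"
  assumes "sphere p r = sphere q R" "r > 0"
  shows "p = q" "r = R"
proof -
  have "(p - q) \<bullet> b = 0" if b: "b \<in> Basis" for b
  proof -
    have "p + r *\<^sub>R b \<in> sphere p r" "p - r *\<^sub>R b \<in> sphere p r" using b assms(2) by (simp_all add: dist_norm)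
    then have "norm (q - (p + r *\<^sub>R b)) = R" "norm (q - (p - r *\<^sub>R b)) = R" unfolding assms(1) by (simp_all add: dist_norm)
    moreover have "norm (q - (p + r *\<^sub>R b)) = norm ((p - q) + r *\<^sub>R b)" "norm (q - (p - r *\<^sub>R b)) = norm ((p - q) - r *\<^sub>R b)"
      by (subst norm_minus_commute, simp add: algebra_simps)+
    ultimately have "norm ((p - q) + r *\<^sub>R b) = norm ((p - q) - r *\<^sub>R b)" by simp
    then have "r * ((p - q) \<bullet> b) = 0" unfolding norm_eq inner_add_self inner_diff_self by simp
    then show ?thesis using assms(2) by simp
  qed
  then have "p - q = 0" using euclidean_all_zero_iff by blast
  then show pq: "p = q" by simp
  obtain b :: 'a where b: "b \<in> Basis" using nonempty_Basis by blast
  then have "q + r *\<^sub>R b \<in> sphere q r" using assms(2) by (simp add: dist_norm)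
  then have "q + r *\<^sub>R b \<in> sphere q R" using assms(1) unfolding pq by blast
  then show "r = R" using b assms(2) by (simp add: dist_norm)
qed

text \<open>The cone cuts the plane in the circle around the foot of the apex whose radius
  \<open>R\<close> is the height times the cotangent of \<open>\<theta>\<close>, and a circle
  determines its center and radius.\<close>

lemma cone_apex_eq:
  assumes \<theta>: "0 < \<theta>" "\<theta> < pi / 2" and ca: "cone_apex \<theta> Q a" and ic: "inscribed_circle Q p r"
  shows "a = lift p (tan \<theta> * r)"
proof -
  from ca obtain p' r' where "inscribed_circle Q p' r'" and a3: "0 < a$3"
    and S': "revolution_cone a \<theta> \<inter> {x. x$3 = 0} = embed ` sphere p' r'" unfolding cone_apex_def by blast
  then have S: "revolution_cone a \<theta> \<inter> {x. x$3 = 0} = embed ` sphere p r" using inscribed_circle_unique[OF ic] by metis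
  have r: "r > 0" using ic by (cases Q) auto
  have sc: "sin \<theta> > 0" "cos \<theta> > 0" using \<theta> by (auto intro: sin_gt_zero2 cos_gt_zero)
  have e: "embed x = lift x 0" for x by (simp add: embed_def lift_def)
  define q :: "real^2" where "q = vector [a$1, a$2]"
  define R where "R = a$3 * cos \<theta> / sin \<theta>"
  have R: "R > 0" using sc a3 by (simp add: R_def)
  have "x \<in> sphere p r \<longleftrightarrow> x \<in> sphere q R" for x
  proof -
    have "x \<in> sphere p r \<longleftrightarrow> embed x \<in> embed ` sphere p r" by (auto simp: e lift_eq_iff)
    also have "\<dots> \<longleftrightarrow> a$3 = sin \<theta> * norm (lift x 0 - a)" unfolding S[symmetric] using a3 by (auto simp: revolution_cone_def e)
    also have "\<dots> \<longleftrightarrow> (a$3)^2 = (sin \<theta> * norm (lift x 0 - a))^2"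
      using a3 sc by (auto simp: power2_eq_iff_nonneg)
    also have "(sin \<theta> * norm (lift x 0 - a))^2 = (sin \<theta>)^2 * ((norm (x - q))^2 + (a$3)^2)"
      unfolding power_mult_distrib power2_norm_eq_inner by (simp add: inner3 inner2 q_def power2_eq_square)
    also have "(a$3)^2 = (sin \<theta>)^2 * ((norm (x - q))^2 + (a$3)^2) \<longleftrightarrow> (a$3)^2 * (1 - (sin \<theta>)^2) = (sin \<theta>)^2 * (norm (x - q))^2"
      by (auto simp: algebra_simps)
    also have "1 - (sin \<theta>)^2 = (cos \<theta>)^2" by (simp add: cos_squared_eq)
    also have "(a$3)^2 * (cos \<theta>)^2 = (sin \<theta>)^2 * (norm (x - q))^2 \<longleftrightarrow> R^2 = (norm (x - q))^2"
      using sc unfolding R_def by (simp add: power_mult_distrib power_divide field_simps)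
    also have "\<dots> \<longleftrightarrow> R = norm (x - q)" using R by (auto simp: power2_eq_iff_nonneg)
    also have "\<dots> \<longleftrightarrow> x \<in> sphere q R" by (auto simp: dist_norm norm_minus_commute)
    finally show ?thesis .
  qed
  then have "sphere p r = sphere q R" by blast
  note u = sphere_center_unique[OF this r]
  have "a$3 = tan \<theta> * r" unfolding u(2) R_def tan_def using sc by simp
  then show ?thesis unfolding u(1) by (simp add: eq3_iff q_def)
qed

lemma inscribed_circle_rotate: "inscribed_circle (A, B, C, D) p r \<longleftrightarrow> inscribed_circle (B, C, D, A) p r"
  by auto

text \<open>The unsigned form of tangency, for nets with two rows or two columns, where a common
  orientation may not exist.\<close>

lemma touches_side_line:
  fixes n :: "real^2"
  assumes t: "touches_side p r A B" and n: "norm n = 1" "n \<bullet> A = c" "n \<bullet> B = c"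
  shows "(n \<bullet> p - c)^2 = r^2"
proof -
  obtain t where t: "(p - (A + t *\<^sub>R (B - A))) \<bullet> (B - A) = 0"
    "(p - (A + t *\<^sub>R (B - A))) \<bullet> (p - (A + t *\<^sub>R (B - A))) = r^2" "A \<noteq> B" by (rule touches_sideE[OF assms(1)])
  define w where "w = p - (A + t *\<^sub>R (B - A))"
  define d where "d = B - A"
  have w: "w \<bullet> d = 0" "w \<bullet> w = r^2" "n \<bullet> d = 0" and d: "d \<noteq> 0" using t n by (simp_all add: w_def d_def inner_diff_right)
  have "n \<bullet> w = n \<bullet> p - c" using n by (simp add: w_def inner_diff_right inner_add_right)
  moreover have "rot 1 n \<bullet> w = 0"
  proof (rule ccontr)
    assume "rot 1 n \<bullet> w \<noteq> 0"
    then show False using inner_eq_imp_zero[of 1 n w d] w d by simp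
  qed
  then have "(n \<bullet> w)^2 = (n \<bullet> n) * (w \<bullet> w)" using lagrange_identity[of n w] by simp
  ultimately show ?thesis using w n by (simp add: dot_square_norm)
qed

lemma collinear_on_line2:
  fixes S :: "(real^2) set"
  assumes "collinear S"
  shows "\<exists>n c. norm n = 1 \<and> (\<forall>x\<in>S. n \<bullet> x = c)"
proof -
  obtain w where w: "\<And>x y. x \<in> S \<Longrightarrow> y \<in> S \<Longrightarrow> \<exists>t. y = x + t *\<^sub>R w" using collinear_line[OF assms] by blast
  have "\<exists>n. n \<noteq> 0 \<and> (\<forall>x\<in>{w}. n \<bullet> x = 0)" by (intro orthogonal_to_fewer) auto
  then obtain n where n: "n \<noteq> 0" "n \<bullet> w = 0" by blast
  define n' where "n' = sgn n"
  have n': "norm n' = 1" "n' \<bullet> w = 0" using n by (simp_all add: n'_def norm_sgn sgn_div_norm)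
  show ?thesis
  proof (cases "S = {}")
    case True then show ?thesis using n' by blast
  next
    case False
    then obtain x where x: "x \<in> S" by blast
    have "n' \<bullet> y = n' \<bullet> x" if y: "y \<in> S" for y
    proof -
      obtain t where "y = x + t *\<^sub>R w" using w[OF x y] by blast
      then show ?thesis using n' by (simp add: inner_add_right)
    qed
    then show ?thesis using n' by blast
  qed
qed

text \<open>The circles that touch two fixed lines have their apexes in the two planes over the bisectors.\<close>

lemma strip_hyperboloid:
  assumes \<theta>: "0 < \<theta>" "\<theta> < pi / 2" and n: "norm n = 1" "norm n' = 1"
    and Qs: "\<And>A B C D. (A, B, C, D) \<in> Qs \<Longrightarrow> n \<bullet> A = c \<and> n \<bullet> B = c \<and> n' \<bullet> C = c' \<and> n' \<bullet> D = c'"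
  shows "\<exists>S. limit_one_sheeted_hyperboloid S \<and> {a. \<exists>Q\<in>Qs. cone_apex \<theta> Q a} \<subseteq> S"
proof (cases "{a. \<exists>Q\<in>Qs. cone_apex \<theta> Q a} = {}")
  case True
  have ax: "axis 1 1 \<noteq> (0 :: real^3)" by (simp add: axis_eq_0_iff)
  show ?thesis unfolding True
    by (rule limit_hyperboloid_of_split_form[OF split_form_plane_pair(1)[OF ax ax, of 0 0] split_form_plane_pair(2)[OF ax ax, of 0 0]]) simp
next
  case False
  \<comment> \<open>Both squared distances equal \<open>r^2\<close>; their difference factors into
    the two vertical planes over the bisectors.\<close>
  define F where "F x = (lift (n - n') 0 \<bullet> x + - (c - c')) * (lift (n + n') 0 \<bullet> x + - (c + c')) + (0 \<bullet> x + 0) * (0 \<bullet> x + 0)" for x :: "real^3"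
  have sf: "split_form F" unfolding split_form_def F_def by blast
  have Fl: "F (lift x z) = (n \<bullet> x - c)^2 - (n' \<bullet> x - c')^2" for x z
    unfolding F_def by (simp add: inner3 inner2 power2_eq_square algebra_simps)
  have sides: "(n \<bullet> p - c)^2 = r^2" "(n' \<bullet> p - c')^2 = r^2" if "(A, B, C, D) \<in> Qs" "inscribed_circle (A, B, C, D) p r" for A B C D p r
    using that Qs[OF that(1)] touches_side_line[of p r A B n c] touches_side_line[of p r C D n' c'] n by auto
  show ?thesis
  proof (rule limit_hyperboloid_of_split_form[OF sf])
    fix a assume "a \<in> {a. \<exists>Q\<in>Qs. cone_apex \<theta> Q a}"
    then obtain A B C D where Q: "(A, B, C, D) \<in> Qs" "cone_apex \<theta> (A, B, C, D) a" by auto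
    then obtain p r where ic: "inscribed_circle (A, B, C, D) p r" by (auto simp only: cone_apex_def)
    show "F a = 0" unfolding cone_apex_eq[OF \<theta> Q(2) ic] Fl using sides[OF Q(1) ic] by simp
  next
    obtain a A B C D where Q: "(A, B, C, D) \<in> Qs" "cone_apex \<theta> (A, B, C, D) a" using False by auto
    then obtain p r where ic: "inscribed_circle (A, B, C, D) p r" by (auto simp only: cone_apex_def)
    then have nc: "\<not> collinear {A, B, C}" by simp
    note l = Qs[OF Q(1)]
    \<comment> \<open>With \<open>n \<bullet> C = c\<close> the points \<open>A\<close>,
      \<open>B\<close>, \<open>C\<close> would be collinear. So \<open>F\<close> does not vanish at
      the lift of \<open>C\<close>.\<close>
    have "n \<bullet> C \<noteq> c"
    proof
      assume "n \<bullet> C = c"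
      then have z: "n \<bullet> (B - A) = 0" "n \<bullet> (C - B) = 0" using l by (simp_all add: inner_diff_right)
      have "rot 1 (B - A) \<bullet> (C - B) \<noteq> 0" using nc collinear3_iff2 by blast
      then have "n = 0" using inner_eq_imp_zero[of 1 "B - A" "C - B" n] z by (simp add: inner_commute)
      then show False using n by simp
    qed
    then have "F (lift C 0) \<noteq> 0" unfolding Fl using l by simp
    then show "\<exists>x. F x \<noteq> 0" by blast
  qed
qed

section \<open>The theorem\<close>

text \<open>A negative side length lists the same quadrilateral from the opposite corner; this
  reduces \<open>c < 0\<close> to \<open>c > 0\<close>.\<close>

lemma net_square_reverse:
  "net_square f i j c = (A, B, C, D) \<Longrightarrow> net_square f (i + c) (j + c) (- c) = (C, D, A, B)"
  by (auto simp: net_square_def)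

lemma circumscribed_net_square_reverse:
  assumes "circumscribed (net_square f (i + c) (j + c) (- c))"
  shows "circumscribed (net_square f i j c)"
proof -
  obtain A B C D where Q: "net_square f i j c = (A, B, C, D)" by (cases "net_square f i j c") auto
  obtain p r where "inscribed_circle (C, D, A, B) p r"
    using assms unfolding net_square_reverse[OF Q] circumscribed_def by blast
  then have "inscribed_circle (A, B, C, D) p r"
    using inscribed_circle_rotate[of A B C D p r] inscribed_circle_rotate[of B C D A p r] by blast
  then show ?thesis unfolding Q circumscribed_def by blast
qed

lemma is_net_square_reverse: "is_net_square P i j c \<Longrightarrow> is_net_square P (i + c) (j + c) (- c)"
  by (auto simp: is_net_square_def)

lemma small_net_square:
  assumes "is_net_square (rectangle m1 m2 n1 n2) i j c" "\<not> (m1 + 4 \<le> m2 \<and> n1 + 4 \<le> n2)"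
  shows "c = 1 \<or> c = -1"
proof -
  have r: "odd c" "m1 < i" "i < m2" "m1 < i + c" "i + c < m2" "n1 < j" "j < n2" "n1 < j + c" "j + c < n2"
    using assms(1) by (auto simp: is_net_square_def mem_rectangle)
  then have "\<bar>c\<bar> \<le> 1" using assms(2) by linarith
  moreover have "c \<noteq> 0" using r(1) by auto
  ultimately show ?thesis by linarith
qed

theorem net_squares_circumscribed:
  assumes net: "checkerboard_IC_net (rectangle m1 m2 n1 n2) f" and ns: "is_net_square (rectangle m1 m2 n1 n2) i j c"
  shows "circumscribed (net_square f i j c)"
proof -
  have pos: "circumscribed (net_square f i j c)" if ns: "is_net_square (rectangle m1 m2 n1 n2) i j c" and c: "c > 0" for i j c
  proof (cases "m1 + 4 \<le> m2 \<and> n1 + 4 \<le> n2")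
    case True
    then obtain s u v h k where "ic_net m1 m2 n1 n2 f s u v h k" using ic_net_of_checkerboard[OF net] by blast
    then interpret ic_net m1 m2 n1 n2 f s u v h k .
    have sq: "sq i (i + c) j (j + c)" using ns c by (auto simp: sq_def is_net_square_def mem_rectangle)
    then show ?thesis using circle_exists[OF sq] inscribed[OF sq] unfolding circumscribed_def net_square_def by blast
  next
    case False
    then have "c = 1" using small_net_square[OF ns False] c by auto
    then show ?thesis using net ns by (simp add: checkerboard_IC_net_def)
  qed
  show ?thesis
  proof (cases "c > 0")
    case True then show ?thesis using pos ns by blast
  next
    case False
    have "c \<noteq> 0" using ns by (auto simp: is_net_square_def)
    then have "0 < - c" using False by simp
    then show ?thesis by (rule circumscribed_net_square_reverse[OF pos[OF is_net_square_reverse[OF ns]]])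
  qed
qed

text \<open>This is the case \<open>l = - c\<close>: the four joining lines are the two diagonals,
  each taken twice.\<close>

lemma perspective_diagonals:
  assumes "circumscribed (net_square f i j c)"
  shows "perspective (net_square f i j c) (net_square f (i + c) (j + c) (- c))"
proof -
  obtain A B C D where Q: "net_square f i j c = (A, B, C, D)" by (cases "net_square f i j c") auto
  obtain p r where "inscribed_circle (A, B, C, D) p r" using assms Q by (auto simp only: circumscribed_def)
  then obtain X where "X \<in> affine hull {A, C}" "X \<in> affine hull {B, D}" by (rule inscribed_circle_diagonals)
  then show ?thesis unfolding Q net_square_reverse[OF Q] by (auto simp: insert_commute)
qed

lemma diagonals_on_conics:
  fixes \<pi> :: "int \<Rightarrow> int"
  assumes net: "checkerboard_IC_net (rectangle m1 m2 n1 n2) f"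
    and iso: "\<And>i j. \<bar>\<pi> j - \<pi> i\<bar> = \<bar>j - i\<bar>" and par: "\<And>i j. odd (j - i) \<Longrightarrow> even (min i j + min (\<pi> i) (\<pi> j))"
  shows "\<exists>S. conic S \<and> {f i (\<pi> i) | i. (i, \<pi> i) \<in> rectangle m1 m2 n1 n2} \<subseteq> S"
proof (cases "m1 + 4 \<le> m2 \<and> n1 + 4 \<le> n2")
  case True
  then obtain s u v h k where "ic_net m1 m2 n1 n2 f s u v h k" using ic_net_of_checkerboard[OF net] by blast
  then interpret ic_net m1 m2 n1 n2 f s u v h k .
  show ?thesis by (rule diagonal_conic[OF iso par])
next
  case False
  define I where "I = {i. (i, \<pi> i) \<in> rectangle m1 m2 n1 n2}"
  have set: "{f i (\<pi> i) | i. (i, \<pi> i) \<in> rectangle m1 m2 n1 n2} = (\<lambda>i. f i (\<pi> i)) ` I" by (auto simp: I_def)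
  have I: "I \<subseteq> {m1<..<m2}" "\<pi> ` I \<subseteq> {n1<..<n2}" by (auto simp: I_def mem_rectangle)
  have fin: "finite I" using I(1) finite_subset by blast
  \<comment> \<open>A diagonal meets each row and each column at most once, so few rows or columns
    leave few points.\<close>
  have inj: "inj_on \<pi> I" using iso by (metis abs_eq_0_iff inj_onI right_minus_eq)
  have "card I \<le> card {m1<..<m2}" using I(1) by (intro card_mono) auto
  moreover have "card (\<pi> ` I) \<le> card {n1<..<n2}" using I(2) by (intro card_mono) auto
  ultimately have "card I \<le> 5" using False card_image[OF inj] by auto
  then show ?thesis unfolding set
    using card_image_le[OF fin, of "\<lambda>i. f i (\<pi> i)"] fin by (intro conic_through_five_points) auto
qed

lemma apexes_on_hyperboloid:
  fixes e :: bool
  assumes net: "checkerboard_IC_net (rectangle m1 m2 n1 n2) f" and \<theta>: "0 < \<theta>" "\<theta> < pi / 2"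
  shows "\<exists>S. limit_one_sheeted_hyperboloid S \<and>
    {a. \<exists>i j. is_unit_square (rectangle m1 m2 n1 n2) i j \<and> even i = e \<and> even j = e \<and> cone_apex \<theta> (unit_square f i j) a} \<subseteq> S"
    (is "\<exists>S. _ \<and> ?A \<subseteq> S")
proof (cases "m1 + 4 \<le> m2 \<and> n1 + 4 \<le> n2")
  case True
  then obtain s u v h k where "ic_net m1 m2 n1 n2 f s u v h k" using ic_net_of_checkerboard[OF net] by blast
  then interpret ic_net m1 m2 n1 n2 f s u v h k .
  have "?A \<subseteq> {lift (cen i j) (tan \<theta> * rad i j) | i j. is_unit_square P i j \<and> even i = e \<and> even j = e}"
    using cone_apex_eq[OF \<theta> _ inscribed_unit] by blast
  then show ?thesis using apex_hyperboloid[of "tan \<theta>" e] by blast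
next
  case False
  let ?P = "rectangle m1 m2 n1 n2"
  have row: "\<exists>n c. norm n = 1 \<and> (\<forall>i. (i, j) \<in> ?P \<longrightarrow> n \<bullet> f i j = c)" for j
  proof -
    obtain n c where "norm n = 1" "\<forall>x\<in>{f i j | i. (i, j) \<in> ?P}. n \<bullet> x = c"
      using collinear_on_line2[OF net[unfolded checkerboard_IC_net_def, THEN conjunct2, THEN conjunct1, THEN spec]] by meson
    then show ?thesis by (intro exI[of _ n] exI[of _ c]) auto
  qed
  have col: "\<exists>n c. norm n = 1 \<and> (\<forall>j. (i, j) \<in> ?P \<longrightarrow> n \<bullet> f i j = c)" for i
  proof -
    obtain n c where "norm n = 1" "\<forall>x\<in>{f i j | j. (i, j) \<in> ?P}. n \<bullet> x = c"
      using collinear_on_line2[OF net[unfolded checkerboard_IC_net_def, THEN conjunct1, THEN spec]] by meson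
    then show ?thesis by (intro exI[of _ n] exI[of _ c]) auto
  qed
  show ?thesis
  proof (cases "n1 + 4 \<le> n2")
    case True
    then have m: "m2 \<le> m1 + 3" using False by simp
    \<comment> \<open>The vertices are listed starting from column \<open>i + 1\<close>, so that the
      first and third sides lie on the two fixed columns.\<close>
    define Qs where "Qs = {(f (i + 1) j, f (i + 1) (j + 1), f i (j + 1), f i j) | i j. is_unit_square ?P i j}"
    define i0 where "i0 = m1 + 1"
    obtain n c where n: "norm n = 1" "\<And>j. (i0 + 1, j) \<in> ?P \<Longrightarrow> n \<bullet> f (i0 + 1) j = c" using col[of "i0 + 1"] by blast
    obtain n' c' where n': "norm n' = 1" "\<And>j. (i0, j) \<in> ?P \<Longrightarrow> n' \<bullet> f i0 j = c'" using col[of i0] by blast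
    have ii: "i = i0" if "is_unit_square ?P i j" for i j using that m by (simp add: is_unit_square_rectangle i0_def)
    have "\<exists>S. limit_one_sheeted_hyperboloid S \<and> {a. \<exists>Q\<in>Qs. cone_apex \<theta> Q a} \<subseteq> S"
    proof (rule strip_hyperboloid[OF \<theta> n(1) n'(1)])
      fix A B C D assume "(A, B, C, D) \<in> Qs"
      then obtain i j where q: "is_unit_square ?P i j" "A = f (i + 1) j" "B = f (i + 1) (j + 1)" "C = f i (j + 1)" "D = f i j" by (auto simp: Qs_def)
      show "n \<bullet> A = c \<and> n \<bullet> B = c \<and> n' \<bullet> C = c' \<and> n' \<bullet> D = c'"
        using q ii[OF q(1)] by (auto intro!: n(2) n'(2) simp: is_unit_square_rectangle mem_rectangle)
    qed
    moreover have "?A \<subseteq> {a. \<exists>Q\<in>Qs. cone_apex \<theta> Q a}"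
    proof
      fix a assume "a \<in> ?A"
      then obtain i j where q: "is_unit_square ?P i j" "cone_apex \<theta> (unit_square f i j) a" by blast
      then have "cone_apex \<theta> (f (i + 1) j, f (i + 1) (j + 1), f i (j + 1), f i j) a"
        unfolding cone_apex_def net_square_def using inscribed_circle_rotate by metis
      then show "a \<in> {a. \<exists>Q\<in>Qs. cone_apex \<theta> Q a}" using q(1) unfolding Qs_def by blast
    qed
    ultimately show ?thesis by (meson subset_trans)
  next
    case False
    define Qs where "Qs = {(f i j, f (i + 1) j, f (i + 1) (j + 1), f i (j + 1)) | i j. is_unit_square ?P i j}"
    define j0 where "j0 = n1 + 1"
    obtain n c where n: "norm n = 1" "\<And>i. (i, j0) \<in> ?P \<Longrightarrow> n \<bullet> f i j0 = c" using row[of j0] by blast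
    obtain n' c' where n': "norm n' = 1" "\<And>i. (i, j0 + 1) \<in> ?P \<Longrightarrow> n' \<bullet> f i (j0 + 1) = c'" using row[of "j0 + 1"] by blast
    have jj: "j = j0" if "is_unit_square ?P i j" for i j using that False by (simp add: is_unit_square_rectangle j0_def)
    have "\<exists>S. limit_one_sheeted_hyperboloid S \<and> {a. \<exists>Q\<in>Qs. cone_apex \<theta> Q a} \<subseteq> S"
    proof (rule strip_hyperboloid[OF \<theta> n(1) n'(1)])
      fix A B C D assume "(A, B, C, D) \<in> Qs"
      then obtain i j where q: "is_unit_square ?P i j" "A = f i j" "B = f (i + 1) j" "C = f (i + 1) (j + 1)" "D = f i (j + 1)" by (auto simp: Qs_def)
      show "n \<bullet> A = c \<and> n \<bullet> B = c \<and> n' \<bullet> C = c' \<and> n' \<bullet> D = c'"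
        using q jj[OF q(1)] by (auto intro!: n(2) n'(2) simp: is_unit_square_rectangle mem_rectangle)
    qed
    moreover have "?A \<subseteq> {a. \<exists>Q\<in>Qs. cone_apex \<theta> Q a}"
      unfolding Qs_def net_square_def by blast
    ultimately show ?thesis by (meson subset_trans)
  qed
qed

theorem centers_circle_conical:
  assumes net: "checkerboard_IC_net (rectangle m1 m2 n1 n2) f"
  shows "circle_conical_net {(i, j). is_unit_square (rectangle m1 m2 n1 n2) i j} (net_of_centers f)"
proof (cases "m1 + 4 \<le> m2 \<and> n1 + 4 \<le> n2")
  case True
  then obtain s u v h k where "ic_net m1 m2 n1 n2 f s u v h k" using ic_net_of_checkerboard[OF net] by blast
  then interpret ic_net m1 m2 n1 n2 f s u v h k .
  have z: "net_of_centers f i j = cen i j" if "is_unit_square P i j" for i j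
    unfolding net_of_centers_def using incenter_eq[OF inscribed_unit[OF that]] .
  show ?thesis
    unfolding circle_conical_net_def circular_net_def conical_net_def
  proof (intro conjI allI impI)
    fix i j assume "{(i, j), (i + 1, j + 1), (i, j + 2), (i - 1, j + 1)} \<subseteq> {(i, j). is_unit_square P i j}"
    then have us: "is_unit_square P i j" "is_unit_square P (i + 1) (j + 1)" "is_unit_square P i (j + 2)" "is_unit_square P (i - 1) (j + 1)"
      by blast+
    show "concyclic {net_of_centers f i j, net_of_centers f (i + 1) (j + 1), net_of_centers f i (j + 2), net_of_centers f (i - 1) (j + 1)}"
      unfolding us[THEN z] by (rule centers_concyclic[OF us])
  next
    fix i j assume "{(i, j), (i + 1, j + 1), (i - 1, j + 1), (i - 1, j - 1), (i + 1, j - 1)} \<subseteq> {(i, j). is_unit_square P i j}"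
    then have us: "is_unit_square P i j" "is_unit_square P (i + 1) (j + 1)" "is_unit_square P (i - 1) (j + 1)"
      "is_unit_square P (i - 1) (j - 1)" "is_unit_square P (i + 1) (j - 1)" by blast+
    note zz = us[THEN z]
    show "angle_at (net_of_centers f (i + 1) (j + 1)) (net_of_centers f i j) (net_of_centers f (i - 1) (j + 1)) +
        angle_at (net_of_centers f (i - 1) (j - 1)) (net_of_centers f i j) (net_of_centers f (i + 1) (j - 1)) = pi"
      unfolding zz by (rule centers_conical(1)[OF us])
    show "angle_at (net_of_centers f (i - 1) (j + 1)) (net_of_centers f i j) (net_of_centers f (i - 1) (j - 1)) +
        angle_at (net_of_centers f (i + 1) (j - 1)) (net_of_centers f i j) (net_of_centers f (i + 1) (j + 1)) = pi"
      unfolding zz by (rule centers_conical(2)[OF us])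
  qed
next
  case False
  \<comment> \<open>With at most two rows or columns neither index pattern occurs, so both
    conditions hold vacuously.\<close>
  then show ?thesis
    unfolding circle_conical_net_def circular_net_def conical_net_def by (auto simp: is_unit_square_rectangle)
qed

theorem theorem3p1:
  fixes m1 m2 n1 n2 :: int and f :: "int \<Rightarrow> int \<Rightarrow> real^2" and P :: "(int \<times> int) set"
  assumes "P = rectangle m1 m2 n1 n2" and "checkerboard_IC_net P f"
  shows
    "(\<forall>i j c. is_net_square P i j c \<longrightarrow> circumscribed (net_square f i j c)) \<and>
     (\<forall>i j c l. odd l \<and> is_net_square P i j c \<and> is_net_square P (i - l) (j - l) (c + 2 * l) \<longrightarrow>
        perspective (net_square f i j c) (net_square f (i - l) (j - l) (c + 2 * l))) \<and>
     (\<forall>k. odd k \<longrightarrow> (\<exists>S. conic S \<and> {f i j | i j. (i, j) \<in> P \<and> i + j = k} \<subseteq> S)) \<and>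
     (\<forall>k. even k \<longrightarrow> (\<exists>S. conic S \<and> {f i j | i j. (i, j) \<in> P \<and> i - j = k} \<subseteq> S)) \<and>
     (\<forall>i j c. even (i + j) \<and> even c \<and>
        is_unit_square P (i - c) j \<and> is_unit_square P (i + c) j \<and>
        is_unit_square P i (j - c) \<and> is_unit_square P i (j + c) \<longrightarrow>
        d_C (unit_square f (i - c) j) (unit_square f (i + c) j) =
        d_C (unit_square f i (j - c)) (unit_square f i (j + c))) \<and>
     (\<forall>\<theta>. 0 < \<theta> \<and> \<theta> < pi / 2 \<longrightarrow>
        (\<exists>S. limit_one_sheeted_hyperboloid S \<and>
           {a. \<exists>i j. is_unit_square P i j \<and> even i \<and> even j \<and> cone_apex \<theta> (unit_square f i j) a} \<subseteq> S) \<and>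
        (\<exists>S. limit_one_sheeted_hyperboloid S \<and>
           {a. \<exists>i j. is_unit_square P i j \<and> odd i \<and> odd j \<and> cone_apex \<theta> (unit_square f i j) a} \<subseteq> S)) \<and>
     circle_conical_net {(i, j). is_unit_square P i j} (net_of_centers f)"
proof -
  let ?P = "rectangle m1 m2 n1 n2"
  have net: "checkerboard_IC_net ?P f" using assms by simp
  have big: "\<exists>s u v h k. ic_net m1 m2 n1 n2 f s u v h k" if "m1 + 4 \<le> m2 \<and> n1 + 4 \<le> n2"
    using ic_net_of_checkerboard[OF net] that by blast
  show ?thesis unfolding assms(1)
  proof (intro conjI allI impI; (elim conjE)?)
    show "circumscribed (net_square f i j c)" if "is_net_square ?P i j c" for i j c
      by (rule net_squares_circumscribed[OF net that])
    show "perspective (net_square f i j c) (net_square f (i - l) (j - l) (c + 2 * l))"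
      if l: "odd l" and ns: "is_net_square ?P i j c" "is_net_square ?P (i - l) (j - l) (c + 2 * l)" for i j c l
    proof (cases "l = - c")
      case True
      then show ?thesis using perspective_diagonals[OF net_squares_circumscribed[OF net ns(1)]] by simp
    next
      case False
      have "m1 + 4 \<le> m2 \<and> n1 + 4 \<le> n2"
      \<comment> \<open>In a small net both side lengths are \<open>1\<close> or \<open>-1\<close>,
        which forces \<open>l = 0\<close> or \<open>l = - c\<close>.\<close>
      proof (rule ccontr)
        assume "\<not> (m1 + 4 \<le> m2 \<and> n1 + 4 \<le> n2)"
        from small_net_square[OF ns(1) this] small_net_square[OF ns(2) this] show False using False l by auto
      qed
      then obtain s u v h k where "ic_net m1 m2 n1 n2 f s u v h k" using big by blast
      then show ?thesis using ic_net.perspective_net_squares[OF _ l ns False] by blast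
    qed
    show "\<exists>S. conic S \<and> {f i j | i j. (i, j) \<in> ?P \<and> i + j = k} \<subseteq> S" if k: "odd k" for k
    proof -
      have iso: "\<bar>(k - j) - (k - i)\<bar> = \<bar>j - i\<bar>" for i j by linarith
      \<comment> \<open>The sum of the minima is \<open>k - |j - i|\<close>; here the parity of the
        diagonal enters.\<close>
      have ev: "even (min i j + min (k - i) (k - j))" if "odd (j - i)" for i j
      proof -
        have "min i j + min (k - i) (k - j) = k - (j - i) \<or> min i j + min (k - i) (k - j) = k - (i - j)"
          by (simp add: min_def)
        then show ?thesis using that k by presburger
      qed
      have "\<exists>S. conic S \<and> {f i (k - i) | i. (i, k - i) \<in> ?P} \<subseteq> S"
        by (rule diagonals_on_conics[where \<pi> = "\<lambda>i. k - i", OF net iso ev])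
      moreover have "{f i j | i j. (i, j) \<in> ?P \<and> i + j = k} \<subseteq> {f i (k - i) | i. (i, k - i) \<in> ?P}"
      proof
        fix x assume "x \<in> {f i j | i j. (i, j) \<in> ?P \<and> i + j = k}"
        then obtain i j where x: "x = f i j" "(i, j) \<in> ?P" "i + j = k" by blast
        then have "j = k - i" by simp
        then show "x \<in> {f i (k - i) | i. (i, k - i) \<in> ?P}" using x by blast
      qed
      ultimately show ?thesis by (meson subset_trans)
    qed
    show "\<exists>S. conic S \<and> {f i j | i j. (i, j) \<in> ?P \<and> i - j = k} \<subseteq> S" if k: "even k" for k
    proof -
      have iso: "\<bar>(j - k) - (i - k)\<bar> = \<bar>j - i\<bar>" for i j by linarith
      have ev: "even (min i j + min (i - k) (j - k))" if "odd (j - i)" for i j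
      proof -
        have "min i j + min (i - k) (j - k) = 2 * i - k \<or> min i j + min (i - k) (j - k) = 2 * j - k"
          by (simp add: min_def)
        then show ?thesis using that k by presburger
      qed
      have "\<exists>S. conic S \<and> {f i (i - k) | i. (i, i - k) \<in> ?P} \<subseteq> S"
        by (rule diagonals_on_conics[where \<pi> = "\<lambda>i. i - k", OF net iso ev])
      moreover have "{f i j | i j. (i, j) \<in> ?P \<and> i - j = k} \<subseteq> {f i (i - k) | i. (i, i - k) \<in> ?P}"
      proof
        fix x assume "x \<in> {f i j | i j. (i, j) \<in> ?P \<and> i - j = k}"
        then obtain i j where x: "x = f i j" "(i, j) \<in> ?P" "i - j = k" by blast
        then have "j = i - k" by simp
        then show "x \<in> {f i (i - k) | i. (i, i - k) \<in> ?P}" using x by blast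
      qed
      ultimately show ?thesis by (meson subset_trans)
    qed
    show "d_C (unit_square f (i - c) j) (unit_square f (i + c) j) = d_C (unit_square f i (j - c)) (unit_square f i (j + c))"
      if c: "even c" and us: "is_unit_square ?P (i - c) j" "is_unit_square ?P (i + c) j" "is_unit_square ?P i (j - c)" "is_unit_square ?P i (j + c)" for i j c
    proof (cases "c = 0")
      case False
      \<comment> \<open>A nonzero even \<open>c\<close> is at least 2 in absolute value.\<close>
      have "m1 + 4 \<le> m2 \<and> n1 + 4 \<le> n2" using us False c by (auto simp: is_unit_square_rectangle)
      then obtain s u v h k where "ic_net m1 m2 n1 n2 f s u v h k" using big by blast
      then show ?thesis using ic_net.ivory[OF _ c us] by blast
    qed simp
    show "\<exists>S. limit_one_sheeted_hyperboloid S \<and> {a. \<exists>i j. is_unit_square ?P i j \<and> even i \<and> even j \<and> cone_apex \<theta> (unit_square f i j) a} \<subseteq> S"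
      if "0 < \<theta>" "\<theta> < pi / 2" for \<theta>
      using apexes_on_hyperboloid[OF net that, of True] by simp
    show "\<exists>S. limit_one_sheeted_hyperboloid S \<and> {a. \<exists>i j. is_unit_square ?P i j \<and> odd i \<and> odd j \<and> cone_apex \<theta> (unit_square f i j) a} \<subseteq> S"
      if "0 < \<theta>" "\<theta> < pi / 2" for \<theta>
      using apexes_on_hyperboloid[OF net that, of False] by simp
    show "circle_conical_net {(i, j). is_unit_square ?P i j} (net_of_centers f)"
      by (rule centers_circle_conical[OF net])
  qed
qed

end
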